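(* Let $(M,L)$ be a Finsler manifold of dimension $n\ge3$ with non-zero horizontal Ricci tensor $\mathrm{Ric}$. The m-projective curvature tensor $\mathbb H$ has the following properties, for all $\pi$-vector fields $\overline X,\overline Y,\overline Z,\overline W$: (a) $\mathbb H(\overline X,\overline Y,\overline Z,\overline W)=-\mathbb H(\overline Y,\overline X,\overline Z,\overline W)$. (b) $\mathbb H(\overline X,\overline Y,\overline Z,\overline W)=-\mathbb H(\overline X,\overline Y,\overline W,\overline Z)$. (c) $\mathfrak S_{\overline X,\overline Y,\overline Z}\{\mathbb H(\overline X,\overline Y)\overline Z\}=\mathfrak S_{\overline X,\overline Y,\overline Z}\Big\{T(\widehat R(\overline X,\overline Y),\overline Z)-\frac{1}{2(n-1)}\big[\mathrm{Ric}(\overline X,\overline Z)\overline Y-\mathrm{Ric}(\overline Y,\overline Z)\overline X+g(\overline X,\overline Z)\mathrm{Ric}_o\overline Y-g(\overline Y,\overline Z)\mathrm{Ric}_o\overline X\big]\Big\}$. (d) $\mathfrak S_{\overline X,\overline Y,\overline Z}\{(\nabla_{\beta\overline X}\mathbb H)(\overline Y,\overline Z,\overline W)\}=-\mathfrak S_{\overline X,\overline Y,\overline Z}\Big\{P(\overline X,\widehat R(\overline Y,\overline Z))\overline W+\frac{1}{2(n-1)}\big[(\nabla_{\beta\overline X}\mathrm{Ric})(\overline Y,\overline W)\overline Z-(\nabla_{\beta\overline X}\mathrm{Ric})(\overline Z,\overline W)\overline Y+g(\overline Y,\overline W)(\nabla_{\beta\overline X}\mathrm{Ric}_o)(\overline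 Z)-g(\overline Z,\overline W)(\nabla_{\beta\overline X}\mathrm{Ric}_o)(\overline Y)\big]\Big\}$. (e) $(\nabla_{\gamma\overline\eta}\mathbb H)(\overline X,\overline Y,\overline Z)=0$. (f) If $\overline\zeta$ is a concurrent $\pi$-vector field, then $\mathbb H(\overline X,\overline Y)\overline\zeta=\frac{1}{2(n-1)}\{g(\overline Y,\overline\zeta)\mathrm{Ric}_o\overline X-g(\overline X,\overline\zeta)\mathrm{Ric}_o\overline Y\}$.
   Context: Setting. $(M,L)$ is a smooth Finsler manifold of dimension $n$ (with positive definite Finsler metric), $\mathcal{T}M$ is the bundle of nonzero tangent vectors, $\pi:\mathcal{T}M\to M$, and $\pi^{-1}(TM)\to\mathcal{T}M$ is the pullback bundle, whose sections $\overline X$ are called $\pi$-vector fields. $g$ is the Finsler metric on $\pi^{-1}(TM)$ defined by $L$ (in coordinates $g_{ij}=\frac12\partial^2L^2/\partial y^i\partial y^j$). $\overline\eta(u)=(u,u)$ is the fundamental $\pi$-vector field. $\rho:T(\mathcal{T}M)\to\pi^{-1}(TM)$ is the morphism induced by $d\pi$ and $\gamma:\pi^{-1}(TM)\to T(\mathcal{T}M)$ is the vertical lift. A linear connection $D$ on $\pi^{-1}(TM)$ is regular if $T_u(\mathcal{T}M)=V_u\oplus H_u$ for all $u$, where $V_u=\ker d\pi$ and $H_u=\{X: D_X\overline\eta=0\}$; then $\beta:=(\rho|_{H})^{-1}$ is its horizontal map. The Cartan connection $\nabla$ is the unique regular connection with $\nabla g=0$, $Q(\overline X,\overline Y):=\mathbf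 T(\beta\overline X,\beta\overline Y)=0$, and $T(\overline X,\overline Y):=\mathbf T(\gamma\overline X,\beta\overline Y)$ satisfying $g(T(\overline X,\overline Y),\overline Z)=g(T(\overline X,\overline Z),\overline Y)$, where $\mathbf T(X,Y)=\nabla_X\rho Y-\nabla_Y\rho X-\rho[X,Y]$. Curvature. $\mathbf K(X,Y)\overline Z=-\nabla_X\nabla_Y\overline Z+\nabla_Y\nabla_X\overline Z+\nabla_{[X,Y]}\overline Z$; $R(\overline X,\overline Y)\overline Z=\mathbf K(\beta\overline X,\beta\overline Y)\overline Z$; $P(\overline X,\overline Y)\overline Z=\mathbf K(\beta\overline X,\gamma\overline Y)\overline Z$; $\widehat R(\overline X,\overline Y)=R(\overline X,\overline Y)\overline\eta$. The horizontal Ricci tensor is $\mathrm{Ric}(\overline X,\overline Y)=\mathrm{trace}\{\overline Z\mapsto R(\overline X,\overline Z)\overline Y\}$; $\mathrm{Ric}_o$ is the $(1,1)$ tensor with $g(\mathrm{Ric}_o\overline X,\overline Y)=\mathrm{Ric}(\overline X,\overline Y)$. The m-projective curvature tensor is $$\mathbb H(\overline X,\overline Y)\overline Z=R(\overline X,\overline Y)\overline Z-\tfrac{1}{2(n-1)}\{\mathrm{Ric}(\overline X,\overline Z)\overline Y-\mathrm{Ric}(\overline Y,\overline Z)\overline X+g(\overline X,\overline Z)\mathrm{Ric}_o\overline Y-g(\overline Y,\overline Z)\mathrm{Ric}_o\overline X\},$$ and $\mathbb H(\overline X,\overline Y,\overline Z,\overline W)=g(\mathbb H(\overline X,\overline Y)\overline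 Z,\overline W)$, while $(\nabla_V\mathbb H)(\overline X,\overline Y,\overline Z)$ is the covariant derivative of $\mathbb H$ along $V$ evaluated on its three arguments. $\mathfrak S_{\overline X,\overline Y,\overline Z}$ denotes the cyclic sum over $\overline X,\overline Y,\overline Z$. A $\pi$-vector field $\overline\zeta$ is concurrent if $\nabla_{\beta\overline X}\overline\zeta=-\overline X$ and $\nabla_{\gamma\overline X}\overline\zeta=0$ for every $\pi$-vector field $\overline X$. *)

theory Defs
  imports "HOL-Analysis.Analysis" "HOL-Library.Function_Algebras"
begin

section \<open>Preliminaries\<close>

text \<open>Pointwise scalar multiplication; together with the pointwise addition of
  \<^theory>\<open>HOL-Library.Function_Algebras\<close> it makes functions into a vector space.\<close>

instantiation "fun" :: (type, real_vector) real_vector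
begin

definition "r *\<^sub>R f = (\<lambda>x. r *\<^sub>R f x)"

instance
  by standard (simp_all add: fun_eq_iff scaleR_fun_def algebra_simps)

end

lemma scaleR_fun_apply [simp]: "(r *\<^sub>R f) x = r *\<^sub>R f x"
  by (simp add: scaleR_fun_def)

text \<open>\<open>C\<^sup>k\<close> via iterated directional derivatives; meaningful for open sets \<open>S\<close> only.\<close>

primrec Ck_on :: "nat \<Rightarrow> 'a::euclidean_space set \<Rightarrow> ('a \<Rightarrow> 'b::real_normed_vector) \<Rightarrow> bool" where
  "Ck_on 0 S f \<longleftrightarrow> continuous_on S f"
| "Ck_on (Suc k) S f \<longleftrightarrow>
     f differentiable_on S \<and> (\<forall>v. Ck_on k S (\<lambda>x. frechet_derivative f (at x) v))"

definition smooth_on :: "'a::euclidean_space set \<Rightarrow> ('a \<Rightarrow> 'b::real_normed_vector) \<Rightarrow> bool" where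
  "smooth_on S f \<longleftrightarrow> (\<forall>k. Ck_on k S f)"

definition endo_trace :: "'v::real_vector set \<Rightarrow> ('v \<Rightarrow> 'v) \<Rightarrow> real" where
  "endo_trace S f =
     (let B = (SOME B. B \<subseteq> S \<and> independent B \<and> S \<subseteq> span B)
      in \<Sum>b\<in>B. representation B (f b) b)"

definition cyc :: "('a \<Rightarrow> 'a \<Rightarrow> 'a \<Rightarrow> 'b::plus) \<Rightarrow> 'a \<Rightarrow> 'a \<Rightarrow> 'a \<Rightarrow> 'b" where
  "cyc F X Y Z = F X Y Z + F Y Z X + F Z X Y"


section \<open>Atlases, tangent vectors, vector fields\<close>

record ('i, 'p, 'e) atlas =
  idx :: "'i set"
  cdom :: "'i \<Rightarrow> 'p set"
  cmap :: "'i \<Rightarrow> 'p \<Rightarrow> 'e"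

definition points :: "('i, 'p, 'e) atlas \<Rightarrow> 'p set" where
  "points B = (\<Union>i\<in>idx B. cdom B i)"

abbreviation cimage :: "('i, 'p, 'e) atlas \<Rightarrow> 'i \<Rightarrow> 'e set" where
  "cimage B i \<equiv> cmap B i ` cdom B i"

definition in_chart :: "('i, 'p, 'e) atlas \<Rightarrow> 'i \<Rightarrow> 'e \<Rightarrow> 'p" where
  "in_chart B i = the_inv_into (cdom B i) (cmap B i)"

definition chart_at :: "('i, 'p, 'e) atlas \<Rightarrow> 'p \<Rightarrow> 'i" where
  "chart_at B p = (SOME i. i \<in> idx B \<and> p \<in> cdom B i)"

definition smooth_manifold ::
    "'m topology \<Rightarrow> ('i, 'm, 'e::euclidean_space) atlas \<Rightarrow> bool" where
  "smooth_manifold X A \<longleftrightarrow>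
     Hausdorff_space X \<and> second_countable X \<and> topspace X = points A \<and>
     (\<forall>i\<in>idx A. openin X (cdom A i) \<and> open (cimage A i) \<and>
        homeomorphic_map (subtopology X (cdom A i)) (top_of_set (cimage A i)) (cmap A i)) \<and>
     (\<forall>i\<in>idx A. \<forall>j\<in>idx A.
        smooth_on (cmap A i ` (cdom A i \<inter> cdom A j)) (\<lambda>x. cmap A j (in_chart A i x)))"

definition smooth_fun ::
    "('i, 'p, 'e::euclidean_space) atlas \<Rightarrow> ('p \<Rightarrow> 'b::real_normed_vector) \<Rightarrow> bool" where
  "smooth_fun B f \<longleftrightarrow> (\<forall>i\<in>idx B. smooth_on (cimage B i) (\<lambda>x. f (in_chart B i x)))"

text \<open>A tangent vector at \<open>p\<close> is the family \<open>(v i)\<^sub>i\<close> of its component vectors in all charts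
  around \<open>p\<close>, subject to the usual transformation law; the components at charts not
  containing \<open>p\<close> are set to 0, so that the tangent space is a linear subspace
  of dimension \<open>DIM('e)\<close>.\<close>

definition tangent_space ::
    "('i, 'p, 'e::euclidean_space) atlas \<Rightarrow> 'p \<Rightarrow> ('i \<Rightarrow> 'e) set" where
  "tangent_space B p =
     {v. (\<forall>i. \<not> (i \<in> idx B \<and> p \<in> cdom B i) \<longrightarrow> v i = 0) \<and>
         (\<forall>i\<in>idx B. \<forall>j\<in>idx B. p \<in> cdom B i \<longrightarrow> p \<in> cdom B j \<longrightarrow>
            v j = frechet_derivative (\<lambda>x. cmap B j (in_chart B i x)) (at (cmap B i p)) (v i))}"

definition vector_field ::
    "('i, 'p, 'e::euclidean_space) atlas \<Rightarrow> ('p \<Rightarrow> 'i \<Rightarrow> 'e) \<Rightarrow> bool" where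
  "vector_field B X \<longleftrightarrow>
     (\<forall>p\<in>points B. X p \<in> tangent_space B p) \<and>
     (\<forall>i\<in>idx B. smooth_on (cimage B i) (\<lambda>x. X (in_chart B i x) i))"

definition dir_deriv ::
    "('i, 'p, 'e::euclidean_space) atlas \<Rightarrow> ('p \<Rightarrow> real) \<Rightarrow> 'p \<Rightarrow> ('i \<Rightarrow> 'e) \<Rightarrow> real" where
  "dir_deriv B f p w =
     (let i = chart_at B p
      in frechet_derivative (\<lambda>x. f (in_chart B i x)) (at (cmap B i p)) (w i))"

definition lie_bracket ::
    "('i, 'p, 'e::euclidean_space) atlas \<Rightarrow> ('p \<Rightarrow> 'i \<Rightarrow> 'e) \<Rightarrow> ('p \<Rightarrow> 'i \<Rightarrow> 'e) \<Rightarrow> 'p \<Rightarrow> 'i \<Rightarrow> 'e" where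
  "lie_bracket B X Y p i =
     (if i \<in> idx B \<and> p \<in> cdom B i
      then frechet_derivative (\<lambda>x. Y (in_chart B i x) i) (at (cmap B i p)) (X p i)
         - frechet_derivative (\<lambda>x. X (in_chart B i x) i) (at (cmap B i p)) (Y p i)
      else 0)"


section \<open>The tangent bundle, the slit tangent bundle and the pullback bundle\<close>

text \<open>The bundles carry the natural charts induced by the charts of the base, indexed by the
  same index set.\<close>

definition tangent_bundle ::
    "('i, 'm, 'e::euclidean_space) atlas \<Rightarrow> ('i, 'm \<times> ('i \<Rightarrow> 'e), 'e \<times> 'e) atlas" where
  "tangent_bundle A =
     \<lparr> idx = idx A,
       cdom = (\<lambda>i. {(p, v). p \<in> cdom A i \<and> v \<in> tangent_space A p}),
       cmap = (\<lambda>i (p, v). (cmap A i p, v i)) \<rparr>"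

definition slit_bundle ::
    "('i, 'm, 'e::euclidean_space) atlas \<Rightarrow> ('i, 'm \<times> ('i \<Rightarrow> 'e), 'e \<times> 'e) atlas" where
  "slit_bundle A =
     \<lparr> idx = idx A,
       cdom = (\<lambda>i. {(p, v). p \<in> cdom A i \<and> v \<in> tangent_space A p \<and> v \<noteq> 0}),
       cmap = (\<lambda>i (p, v). (cmap A i p, v i)) \<rparr>"

type_synonym ('i, 'm, 'e) pfield = "'m \<times> ('i \<Rightarrow> 'e) \<Rightarrow> 'i \<Rightarrow> 'e"
type_synonym ('i, 'm, 'e) vfield = "'m \<times> ('i \<Rightarrow> 'e) \<Rightarrow> 'i \<Rightarrow> 'e \<times> 'e"
type_synonym ('i, 'm, 'e) conn =
  "'m \<times> ('i \<Rightarrow> 'e) \<Rightarrow> ('i \<Rightarrow> 'e \<times> 'e) \<Rightarrow> ('i, 'm, 'e) pfield \<Rightarrow> 'i \<Rightarrow> 'e"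

text \<open>The fibre of the pullback bundle over \<open>u\<close> is \<open>{u} \<times> T\<^bsub>\<pi>(u)\<^esub>M\<close>; a section
  \<open>u \<mapsto> (u, X u)\<close> is represented by its second component \<open>X\<close>.\<close>

abbreviation fibre :: "('i, 'm, 'e::euclidean_space) atlas \<Rightarrow> 'm \<times> ('i \<Rightarrow> 'e) \<Rightarrow> ('i \<Rightarrow> 'e) set" where
  "fibre A u \<equiv> tangent_space A (fst u)"

definition pi_field :: "('i, 'm, 'e::euclidean_space) atlas \<Rightarrow> ('i, 'm, 'e) pfield \<Rightarrow> bool" where
  "pi_field A X \<longleftrightarrow>
     (\<forall>u\<in>points (slit_bundle A). X u \<in> fibre A u) \<and>
     (\<forall>i\<in>idx A. smooth_on (cimage (slit_bundle A) i) (\<lambda>x. X (in_chart (slit_bundle A) i x) i))"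

definition eta :: "('i, 'm, 'e) pfield" where
  "eta u = snd u"

text \<open>In the natural chart with coordinates \<open>(x, y)\<close> the projection is \<open>(x, y) \<mapsto> x\<close>, hence
  \<open>\<rho> = d\<pi>\<close> maps \<open>(a, b)\<close> to \<open>a\<close>; the vertical lift of \<open>a\<close> at \<open>u\<close>, i.e. the velocity at
  \<open>t = 0\<close> of the curve \<open>u + t a\<close>, is \<open>(0, a)\<close>.\<close>

definition rho :: "('i \<Rightarrow> 'e \<times> 'e) \<Rightarrow> 'i \<Rightarrow> 'e" where
  "rho w = (\<lambda>i. fst (w i))"

definition vlift :: "('i \<Rightarrow> 'e::zero) \<Rightarrow> 'i \<Rightarrow> 'e \<times> 'e" where
  "vlift x = (\<lambda>i. (0, x i))"


section \<open>Finsler structures\<close>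

text \<open>\<open>g\<^sub>u(x, y) = 1/2 (\<partial>\<^sup>2L\<^sup>2 / \<partial>y\<^sup>a \<partial>y\<^sup>b) x\<^sup>a y\<^sup>b\<close>, computed in a natural chart around \<open>u\<close>.\<close>

definition fmetric ::
    "('i, 'm, 'e::euclidean_space) atlas \<Rightarrow> ('m \<times> ('i \<Rightarrow> 'e) \<Rightarrow> real) \<Rightarrow>
     'm \<times> ('i \<Rightarrow> 'e) \<Rightarrow> ('i \<Rightarrow> 'e) \<Rightarrow> ('i \<Rightarrow> 'e) \<Rightarrow> real" where
  "fmetric A L u x y =
     (let S = slit_bundle A; i = chart_at S u; E = (\<lambda>z. (L (in_chart S i z))\<^sup>2)
      in 1/2 * frechet_derivative (\<lambda>z. frechet_derivative E (at z) (vlift x i))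
                 (at (cmap S i u)) (vlift y i))"

definition finsler_structure ::
    "('i, 'm, 'e::euclidean_space) atlas \<Rightarrow> ('m \<times> ('i \<Rightarrow> 'e) \<Rightarrow> real) \<Rightarrow> bool" where
  "finsler_structure A L \<longleftrightarrow>
     (\<forall>i\<in>idx A. continuous_on (cimage (tangent_bundle A) i) (\<lambda>x. L (in_chart (tangent_bundle A) i x))) \<and>
     smooth_fun (slit_bundle A) L \<and>
     (\<forall>u\<in>points (slit_bundle A). 0 < L u) \<and>
     (\<forall>p v. (p, v) \<in> points (tangent_bundle A) \<longrightarrow> (\<forall>r>0. L (p, r *\<^sub>R v) = r * L (p, v))) \<and>
     (\<forall>u\<in>points (slit_bundle A). \<forall>x\<in>fibre A u. x \<noteq> 0 \<longrightarrow> 0 < fmetric A L u x x)"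


section \<open>Connections on the pullback bundle\<close>

text \<open>\<open>D u w Z\<close> is the covariant derivative \<open>D\<^sub>w Z\<close> of the \<open>\<pi>\<close>-vector field \<open>Z\<close> along the
  tangent vector \<open>w\<close> of the slit tangent bundle at \<open>u\<close>; \<open>nab D X Z\<close> is \<open>D\<^sub>X Z\<close> for a vector
  field \<open>X\<close>.\<close>

definition nab :: "('i, 'm, 'e) conn \<Rightarrow> ('i, 'm, 'e) vfield \<Rightarrow> ('i, 'm, 'e) pfield \<Rightarrow> ('i, 'm, 'e) pfield" where
  "nab D X Z = (\<lambda>u. D u (X u) Z)"

definition linear_connection ::
    "('i, 'm, 'e::euclidean_space) atlas \<Rightarrow> ('i, 'm, 'e) conn \<Rightarrow> bool" where
  "linear_connection A D \<longleftrightarrow>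
     (\<forall>X Z. vector_field (slit_bundle A) X \<longrightarrow> pi_field A Z \<longrightarrow> pi_field A (nab D X Z)) \<and>
     (\<forall>u\<in>points (slit_bundle A). \<forall>w\<in>tangent_space (slit_bundle A) u.
        \<forall>Z. pi_field A Z \<longrightarrow>
          D u w Z \<in> fibre A u \<and>
          (\<forall>w'\<in>tangent_space (slit_bundle A) u. \<forall>r. D u (r *\<^sub>R w + w') Z = r *\<^sub>R D u w Z + D u w' Z) \<and>
          (\<forall>Z'. pi_field A Z' \<longrightarrow> D u w (Z + Z') = D u w Z + D u w Z') \<and>
          (\<forall>f. smooth_fun (slit_bundle A) f \<longrightarrow>
             D u w (\<lambda>v. f v *\<^sub>R Z v) = dir_deriv (slit_bundle A) f u w *\<^sub>R Z u + f u *\<^sub>R D u w Z))"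

definition vert_space ::
    "('i, 'm, 'e::euclidean_space) atlas \<Rightarrow> 'm \<times> ('i \<Rightarrow> 'e) \<Rightarrow> ('i \<Rightarrow> 'e \<times> 'e) set" where
  "vert_space A u = {w \<in> tangent_space (slit_bundle A) u. rho w = 0}"

definition hor_space ::
    "('i, 'm, 'e::euclidean_space) atlas \<Rightarrow> ('i, 'm, 'e) conn \<Rightarrow>
     'm \<times> ('i \<Rightarrow> 'e) \<Rightarrow> ('i \<Rightarrow> 'e \<times> 'e) set" where
  "hor_space A D u = {w \<in> tangent_space (slit_bundle A) u. D u w eta = 0}"

definition regular_connection ::
    "('i, 'm, 'e::euclidean_space) atlas \<Rightarrow> ('i, 'm, 'e) conn \<Rightarrow> bool" where
  "regular_connection A D \<longleftrightarrow>
     linear_connection A D \<and>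
     (\<forall>u\<in>points (slit_bundle A). \<forall>w\<in>tangent_space (slit_bundle A) u.
        \<exists>!(a, b). a \<in> vert_space A u \<and> b \<in> hor_space A D u \<and> w = a + b)"

definition gam :: "('i, 'm, 'e::zero) pfield \<Rightarrow> ('i, 'm, 'e) vfield" where
  "gam X = (\<lambda>u. vlift (X u))"

definition bet ::
    "('i, 'm, 'e::euclidean_space) atlas \<Rightarrow> ('i, 'm, 'e) conn \<Rightarrow> ('i, 'm, 'e) pfield \<Rightarrow> ('i, 'm, 'e) vfield" where
  "bet A D X = (\<lambda>u. the_inv_into (hor_space A D u) rho (X u))"

definition torsion ::
    "('i, 'm, 'e::euclidean_space) atlas \<Rightarrow> ('i, 'm, 'e) conn \<Rightarrow>
     ('i, 'm, 'e) vfield \<Rightarrow> ('i, 'm, 'e) vfield \<Rightarrow> ('i, 'm, 'e) pfield" where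
  "torsion A D X Y =
     nab D X (\<lambda>u. rho (Y u)) - nab D Y (\<lambda>u. rho (X u)) - (\<lambda>u. rho (lie_bracket (slit_bundle A) X Y u))"

definition htorsion ::
    "('i, 'm, 'e::euclidean_space) atlas \<Rightarrow> ('i, 'm, 'e) conn \<Rightarrow>
     ('i, 'm, 'e) pfield \<Rightarrow> ('i, 'm, 'e) pfield \<Rightarrow> ('i, 'm, 'e) pfield" where
  "htorsion A D X Y = torsion A D (bet A D X) (bet A D Y)"

definition mtorsion ::
    "('i, 'm, 'e::euclidean_space) atlas \<Rightarrow> ('i, 'm, 'e) conn \<Rightarrow>
     ('i, 'm, 'e) pfield \<Rightarrow> ('i, 'm, 'e) pfield \<Rightarrow> ('i, 'm, 'e) pfield" where
  "mtorsion A D X Y = torsion A D (gam X) (bet A D Y)"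

definition metrical ::
    "('i, 'm, 'e::euclidean_space) atlas \<Rightarrow> ('m \<times> ('i \<Rightarrow> 'e) \<Rightarrow> real) \<Rightarrow> ('i, 'm, 'e) conn \<Rightarrow> bool" where
  "metrical A L D \<longleftrightarrow>
     (\<forall>u\<in>points (slit_bundle A). \<forall>w\<in>tangent_space (slit_bundle A) u.
        \<forall>Y Z. pi_field A Y \<longrightarrow> pi_field A Z \<longrightarrow>
          dir_deriv (slit_bundle A) (\<lambda>v. fmetric A L v (Y v) (Z v)) u w =
          fmetric A L u (D u w Y) (Z u) + fmetric A L u (Y u) (D u w Z))"

definition cartan_connection ::
    "('i, 'm, 'e::euclidean_space) atlas \<Rightarrow> ('m \<times> ('i \<Rightarrow> 'e) \<Rightarrow> real) \<Rightarrow> ('i, 'm, 'e) conn \<Rightarrow> bool" where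
  "cartan_connection A L D \<longleftrightarrow>
     regular_connection A D \<and> metrical A L D \<and>
     (\<forall>X Y. pi_field A X \<longrightarrow> pi_field A Y \<longrightarrow>
        (\<forall>u\<in>points (slit_bundle A). htorsion A D X Y u = 0)) \<and>
     (\<forall>X Y Z. pi_field A X \<longrightarrow> pi_field A Y \<longrightarrow> pi_field A Z \<longrightarrow>
        (\<forall>u\<in>points (slit_bundle A).
           fmetric A L u (mtorsion A D X Y u) (Z u) = fmetric A L u (mtorsion A D X Z u) (Y u)))"


section \<open>Curvature\<close>

definition curvature ::
    "('i, 'm, 'e::euclidean_space) atlas \<Rightarrow> ('i, 'm, 'e) conn \<Rightarrow>
     ('i, 'm, 'e) vfield \<Rightarrow> ('i, 'm, 'e) vfield \<Rightarrow> ('i, 'm, 'e) pfield \<Rightarrow> ('i, 'm, 'e) pfield" where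
  "curvature A D X Y Z =
     - nab D X (nab D Y Z) + nab D Y (nab D X Z) + nab D (lie_bracket (slit_bundle A) X Y) Z"

definition hcurv ::
    "('i, 'm, 'e::euclidean_space) atlas \<Rightarrow> ('i, 'm, 'e) conn \<Rightarrow>
     ('i, 'm, 'e) pfield \<Rightarrow> ('i, 'm, 'e) pfield \<Rightarrow> ('i, 'm, 'e) pfield \<Rightarrow> ('i, 'm, 'e) pfield" where
  "hcurv A D X Y Z = curvature A D (bet A D X) (bet A D Y) Z"

definition hvcurv ::
    "('i, 'm, 'e::euclidean_space) atlas \<Rightarrow> ('i, 'm, 'e) conn \<Rightarrow>
     ('i, 'm, 'e) pfield \<Rightarrow> ('i, 'm, 'e) pfield \<Rightarrow> ('i, 'm, 'e) pfield \<Rightarrow> ('i, 'm, 'e) pfield" where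
  "hvcurv A D X Y Z = curvature A D (bet A D X) (gam Y) Z"

definition rhat ::
    "('i, 'm, 'e::euclidean_space) atlas \<Rightarrow> ('i, 'm, 'e) conn \<Rightarrow>
     ('i, 'm, 'e) pfield \<Rightarrow> ('i, 'm, 'e) pfield \<Rightarrow> ('i, 'm, 'e) pfield" where
  "rhat A D X Y = hcurv A D X Y eta"

text \<open>The trace is taken on the fibre over \<open>u\<close>; a fibre element is fed to the curvature tensor
  by means of an arbitrary \<open>\<pi>\<close>-vector field extending it.\<close>

definition pi_extension ::
    "('i, 'm, 'e::euclidean_space) atlas \<Rightarrow> 'm \<times> ('i \<Rightarrow> 'e) \<Rightarrow> ('i \<Rightarrow> 'e) \<Rightarrow> ('i, 'm, 'e) pfield" where
  "pi_extension A u z = (SOME Z. pi_field A Z \<and> Z u = z)"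

definition hricci ::
    "('i, 'm, 'e::euclidean_space) atlas \<Rightarrow> ('i, 'm, 'e) conn \<Rightarrow>
     ('i, 'm, 'e) pfield \<Rightarrow> ('i, 'm, 'e) pfield \<Rightarrow> 'm \<times> ('i \<Rightarrow> 'e) \<Rightarrow> real" where
  "hricci A D X Y u = endo_trace (fibre A u) (\<lambda>z. hcurv A D X (pi_extension A u z) Y u)"

definition ricci_op ::
    "('i, 'm, 'e::euclidean_space) atlas \<Rightarrow> ('m \<times> ('i \<Rightarrow> 'e) \<Rightarrow> real) \<Rightarrow> ('i, 'm, 'e) conn \<Rightarrow>
     ('i, 'm, 'e) pfield \<Rightarrow> ('i, 'm, 'e) pfield" where
  "ricci_op A L D X u =
     (THE w. w \<in> fibre A u \<and> (\<forall>Y. pi_field A Y \<longrightarrow> fmetric A L u w (Y u) = hricci A D X Y u))"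

definition mproj ::
    "('i, 'm, 'e::euclidean_space) atlas \<Rightarrow> ('m \<times> ('i \<Rightarrow> 'e) \<Rightarrow> real) \<Rightarrow> ('i, 'm, 'e) conn \<Rightarrow>
     ('i, 'm, 'e) pfield \<Rightarrow> ('i, 'm, 'e) pfield \<Rightarrow> ('i, 'm, 'e) pfield \<Rightarrow> ('i, 'm, 'e) pfield" where
  "mproj A L D X Y Z u =
     hcurv A D X Y Z u - (1 / (2 * (real DIM('e) - 1))) *\<^sub>R
       (hricci A D X Z u *\<^sub>R Y u - hricci A D Y Z u *\<^sub>R X u
        + fmetric A L u (X u) (Z u) *\<^sub>R ricci_op A L D Y u
        - fmetric A L u (Y u) (Z u) *\<^sub>R ricci_op A L D X u)"

definition mproj4 ::
    "('i, 'm, 'e::euclidean_space) atlas \<Rightarrow> ('m \<times> ('i \<Rightarrow> 'e) \<Rightarrow> real) \<Rightarrow> ('i, 'm, 'e) conn \<Rightarrow>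
     ('i, 'm, 'e) pfield \<Rightarrow> ('i, 'm, 'e) pfield \<Rightarrow> ('i, 'm, 'e) pfield \<Rightarrow> ('i, 'm, 'e) pfield \<Rightarrow>
     'm \<times> ('i \<Rightarrow> 'e) \<Rightarrow> real" where
  "mproj4 A L D X Y Z W u = fmetric A L u (mproj A L D X Y Z u) (W u)"

text \<open>Covariant derivatives of \<open>\<pi>\<close>-tensor fields of type \<open>(1,1)\<close>, \<open>(1,3)\<close> and \<open>(0,2)\<close> along
  a vector field \<open>V\<close>.\<close>

definition nab11 ::
    "('i, 'm, 'e::euclidean_space) conn \<Rightarrow> ('i, 'm, 'e) vfield \<Rightarrow>
     (('i, 'm, 'e) pfield \<Rightarrow> ('i, 'm, 'e) pfield) \<Rightarrow>
     ('i, 'm, 'e) pfield \<Rightarrow> ('i, 'm, 'e) pfield" where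
  "nab11 D V S X = nab D V (S X) - S (nab D V X)"

definition nab13 ::
    "('i, 'm, 'e::euclidean_space) conn \<Rightarrow> ('i, 'm, 'e) vfield \<Rightarrow>
     (('i, 'm, 'e) pfield \<Rightarrow> ('i, 'm, 'e) pfield \<Rightarrow> ('i, 'm, 'e) pfield \<Rightarrow> ('i, 'm, 'e) pfield) \<Rightarrow>
     ('i, 'm, 'e) pfield \<Rightarrow> ('i, 'm, 'e) pfield \<Rightarrow> ('i, 'm, 'e) pfield \<Rightarrow> ('i, 'm, 'e) pfield" where
  "nab13 D V S X Y Z =
     nab D V (S X Y Z) - S (nab D V X) Y Z - S X (nab D V Y) Z - S X Y (nab D V Z)"

definition nab02 ::
    "('i, 'm, 'e::euclidean_space) atlas \<Rightarrow> ('i, 'm, 'e) conn \<Rightarrow> ('i, 'm, 'e) vfield \<Rightarrow>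
     (('i, 'm, 'e) pfield \<Rightarrow> ('i, 'm, 'e) pfield \<Rightarrow> 'm \<times> ('i \<Rightarrow> 'e) \<Rightarrow> real) \<Rightarrow>
     ('i, 'm, 'e) pfield \<Rightarrow> ('i, 'm, 'e) pfield \<Rightarrow> 'm \<times> ('i \<Rightarrow> 'e) \<Rightarrow> real" where
  "nab02 A D V S X Y u =
     dir_deriv (slit_bundle A) (S X Y) u (V u) - S (nab D V X) Y u - S X (nab D V Y) u"

definition concurrent ::
    "('i, 'm, 'e::euclidean_space) atlas \<Rightarrow> ('i, 'm, 'e) conn \<Rightarrow> ('i, 'm, 'e) pfield \<Rightarrow> bool" where
  "concurrent A D \<zeta> \<longleftrightarrow>
     pi_field A \<zeta> \<and>
     (\<forall>X. pi_field A X \<longrightarrow> (\<forall>u\<in>points (slit_bundle A).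
        nab D (bet A D X) \<zeta> u = - X u \<and> nab D (gam X) \<zeta> u = 0))"

end

theory Submission
  imports Defs
begin

text \<open>
  In a natural chart \<open>(x, y)\<close> of the slit bundle the connection reads \<open>D\<^sub>w Z = dZ(w) + om(w) Z\<close>, and
  curvature and torsion become pointwise expressions in \<open>om\<close>; this makes all the tensors involved
  smooth and tensorial. Antisymmetry in the last two arguments comes from \<open>\<nabla>g = 0\<close>. The two cyclic
  identities are the Bianchi identities for horizontal lifts: as \<open>Q = 0\<close>, the bracket
  \<open>[\<beta>X, \<beta>Y]\<close> has horizontal part \<open>\<beta>(\<nabla>\<^bsub>\<beta>X\<^esub> Y - \<nabla>\<^bsub>\<beta>Y\<^esub> X)\<close>, and since \<open>\<nabla>\<^bsub>\<gamma>V\<^esub> \<eta> = V\<close> its vertical part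
  is \<open>\<gamma>(rhat X Y)\<close>. The same splitting gives \<open>R(X, Y)\<zeta> = 0\<close> for a concurrent \<open>\<zeta>\<close>.

  For the derivative along \<open>\<gamma>\<eta>\<close>, the Cartan axioms determine \<open>om\<close> from \<open>g\<close> by a Koszul type
  argument. Since \<open>g\<close> is homogeneous of degree 0 in \<open>y\<close>, the components of \<open>R\<close>, \<open>Ric\<close> and
  \<open>Ric\<^sub>o\<close> are constant along the rays \<open>t \<mapsto> (x, t y)\<close>; and as \<open>T(\<eta>, \<cdot>) = 0\<close>, the operator
  \<open>\<nabla>\<^bsub>\<gamma>\<eta>\<^esub>\<close> is the derivative along these rays.
\<close>

text \<open>Two obstacles shape the proof. First, a connection is an operator on global fields, and
  its axioms say nothing about locality. Before any chart formula is available, cutoff functions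
  must turn chart data into global fields, and the Leibniz rule must show that
  \<open>D u w Z\<close> depends only on the value and first derivative of \<open>Z\<close> at
  \<open>u\<close>. Second, the Cartan connection is given by axioms. Instead of a coefficient
  formula for its horizontal part, homogeneity is obtained from uniqueness: rescaling the fibre by
  \<open>t\<close> carries the coefficients at \<open>hs t z\<close> to a second solution of the
  axioms at \<open>z\<close>, because the metric is invariant. The difference of the two solutions
  satisfies a homogeneous linear system, and permuting its indices as for the Christoffel symbols
  forces it to be 0, since the Cartan tensor vanishes on \<open>y\<close>. Linear maps depending on
  a point are treated as families \<open>F x a\<close>, linear in \<open>a\<close> and smooth in
  \<open>x\<close> for fixed \<open>a\<close>; that inverses of such families are smooth gives the
  smoothness of the nonlinear connection and of Ric_o.\<close>

definition dd :: "('a::real_normed_vector \<Rightarrow> 'b::real_normed_vector) \<Rightarrow> 'a \<Rightarrow> 'a \<Rightarrow> 'b" where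
  "dd f v x = frechet_derivative f (at x) v"

lemma dd_has_derivative:
  "f differentiable at x \<Longrightarrow> (f has_derivative (\<lambda>v. dd f v x)) (at x)"
  by (simp add: dd_def frechet_derivative_works)

lemma dd_eq: "(f has_derivative f') (at x) \<Longrightarrow> dd f v x = f' v"
  by (metis dd_def frechet_derivative_at)

lemma linear_dd: "f differentiable at x \<Longrightarrow> linear (\<lambda>v. dd f v x)"
  using dd_has_derivative has_derivative_linear by blast

text \<open>\<open>frechet_derivative\<close> chooses some map satisfying the
  \<open>has_derivative\<close> predicate. The predicates of the two functions coincide at
  \<open>x\<close>, hence so do the choices, even where neither function is differentiable.\<close>

lemma frechet_derivative_cong_open:
  assumes "open S" "x \<in> S" "\<And>y. y \<in> S \<Longrightarrow> f y = g y"
  shows "frechet_derivative f (at x) = frechet_derivative g (at x)"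
proof -
  have "(f has_derivative f') (at x) \<longleftrightarrow> (g has_derivative f') (at x)" for f'
    using assms has_derivative_transform_within_open[of _ _ x UNIV S] by (metis UNIV_I)
  then show ?thesis by (simp add: frechet_derivative_def)
qed

lemma dd_cong:
  assumes "open S" "x \<in> S" "\<And>y. y \<in> S \<Longrightarrow> f y = g y"
  shows "dd f v x = dd g v x"
  using frechet_derivative_cong_open[OF assms] by (simp add: dd_def)

lemma dd_const [simp]: "dd (\<lambda>x. c) v x = 0"
  by (simp add: dd_def)

lemma differentiable_on_openD:
  "f differentiable_on S \<Longrightarrow> open S \<Longrightarrow> x \<in> S \<Longrightarrow> f differentiable at x"
  using differentiable_on_eq_differentiable_at by blast

lemma differentiable_cong_open:
  assumes "open S" "x \<in> S" "\<And>y. y \<in> S \<Longrightarrow> f y = g y" "f differentiable at x"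
  shows "g differentiable at x"
  using assms has_derivative_transform_within_open[of f _ x UNIV S g]
  unfolding differentiable_def by blast

subsection \<open>\<open>C\<^sup>k\<close> functions on open sets\<close>

lemma Ck_on_Suc:
  "Ck_on (Suc k) S f \<longleftrightarrow> f differentiable_on S \<and> (\<forall>v. Ck_on k S (dd f v))"
  by (simp add: dd_def[abs_def])

declare Ck_on.simps(2) [simp del]

lemma Ck_on_cong:
  assumes "open S" "\<And>x. x \<in> S \<Longrightarrow> f x = g x" "Ck_on k S f"
  shows "Ck_on k S g"
  using assms(2,3)
proof (induction k arbitrary: f g)
  case 0
  then show ?case by (metis Ck_on.simps(1) continuous_on_cong)
next
  case (Suc k)
  have "g differentiable_on S"
    unfolding differentiable_on_eq_differentiable_at[OF assms(1)]
  proof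
    fix x assume "x \<in> S"
    then show "g differentiable at x"
      using Suc.prems assms(1)
      by (intro differentiable_cong_open[OF assms(1), of x f g])
        (auto simp: Ck_on_Suc intro: differentiable_on_openD)
  qed
  moreover have "Ck_on k S (dd g v)" for v
    by (rule Suc.IH[of "dd f v"]) (use Suc.prems assms(1) in \<open>auto simp: Ck_on_Suc intro!: dd_cong\<close>)
  ultimately show ?case by (simp add: Ck_on_Suc)
qed

lemma Ck_on_subset: "Ck_on k S f \<Longrightarrow> T \<subseteq> S \<Longrightarrow> Ck_on k T f"
  by (induction k arbitrary: f)
    (auto simp: Ck_on_Suc intro: continuous_on_subset differentiable_on_subset)

lemma Ck_on_SucD: "Ck_on (Suc k) S f \<Longrightarrow> Ck_on k S f"
  by (induction k arbitrary: f) (auto simp: Ck_on_Suc differentiable_imp_continuous_on)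

text \<open>Lets smoothness be checked near each point; functions glued from a chart formula and 0
  are treated this way.\<close>

lemma Ck_on_local:
  assumes "\<And>x. x \<in> S \<Longrightarrow> \<exists>T. open T \<and> x \<in> T \<and> Ck_on k T f"
  shows "Ck_on k S f"
  using assms
proof (induction k arbitrary: f)
  case 0
  then show ?case
    by (metis Ck_on.simps(1) continuous_at_imp_continuous_on continuous_on_eq_continuous_at)
next
  case (Suc k)
  have "f differentiable at x" if "x \<in> S" for x
    using Suc.prems[OF that] by (meson Ck_on_Suc differentiable_on_openD)
  moreover have "Ck_on k S (dd f v)" for v
    by (rule Suc.IH) (use Suc.prems in \<open>auto simp: Ck_on_Suc\<close>)
  ultimately show ?case
    by (auto simp: Ck_on_Suc differentiable_at_imp_differentiable_on)
qed

lemma Ck_on_const: "Ck_on k S (\<lambda>x. c)"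
proof (induction k arbitrary: c)
  case (Suc k)
  then show ?case by (simp add: Ck_on_Suc dd_const[abs_def])
qed simp

lemma Ck_on_add:
  assumes "open S" "Ck_on k S f" "Ck_on k S g"
  shows "Ck_on k S (\<lambda>x. f x + g x)"
  using assms(2,3)
proof (induction k arbitrary: f g)
  case 0
  then show ?case by (simp add: continuous_on_add)
next
  case (Suc k)
  have d: "f differentiable at x" "g differentiable at x" if "x \<in> S" for x
    using Suc.prems that assms(1) by (auto simp: Ck_on_Suc intro: differentiable_on_openD)
  have eq: "dd (\<lambda>x. f x + g x) v x = dd f v x + dd g v x" if "x \<in> S" for v x
    by (rule dd_eq) (use d[OF that] in \<open>auto intro!: derivative_intros dd_has_derivative\<close>)
  have "Ck_on k S (dd (\<lambda>x. f x + g x) v)" for v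
    by (rule Ck_on_cong[OF assms(1), of "\<lambda>x. dd f v x + dd g v x"])
      (use Suc eq in \<open>auto simp: Ck_on_Suc\<close>)
  moreover have "(\<lambda>x. f x + g x) differentiable_on S"
    using Suc.prems by (auto simp: Ck_on_Suc intro: differentiable_on_add)
  ultimately show ?case by (simp add: Ck_on_Suc)
qed

text \<open>The product rule writes a directional derivative as two values of \<open>B\<close>, each
  pairing a derivative with an undifferentiated factor; both are of class \<open>k\<close>.\<close>

lemma Ck_on_bilinear:
  assumes "bounded_bilinear B" "open S" "Ck_on k S f" "Ck_on k S g"
  shows "Ck_on k S (\<lambda>x. B (f x) (g x))"
  using assms(3,4)
proof (induction k arbitrary: f g)
  case 0
  then show ?case by (simp add: bounded_bilinear.continuous_on[OF assms(1)])
next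
  case (Suc k)
  have d: "f differentiable at x" "g differentiable at x" if "x \<in> S" for x
    using Suc.prems that assms(2) by (auto simp: Ck_on_Suc intro: differentiable_on_openD)
  have der: "((\<lambda>x. B (f x) (g x)) has_derivative (\<lambda>v. B (f x) (dd g v x) + B (dd f v x) (g x))) (at x)"
    if "x \<in> S" for x
    by (rule bounded_bilinear.FDERIV[OF assms(1)]) (use d[OF that] in \<open>auto intro!: dd_has_derivative\<close>)
  have ck: "Ck_on k S f" "Ck_on k S g" using Suc.prems Ck_on_SucD by auto
  have "Ck_on k S (dd (\<lambda>x. B (f x) (g x)) v)" for v
    by (rule Ck_on_cong[OF assms(2), of "\<lambda>x. B (f x) (dd g v x) + B (dd f v x) (g x)"])
      (use Suc ck assms(2) dd_eq[OF der] in \<open>auto simp: Ck_on_Suc intro!: Ck_on_add\<close>)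
  moreover have "(\<lambda>x. B (f x) (g x)) differentiable_on S"
    using der by (meson differentiable_at_imp_differentiable_on differentiable_def)
  ultimately show ?case by (simp add: Ck_on_Suc)
qed

lemma Ck_on_linear:
  assumes "bounded_linear B" "open S" "Ck_on k S f"
  shows "Ck_on k S (\<lambda>x. B (f x))"
  using assms(3)
proof (induction k arbitrary: f)
  case 0
  then show ?case by (simp add: bounded_linear.continuous_on[OF assms(1)])
next
  case (Suc k)
  have der: "((\<lambda>x. B (f x)) has_derivative (\<lambda>v. B (dd f v x))) (at x)" if "x \<in> S" for x
    by (rule bounded_linear.has_derivative[OF assms(1)])
      (use Suc.prems that assms(2) in \<open>auto simp: Ck_on_Suc intro!: dd_has_derivative differentiable_on_openD\<close>)
  have "Ck_on k S (dd (\<lambda>x. B (f x)) v)" for v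
    by (rule Ck_on_cong[OF assms(2), of "\<lambda>x. B (dd f v x)"])
      (use Suc dd_eq[OF der] in \<open>auto simp: Ck_on_Suc\<close>)
  moreover have "(\<lambda>x. B (f x)) differentiable_on S"
    using der by (meson differentiable_at_imp_differentiable_on differentiable_def)
  ultimately show ?case by (simp add: Ck_on_Suc)
qed

lemma Ck_on_sum:
  assumes "open S" "\<And>i. i \<in> I \<Longrightarrow> Ck_on k S (f i)"
  shows "Ck_on k S (\<lambda>x. \<Sum>i\<in>I. f i x)"
  using assms(2) by (induction I rule: infinite_finite_induct) (auto intro: Ck_on_const Ck_on_add assms(1))

lemma Ck_on_id: "Ck_on k S (\<lambda>x. x)"
proof (cases k)
  case (Suc l)
  have "dd (\<lambda>x::'a. x) v = (\<lambda>x. v)" for v by (auto simp: dd_def)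
  then show ?thesis by (simp add: Suc Ck_on_Suc Ck_on_const)
qed simp

lemma dd_basis:
  fixes f :: "'a::euclidean_space \<Rightarrow> 'b::real_normed_vector"
  assumes "f differentiable at x"
  shows "dd f v x = (\<Sum>b\<in>Basis. (v \<bullet> b) *\<^sub>R dd f b x)"
proof -
  interpret linear "\<lambda>v. dd f v x" by (rule linear_dd[OF assms])
  show ?thesis by (subst euclidean_representation[of v, symmetric]) (simp only: sum scaleR)
qed

lemma dd_compose:
  assumes "g differentiable at x" "f differentiable at (g x)"
  shows "(\<lambda>x. f (g x)) differentiable at x" "dd (\<lambda>x. f (g x)) v x = dd f (dd g v x) (g x)"
proof -
  have "((\<lambda>x. f (g x)) has_derivative (\<lambda>v. dd f (dd g v x) (g x))) (at x)"
    using diff_chain_at[OF dd_has_derivative[OF assms(1)] dd_has_derivative[OF assms(2)]]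
    by (simp add: o_def)
  then show "(\<lambda>x. f (g x)) differentiable at x" "dd (\<lambda>x. f (g x)) v x = dd f (dd g v x) (g x)"
    by (auto simp: differentiable_def dest: dd_eq)
qed

text \<open>\<open>Ck_on\<close> controls derivatives in fixed directions, while the chain rule
  produces the moving direction \<open>dd g v x\<close>. Expanding it in \<open>Basis\<close> leaves
  fixed directions with scalar coefficients of class \<open>k\<close>.\<close>

lemma Ck_on_compose:
  fixes f :: "'b::euclidean_space \<Rightarrow> 'c::real_normed_vector" and g :: "'a::euclidean_space \<Rightarrow> 'b"
  assumes "open S" "open T" "\<And>x. x \<in> S \<Longrightarrow> g x \<in> T" "Ck_on k S g" "Ck_on k T f"
  shows "Ck_on k S (\<lambda>x. f (g x))"
  using assms(4,5)
proof (induction k arbitrary: f)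
  case 0
  then show ?case
    using assms(3) by (auto intro!: continuous_on_compose2[of T f S g])
next
  case (Suc k)
  have d: "g differentiable at x" "f differentiable at (g x)" if "x \<in> S" for x
    using Suc.prems that assms by (auto simp: Ck_on_Suc intro: differentiable_on_openD)
  have eq: "dd (\<lambda>x. f (g x)) v x = (\<Sum>b\<in>Basis. (dd g v x \<bullet> b) *\<^sub>R dd f b (g x))" if "x \<in> S" for v x
    using dd_compose[OF d[OF that]] dd_basis[OF d(2)[OF that]] by metis
  have "Ck_on k S (\<lambda>x. dd g v x \<bullet> b)" for v b
    by (rule Ck_on_linear[OF bounded_linear_inner_left assms(1)]) (use Suc.prems in \<open>simp add: Ck_on_Suc\<close>)
  moreover have "Ck_on k S (\<lambda>x. dd f b (g x))" for b
    using Suc.prems Suc.IH[of "dd f b"] Ck_on_SucD[OF Suc.prems(1)] by (simp add: Ck_on_Suc)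
  ultimately have "Ck_on k S (\<lambda>x. \<Sum>b\<in>Basis. (dd g v x \<bullet> b) *\<^sub>R dd f b (g x))" for v
    by (intro Ck_on_sum Ck_on_bilinear[OF bounded_bilinear_scaleR] assms(1))
  then have "Ck_on k S (dd (\<lambda>x. f (g x)) v)" for v
    by (rule Ck_on_cong[OF assms(1), rotated]) (simp add: eq)
  moreover have "(\<lambda>x. f (g x)) differentiable_on S"
    by (intro differentiable_at_imp_differentiable_on dd_compose(1)[of g _ f] d)
  ultimately show ?case by (simp add: Ck_on_Suc)
qed

subsection \<open>Smooth functions\<close>

lemma smooth_on_cong:
  "open S \<Longrightarrow> (\<And>x. x \<in> S \<Longrightarrow> f x = g x) \<Longrightarrow> smooth_on S f \<Longrightarrow> smooth_on S g"
  unfolding smooth_on_def using Ck_on_cong by blast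

lemma smooth_on_subset: "smooth_on S f \<Longrightarrow> T \<subseteq> S \<Longrightarrow> smooth_on T f"
  unfolding smooth_on_def using Ck_on_subset by blast

lemma smooth_on_local:
  assumes "\<And>x. x \<in> S \<Longrightarrow> \<exists>T. open T \<and> x \<in> T \<and> smooth_on T f"
  shows "smooth_on S f"
  using assms unfolding smooth_on_def by (metis Ck_on_local)

lemma smooth_on_differentiable: "smooth_on S f \<Longrightarrow> open S \<Longrightarrow> x \<in> S \<Longrightarrow> f differentiable at x"
  unfolding smooth_on_def by (metis Ck_on_Suc differentiable_on_openD)

lemma smooth_on_dd: "smooth_on S f \<Longrightarrow> smooth_on S (dd f v)"
  unfolding smooth_on_def by (metis Ck_on_Suc)

lemma smooth_on_const: "smooth_on S (\<lambda>x. c)"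
  by (simp add: smooth_on_def Ck_on_const)

lemma smooth_on_id: "smooth_on S (\<lambda>x. x)"
  by (simp add: smooth_on_def Ck_on_id)

lemma smooth_on_add: "open S \<Longrightarrow> smooth_on S f \<Longrightarrow> smooth_on S g \<Longrightarrow> smooth_on S (\<lambda>x. f x + g x)"
  by (simp add: smooth_on_def Ck_on_add)

lemma smooth_on_bilinear:
  "bounded_bilinear B \<Longrightarrow> open S \<Longrightarrow> smooth_on S f \<Longrightarrow> smooth_on S g \<Longrightarrow> smooth_on S (\<lambda>x. B (f x) (g x))"
  by (simp add: smooth_on_def Ck_on_bilinear)

lemma smooth_on_linear:
  "bounded_linear B \<Longrightarrow> open S \<Longrightarrow> smooth_on S f \<Longrightarrow> smooth_on S (\<lambda>x. B (f x))"
  by (simp add: smooth_on_def Ck_on_linear)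

lemma smooth_on_sum:
  "open S \<Longrightarrow> (\<And>i. i \<in> I \<Longrightarrow> smooth_on S (f i)) \<Longrightarrow> smooth_on S (\<lambda>x. \<Sum>i\<in>I. f i x)"
  by (simp add: smooth_on_def Ck_on_sum)

lemmas smooth_on_scaleR = smooth_on_bilinear[OF bounded_bilinear_scaleR]
lemmas smooth_on_inner = smooth_on_bilinear[OF bounded_bilinear_inner]
lemmas smooth_on_mult = smooth_on_bilinear[OF bounded_bilinear_mult]

lemma smooth_on_minus: "open S \<Longrightarrow> smooth_on S f \<Longrightarrow> smooth_on S (\<lambda>x. - f x)"
  by (rule smooth_on_linear[OF bounded_linear_minus[OF bounded_linear_ident]])

lemma smooth_on_diff: "open S \<Longrightarrow> smooth_on S f \<Longrightarrow> smooth_on S g \<Longrightarrow> smooth_on S (\<lambda>x. f x - g x)"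
  using smooth_on_add[of S f "\<lambda>x. - g x"] smooth_on_minus by fastforce

lemma smooth_on_fst: "open S \<Longrightarrow> smooth_on S f \<Longrightarrow> smooth_on S (\<lambda>x. fst (f x))"
  by (rule smooth_on_linear[OF bounded_linear_fst])

lemma smooth_on_snd: "open S \<Longrightarrow> smooth_on S f \<Longrightarrow> smooth_on S (\<lambda>x. snd (f x))"
  by (rule smooth_on_linear[OF bounded_linear_snd])

lemma smooth_on_Pair:
  assumes "open S" "smooth_on S f" "smooth_on S g"
  shows "smooth_on S (\<lambda>x. (f x, g x))"
proof -
  have 1: "bounded_linear (\<lambda>a. (a, 0))" "bounded_linear (\<lambda>b. (0, b))"
    by (auto intro!: bounded_linear_Pair bounded_linear_ident bounded_linear_zero)
  have "smooth_on S (\<lambda>x. (f x, 0) + (0, g x))"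
    by (intro smooth_on_add smooth_on_linear[OF 1(1)] smooth_on_linear[OF 1(2)] assms)
  then show ?thesis by simp
qed

lemma smooth_on_compose:
  fixes f :: "'b::euclidean_space \<Rightarrow> 'c::real_normed_vector" and g :: "'a::euclidean_space \<Rightarrow> 'b"
  assumes "open S" "open T" "\<And>x. x \<in> S \<Longrightarrow> g x \<in> T" "smooth_on S g" "smooth_on T f"
  shows "smooth_on S (\<lambda>x. f (g x))"
  using assms by (simp add: smooth_on_def Ck_on_compose[of S T g])

lemma linear_basis_expand:
  fixes F :: "'a::euclidean_space \<Rightarrow> 'b::real_vector"
  assumes "linear F"
  shows "F v = (\<Sum>b\<in>Basis. (v \<bullet> b) *\<^sub>R F b)"
proof -
  interpret linear F by fact
  show ?thesis by (subst euclidean_representation[of v, symmetric]) (simp only: sum scaleR)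
qed

text \<open>Stands in for smooth operator-valued maps: smoothness for each fixed argument is enough,
  because \<open>Z x\<close> expands in the finite basis with coefficients of the same class as
  \<open>Z\<close>.\<close>

lemma Ck_on_linear_family:
  fixes F :: "'a::euclidean_space \<Rightarrow> 'c::euclidean_space \<Rightarrow> 'b::real_normed_vector"
  assumes "open S" "\<And>a. Ck_on k S (\<lambda>x. F x a)" "\<And>x. x \<in> S \<Longrightarrow> linear (F x)" "Ck_on k S Z"
  shows "Ck_on k S (\<lambda>x. F x (Z x))"
proof (rule Ck_on_cong[OF assms(1), of "\<lambda>x. \<Sum>b\<in>Basis. (Z x \<bullet> b) *\<^sub>R F x b"])
  show "Ck_on k S (\<lambda>x. \<Sum>b\<in>Basis. (Z x \<bullet> b) *\<^sub>R F x b)"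
    by (intro Ck_on_sum Ck_on_bilinear[OF bounded_bilinear_scaleR] Ck_on_linear[OF bounded_linear_inner_left] assms)
qed (metis assms(3) linear_basis_expand)

lemma smooth_on_linear_family:
  fixes F :: "'a::euclidean_space \<Rightarrow> 'c::euclidean_space \<Rightarrow> 'b::real_normed_vector"
  assumes "open S" "\<And>a. smooth_on S (\<lambda>x. F x a)" "\<And>x. x \<in> S \<Longrightarrow> linear (F x)" "smooth_on S Z"
  shows "smooth_on S (\<lambda>x. F x (Z x))"
  using assms unfolding smooth_on_def by (simp add: Ck_on_linear_family)

lemma smooth_on_dd_var:
  fixes f :: "'a::euclidean_space \<Rightarrow> 'b::real_normed_vector"
  assumes "open S" "smooth_on S f" "smooth_on S V"
  shows "smooth_on S (\<lambda>x. dd f (V x) x)"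
  by (rule smooth_on_linear_family[of S "\<lambda>x v. dd f v x"])
    (use assms in \<open>auto intro: smooth_on_dd linear_dd smooth_on_differentiable\<close>)

lemma has_derivative_linear_family:
  fixes F :: "'a::euclidean_space \<Rightarrow> 'c::euclidean_space \<Rightarrow> 'b::real_normed_vector"
  assumes "open S" "x \<in> S" "\<And>a. (\<lambda>x. F x a) differentiable at x" "\<And>x. x \<in> S \<Longrightarrow> linear (F x)"
    "Z differentiable at x"
  shows "((\<lambda>y. F y (Z y)) has_derivative (\<lambda>v. dd (\<lambda>y. F y (Z x)) v x + F x (dd Z v x))) (at x)"
proof -
  have "((\<lambda>y. \<Sum>b\<in>Basis. (Z y \<bullet> b) *\<^sub>R F y b) has_derivative
      (\<lambda>v. \<Sum>b\<in>Basis. (Z x \<bullet> b) *\<^sub>R dd (\<lambda>y. F y b) v x + (dd Z v x \<bullet> b) *\<^sub>R F x b)) (at x)"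
    by (auto intro!: derivative_eq_intros dd_has_derivative assms)
  moreover have "(\<Sum>b\<in>Basis. (Z x \<bullet> b) *\<^sub>R dd (\<lambda>y. F y b) v x + (dd Z v x \<bullet> b) *\<^sub>R F x b)
      = dd (\<lambda>y. F y (Z x)) v x + F x (dd Z v x)" for v
  proof -
    have "dd (\<lambda>y. F y (Z x)) v x = dd (\<lambda>y. \<Sum>b\<in>Basis. (Z x \<bullet> b) *\<^sub>R F y b) v x"
      by (rule dd_cong[OF assms(1,2)]) (metis assms(4) linear_basis_expand)
    also have "\<dots> = (\<Sum>b\<in>Basis. (Z x \<bullet> b) *\<^sub>R dd (\<lambda>y. F y b) v x)"
      by (rule dd_eq) (auto intro!: derivative_eq_intros dd_has_derivative assms)
    finally show ?thesis
      by (simp add: sum.distrib linear_basis_expand[OF assms(4)[OF assms(2)], of "dd Z v x"])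
  qed
  ultimately have "((\<lambda>y. \<Sum>b\<in>Basis. (Z y \<bullet> b) *\<^sub>R F y b) has_derivative
      (\<lambda>v. dd (\<lambda>y. F y (Z x)) v x + F x (dd Z v x))) (at x)" by simp
  then show ?thesis
    by (rule has_derivative_transform_within_open[OF _ assms(1,2)])
      (metis assms(4) linear_basis_expand)
qed

lemma dd_linear_family:
  fixes F :: "'a::euclidean_space \<Rightarrow> 'c::euclidean_space \<Rightarrow> 'b::real_normed_vector"
  assumes "open S" "x \<in> S" "\<And>a. smooth_on S (\<lambda>x. F x a)" "\<And>x. x \<in> S \<Longrightarrow> linear (F x)" "smooth_on S Z"
  shows "dd (\<lambda>y. F y (Z y)) v x = dd (\<lambda>y. F y (Z x)) v x + F x (dd Z v x)"
  by (rule dd_eq[OF has_derivative_linear_family[OF assms(1,2)]])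
    (use assms in \<open>auto intro: smooth_on_differentiable\<close>)

subsection \<open>Symmetry of second derivatives\<close>

text \<open>Two applications of the mean value theorem, first in direction \<open>v\<close> and then
  in direction \<open>w\<close>, express the second difference exactly as \<open>t\<^sup>2\<close>
  times the mixed derivative at an intermediate point; continuity then gives the limit.\<close>

lemma second_difference_tendsto:
  fixes f :: "'a::euclidean_space \<Rightarrow> real"
  assumes "open S" "x \<in> S" "Ck_on 2 S f"
  shows "((\<lambda>t. (f (x + t *\<^sub>R v + t *\<^sub>R w) - f (x + t *\<^sub>R v) - f (x + t *\<^sub>R w) + f x) / t\<^sup>2)
          \<longlongrightarrow> dd (dd f v) w x) (at_right 0)"
proof (rule tendstoI)
  fix e :: real assume "e > 0"
  have df: "f differentiable at y" "dd f v differentiable at y" if "y \<in> S" for y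
    using assms that by (auto simp: numeral_2_eq_2 Ck_on_Suc intro: differentiable_on_openD)
  have "continuous_on S (dd (dd f v) w)"
    using assms by (auto simp: numeral_2_eq_2 Ck_on_Suc)
  then have "isCont (dd (dd f v) w) x"
    using assms continuous_on_eq_continuous_at by blast
  then obtain d1 where d1: "d1 > 0" "\<And>y. dist y x < d1 \<Longrightarrow> dist (dd (dd f v) w y) (dd (dd f v) w x) < e"
    unfolding continuous_at_eps_delta using \<open>e > 0\<close> by blast
  obtain d2 where d2: "d2 > 0" "ball x d2 \<subseteq> S"
    using assms openE by blast
  \<comment> \<open>With this bound on both parameters, the whole small parallelogram lies in both
    balls; the added 1 covers \<open>v = w = 0\<close>.\<close>
  define d where "d = min d1 d2 / (norm v + norm w + 1)"
  have np: "norm v + norm w + 1 > 0" by (smt (verit) norm_ge_zero)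
  have "d > 0" using d1 d2 np by (simp add: d_def)
  have near: "x + s *\<^sub>R v + r *\<^sub>R w \<in> S"
     "dist (dd (dd f v) w (x + s *\<^sub>R v + r *\<^sub>R w)) (dd (dd f v) w x) < e"
    if "0 \<le> s" "s < d" "0 \<le> r" "r < d" for s r
  proof -
    have "norm (s *\<^sub>R v + r *\<^sub>R w) \<le> s * norm v + r * norm w"
      using norm_triangle_ineq[of "s *\<^sub>R v" "r *\<^sub>R w"] that by simp
    also have "\<dots> \<le> d * norm v + d * norm w"
      using that by (intro add_mono mult_right_mono) auto
    also have "\<dots> < d * (norm v + norm w + 1)" using \<open>d > 0\<close> by (simp add: algebra_simps)
    also have "\<dots> = min d1 d2" using np by (simp add: d_def)
    finally have "dist (x + s *\<^sub>R v + r *\<^sub>R w) x < min d1 d2" by (simp add: dist_norm add.assoc)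
    then show "x + s *\<^sub>R v + r *\<^sub>R w \<in> S"
     "dist (dd (dd f v) w (x + s *\<^sub>R v + r *\<^sub>R w)) (dd (dd f v) w x) < e"
      using d2(2) d1(2)[of "x + s *\<^sub>R v + r *\<^sub>R w"] by (simp_all add: subset_eq dist_commute[of x])
  qed
  have line: "((\<lambda>s. h (y + s *\<^sub>R a)) has_real_derivative dd h a (y + s *\<^sub>R a)) (at s)"
    if "h differentiable at (y + s *\<^sub>R a)" for h :: "'a \<Rightarrow> real" and y a s
  proof -
    have lin: "linear (\<lambda>v. dd h v (y + s *\<^sub>R a))" by (rule linear_dd[OF that])
    have "((\<lambda>s. y + s *\<^sub>R a) has_derivative (\<lambda>r. r *\<^sub>R a)) (at s)"
      by (auto intro!: derivative_eq_intros)
    from diff_chain_at[OF this dd_has_derivative[OF that]]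
    show ?thesis
      by (simp add: o_def has_field_derivative_def linear_scale[OF lin] mult.commute[of _ "dd h a _"])
  qed
  show "\<forall>\<^sub>F t in at_right 0. dist ((f (x + t *\<^sub>R v + t *\<^sub>R w) - f (x + t *\<^sub>R v) - f (x + t *\<^sub>R w) + f x) / t\<^sup>2)
          (dd (dd f v) w x) < e"
    unfolding eventually_at_right_field
  proof (intro exI[of _ d] conjI allI impI \<open>d > 0\<close>)
    fix t assume t: "0 < t" "t < d"
    define \<phi> where "\<phi> = (\<lambda>s. f ((x + t *\<^sub>R w) + s *\<^sub>R v) - f (x + s *\<^sub>R v))"
    have "DERIV \<phi> s :> dd f v ((x + t *\<^sub>R w) + s *\<^sub>R v) - dd f v (x + s *\<^sub>R v)" if "0 \<le> s" "s \<le> t" for s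
      unfolding \<phi>_def
      by (intro DERIV_diff line df) (use near(1)[of s t] near(1)[of s 0] t that in \<open>auto simp: algebra_simps\<close>)
    then obtain \<xi> where xi: "0 < \<xi>" "\<xi> < t"
      "\<phi> t - \<phi> 0 = (t - 0) * (dd f v ((x + t *\<^sub>R w) + \<xi> *\<^sub>R v) - dd f v (x + \<xi> *\<^sub>R v))"
      using MVT2[OF t(1), of \<phi> "\<lambda>s. dd f v ((x + t *\<^sub>R w) + s *\<^sub>R v) - dd f v (x + s *\<^sub>R v)"] by blast
    have "DERIV (\<lambda>r. dd f v ((x + \<xi> *\<^sub>R v) + r *\<^sub>R w)) r :> dd (dd f v) w ((x + \<xi> *\<^sub>R v) + r *\<^sub>R w)"
      if "0 \<le> r" "r \<le> t" for r
      by (intro line df) (use near(1)[of \<xi> r] t xi that in \<open>auto simp: algebra_simps\<close>)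
    then obtain \<theta> where th: "0 < \<theta>" "\<theta> < t"
      "dd f v ((x + \<xi> *\<^sub>R v) + t *\<^sub>R w) - dd f v ((x + \<xi> *\<^sub>R v) + 0 *\<^sub>R w)
        = (t - 0) * dd (dd f v) w ((x + \<xi> *\<^sub>R v) + \<theta> *\<^sub>R w)"
      using MVT2[OF t(1), of "\<lambda>r. dd f v ((x + \<xi> *\<^sub>R v) + r *\<^sub>R w)"
          "\<lambda>r. dd (dd f v) w ((x + \<xi> *\<^sub>R v) + r *\<^sub>R w)"] by blast
    have "f (x + t *\<^sub>R v + t *\<^sub>R w) - f (x + t *\<^sub>R v) - f (x + t *\<^sub>R w) + f x = \<phi> t - \<phi> 0"
      by (simp add: \<phi>_def algebra_simps)
    also have "\<dots> = t\<^sup>2 * dd (dd f v) w (x + \<xi> *\<^sub>R v + \<theta> *\<^sub>R w)"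
      using xi(3) th(3) by (simp add: algebra_simps power2_eq_square)
    finally show "dist ((f (x + t *\<^sub>R v + t *\<^sub>R w) - f (x + t *\<^sub>R v) - f (x + t *\<^sub>R w) + f x) / t\<^sup>2)
          (dd (dd f v) w x) < e"
      using near(2)[of \<xi> \<theta>] xi th t by simp
  qed
qed

text \<open>The second difference quotient is symmetric in \<open>v\<close> and \<open>w\<close>, so
  both mixed derivatives are its limit.\<close>

lemma dd_dd_commute_real:
  fixes f :: "'a::euclidean_space \<Rightarrow> real"
  assumes "open S" "x \<in> S" "Ck_on 2 S f"
  shows "dd (dd f v) w x = dd (dd f w) v x"
proof (rule tendsto_unique[OF _ second_difference_tendsto[OF assms]])
  show "((\<lambda>t. (f (x + t *\<^sub>R v + t *\<^sub>R w) - f (x + t *\<^sub>R v) - f (x + t *\<^sub>R w) + f x) / t\<^sup>2)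
      \<longlongrightarrow> dd (dd f w) v x) (at_right 0)"
    using second_difference_tendsto[OF assms, of w v] by (simp add: algebra_simps)
qed simp

lemma dd_linear:
  assumes "bounded_linear B" "f differentiable at x"
  shows "dd (\<lambda>x. B (f x)) v x = B (dd f v x)"
  by (rule dd_eq[OF bounded_linear.has_derivative[OF assms(1) dd_has_derivative[OF assms(2)]]])

lemma dd_dd_commute:
  fixes f :: "'a::euclidean_space \<Rightarrow> 'b::euclidean_space"
  assumes "open S" "x \<in> S" "smooth_on S f"
  shows "dd (dd f v) w x = dd (dd f w) v x"
proof (rule euclidean_eqI)
  fix b :: 'b
  let ?B = "\<lambda>y. y \<bullet> b"
  have inner: "dd (dd (\<lambda>x. ?B (f x)) v) w x = ?B (dd (dd f v) w x)" for v w
  proof -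
    have "dd (dd (\<lambda>x. ?B (f x)) v) w x = dd (\<lambda>x. ?B (dd f v x)) w x"
      by (rule dd_cong[OF assms(1,2)])
        (use assms in \<open>auto intro!: dd_linear bounded_linear_inner_left smooth_on_differentiable\<close>)
    also have "\<dots> = ?B (dd (dd f v) w x)"
      by (rule dd_linear) (use assms in \<open>auto intro!: bounded_linear_inner_left smooth_on_differentiable smooth_on_dd\<close>)
    finally show ?thesis .
  qed
  have "Ck_on 2 S (\<lambda>x. ?B (f x))"
    using smooth_on_linear[OF bounded_linear_inner_left assms(1,3)] by (simp add: smooth_on_def)
  then show "?B (dd (dd f v) w x) = ?B (dd (dd f w) v x)"
    using dd_dd_commute_real[OF assms(1,2)] inner by metis
qed

subsection \<open>Inverses\<close>

text \<open>Differentiability comes from the inverse function theorem for \<open>(z, a) \<mapsto> (z, M z a)\<close>; the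
  derivative formula then raises the order by induction.\<close>

lemma smooth_on_inverse_family:
  fixes M Mi :: "'a::euclidean_space \<Rightarrow> 'b::euclidean_space \<Rightarrow> 'b"
  assumes S: "open S" and lin: "\<And>z. z \<in> S \<Longrightarrow> linear (M z)" and sm: "\<And>a. smooth_on S (\<lambda>z. M z a)"
    and left: "\<And>z a. z \<in> S \<Longrightarrow> Mi z (M z a) = a" and right: "\<And>z a. z \<in> S \<Longrightarrow> M z (Mi z a) = a"
    and c: "smooth_on S c"
  shows "smooth_on S (\<lambda>z. Mi z (c z))"
proof -
  have linMi: "linear (Mi z)" if "z \<in> S" for z
    by (rule linearI) (metis left right that linear_add[OF lin[OF that]], metis left right that linear_scale[OF lin[OF that]])
  define F where "F = (\<lambda>p. (fst p, M (fst p) (snd p)))"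
  define g where "g = (\<lambda>p. (fst p, Mi (fst p) (snd p)))"
  let ?S = "S \<times> (UNIV :: 'b set)"
  have oS: "open ?S" using S by (simp add: open_Times)
  have smM: "smooth_on ?S (\<lambda>p. M (fst p) a)" for a
    by (rule smooth_on_compose[OF oS S _ _ sm]) (auto intro: smooth_on_fst[OF oS] smooth_on_id)
  have smFM: "smooth_on ?S (\<lambda>p. M (fst p) (snd p))"
    by (rule smooth_on_linear_family[OF oS smM]) (auto intro: lin smooth_on_snd[OF oS] smooth_on_id)
  have smF: "smooth_on ?S F"
    unfolding F_def by (intro smooth_on_Pair smooth_on_fst smooth_on_id smFM oS)
  have der_g: "g differentiable at (z, b)" if z: "z \<in> S" for z b
  proof -
    define a where "a = Mi z b"
    have Fza: "F (z, a) = (z, b)" by (simp add: F_def a_def right z)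
    define m where "m = (\<lambda>h. dd (\<lambda>z. M z a) h z)"
    have dF: "(F has_derivative (\<lambda>h. (fst h, m (fst h) + M z (snd h)))) (at (z, a))"
    proof -
      have "((\<lambda>p. M (fst p) (snd p)) has_derivative
          (\<lambda>v. dd (\<lambda>p. M (fst p) (snd (z, a))) v (z, a) + M (fst (z, a)) (dd snd v (z, a)))) (at (z, a))"
        by (rule has_derivative_linear_family[OF oS])
          (use z lin smM oS in \<open>auto intro: smooth_on_differentiable bounded_linear_imp_differentiable bounded_linear_snd\<close>)
      moreover have "dd snd v (z, a) = snd v" for v :: "'a \<times> 'b"
        by (rule dd_eq) (rule bounded_linear_imp_has_derivative[OF bounded_linear_snd])
      moreover have "dd (\<lambda>p. M (fst p) a) v (z, a) = m (fst v)" for v :: "'a \<times> 'b"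
        unfolding m_def
        by (rule dd_eq, rule diff_chain_at[of fst, unfolded o_def])
          (use dd_has_derivative[OF smooth_on_differentiable[OF sm S z]] bounded_linear_imp_has_derivative[OF bounded_linear_fst] in auto)
      ultimately show ?thesis
        unfolding F_def by (auto intro!: derivative_eq_intros)
    qed
    \<comment> \<open>The derivative of \<open>F\<close> is block triangular, so its inverse is
      obtained by back-substitution.\<close>
    have "(g has_derivative (\<lambda>h. (fst h, Mi z (snd h - m (fst h))))) (at (F (z, a)))"
    proof (rule has_derivative_inverse_strong[OF oS _ _ _ dF])
      show "(z, a) \<in> ?S" using z by simp
      show "continuous_on ?S F" using smF by (metis smooth_on_def Ck_on.simps(1))
      show "g (F x) = x" if "x \<in> ?S" for x using that left by (auto simp: g_def F_def)
      show "(\<lambda>h. (fst h, m (fst h) + M z (snd h))) \<circ> (\<lambda>h. (fst h, Mi z (snd h - m (fst h)))) = id"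
        using right[OF z] by (auto simp: fun_eq_iff)
    qed
    then show ?thesis using Fza differentiable_def by metis
  qed
  have diff: "(\<lambda>z. Mi z (c z)) differentiable at z" if z: "z \<in> S" and c: "c differentiable at z" for z c
  proof -
    have "(\<lambda>z. (z, c z)) differentiable at z"
      using has_derivative_Pair[OF has_derivative_ident dd_has_derivative[OF c]] differentiable_def by blast
    from dd_compose(1)[OF this der_g[OF z]]
    have "(\<lambda>z. g (z, c z)) differentiable at z" .
    then have "(\<lambda>z. snd (g (z, c z))) differentiable at z"
      by (auto simp: differentiable_def intro: bounded_linear.has_derivative[OF bounded_linear_snd])
    then show ?thesis by (simp add: g_def)
  qed
  \<comment> \<open>The order is raised for all right-hand sides at once: the derivative of the
    solution solves the same linear system with another right-hand side of class \<open>k\<close>,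
    to which the induction hypothesis is applied.\<close>
  have "Ck_on k S (\<lambda>z. Mi z (c z))" if "Ck_on k S c" for k c
    using that
  proof (induction k arbitrary: c)
    case 0
    show ?case
    proof (simp, rule continuous_at_imp_continuous_on, rule ballI)
      fix z assume z: "z \<in> S"
      have g: "isCont g (z, c z)" using der_g[OF z] differentiable_imp_continuous_within by blast
      have "isCont c z" using 0 z S continuous_on_eq_continuous_at by (metis Ck_on.simps(1))
      then have "isCont (\<lambda>z. (z, c z)) z" by (intro continuous_intros)
      then have "isCont (\<lambda>z. g (z, c z)) z"
        using isCont_o2[of z "\<lambda>z. (z, c z)" g] g by simp
      then have "isCont (\<lambda>z. snd (g (z, c z))) z"
        by (rule isCont_snd)
      then show "isCont (\<lambda>z. Mi z (c z)) z" by (simp add: g_def)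
    qed
  next
    case (Suc k)
    have cd: "c differentiable at z" if "z \<in> S" for z
      using Suc.prems that S by (auto simp: Ck_on_Suc intro: differentiable_on_openD)
    have Ck: "Ck_on k S (\<lambda>z. Mi z (c z))" by (rule Suc.IH[OF Ck_on_SucD[OF Suc.prems]])
    have smMd: "(\<lambda>z. M z a) differentiable at z" if "z \<in> S" for z a
      using smooth_on_differentiable[OF sm S that] .
    have lin2: "linear (\<lambda>a. dd (\<lambda>z. M z a) v z)" if z: "z \<in> S" for z v
    proof (rule linearI)
      fix a b :: 'b and r :: real
      have "dd (\<lambda>z. M z (a + b)) v z = dd (\<lambda>z. M z a + M z b) v z"
        by (rule dd_cong[OF S z]) (simp add: lin linear_add)
      also have "\<dots> = dd (\<lambda>z. M z a) v z + dd (\<lambda>z. M z b) v z"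
        by (rule dd_eq) (auto intro!: derivative_intros dd_has_derivative smMd z)
      finally show "dd (\<lambda>z. M z (a + b)) v z = dd (\<lambda>z. M z a) v z + dd (\<lambda>z. M z b) v z" .
      have "dd (\<lambda>z. M z (r *\<^sub>R a)) v z = dd (\<lambda>z. r *\<^sub>R M z a) v z"
        by (rule dd_cong[OF S z]) (simp add: lin linear_scale)
      also have "\<dots> = r *\<^sub>R dd (\<lambda>z. M z a) v z"
        by (rule dd_eq) (auto intro!: derivative_eq_intros dd_has_derivative smMd z)
      finally show "dd (\<lambda>z. M z (r *\<^sub>R a)) v z = r *\<^sub>R dd (\<lambda>z. M z a) v z" .
    qed
    have eq: "dd (\<lambda>z. Mi z (c z)) v z = Mi z (dd c v z - dd (\<lambda>y. M y (Mi z (c z))) v z)"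
      if z: "z \<in> S" for v z
    proof -
      have "((\<lambda>y. M y (Mi y (c y))) has_derivative
          (\<lambda>v. dd (\<lambda>y. M y (Mi z (c z))) v z + M z (dd (\<lambda>z. Mi z (c z)) v z))) (at z)"
        by (rule has_derivative_linear_family[OF S z]) (use z smMd lin diff[OF z cd[OF z]] in auto)
      then have "dd (\<lambda>y. M y (Mi y (c y))) v z = dd (\<lambda>y. M y (Mi z (c z))) v z + M z (dd (\<lambda>z. Mi z (c z)) v z)"
        by (rule dd_eq)
      moreover have "dd (\<lambda>y. M y (Mi y (c y))) v z = dd c v z"
        by (rule dd_cong[OF S z]) (simp add: right)
      ultimately have "M z (dd (\<lambda>z. Mi z (c z)) v z) = dd c v z - dd (\<lambda>y. M y (Mi z (c z))) v z"
        by (simp add: algebra_simps)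
      then show ?thesis using left[OF z] by metis
    qed
    have "Ck_on k S (dd (\<lambda>z. Mi z (c z)) v)" for v
    proof (rule Ck_on_cong[OF S])
      show "Ck_on k S (\<lambda>z. Mi z (dd c v z + - dd (\<lambda>y. M y (Mi z (c z))) v z))"
      proof (rule Suc.IH, intro Ck_on_add S)
        show "Ck_on k S (dd c v)" using Suc.prems by (simp add: Ck_on_Suc)
        have "Ck_on k S (\<lambda>z. dd (\<lambda>y. M y (Mi z (c z))) v z)"
          by (rule Ck_on_linear_family[OF S _ lin2 Ck]) (use smooth_on_dd[OF sm] in \<open>simp add: smooth_on_def\<close>)
        then show "Ck_on k S (\<lambda>z. - dd (\<lambda>y. M y (Mi z (c z))) v z)"
          by (rule Ck_on_linear[OF bounded_linear_minus[OF bounded_linear_ident] S])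
      qed
    qed (simp add: eq)
    moreover have "(\<lambda>z. Mi z (c z)) differentiable_on S"
      using diff cd by (meson differentiable_at_imp_differentiable_on)
    ultimately show ?case by (simp add: Ck_on_Suc)
  qed
  then show ?thesis using c by (simp add: smooth_on_def)
qed

text \<open>Division inverts the one-dimensional linear family
  \<open>a \<mapsto> g z * a\<close>.\<close>

lemma smooth_on_divide:
  fixes f g :: "'a::euclidean_space \<Rightarrow> real"
  assumes "open S" "smooth_on S f" "smooth_on S g" "\<And>z. z \<in> S \<Longrightarrow> g z \<noteq> 0"
  shows "smooth_on S (\<lambda>z. f z / g z)"
  by (rule smooth_on_inverse_family[of S "\<lambda>z a. g z * a" "\<lambda>z a. a / g z"])
    (use assms in \<open>auto intro: smooth_on_mult smooth_on_const linear_times\<close>)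

subsection \<open>Bump functions\<close>

text \<open>The functions x^(-n) exp(-1/x), extended by 0, form a family in which every derivative
  is a linear combination of members. Smoothness of \<open>flat 0\<close>, also at the origin, thus
  follows by one induction for all \<open>n\<close> together.\<close>

definition flat :: "nat \<Rightarrow> real \<Rightarrow> real" where
  "flat n x = (if x > 0 then inverse x ^ n * exp (- inverse x) else 0)"

lemma flat_tendsto: "((\<lambda>x. flat n x) \<longlongrightarrow> 0) (at_right 0)"
proof -
  have "((\<lambda>x. inverse x ^ n / exp (inverse x)) \<longlongrightarrow> 0) (at_right (0::real))"
    by (rule filterlim_compose[OF tendsto_power_div_exp_0 filterlim_inverse_at_top_right])
  moreover have "\<forall>\<^sub>F x in at_right (0::real). inverse x ^ n / exp (inverse x) = flat n x"
    by (auto simp: eventually_at_right_field flat_def exp_minus divide_inverse intro: exI[of _ 1])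
  ultimately show ?thesis using tendsto_cong by fastforce
qed

lemma flat_has_derivative:
  "(flat n has_real_derivative flat (n + 2) x - real n * flat (n + 1) x) (at x)"
proof -
  consider "x > 0" | "x < 0" | "x = 0" by linarith
  then show ?thesis
  proof cases
    case 1
    have "((\<lambda>x. inverse x ^ n * exp (- inverse x)) has_real_derivative
        flat (n + 2) x - real n * flat (n + 1) x) (at x)"
    proof -
      let ?y = "inverse x"
      have "((\<lambda>y. y ^ n * exp (- y)) has_real_derivative (n * ?y ^ (n - 1) * exp (- ?y) - ?y ^ n * exp (- ?y))) (at ?y)"
        by (auto intro!: derivative_eq_intros)
      from DERIV_chain2[OF this DERIV_inverse] have
        "((\<lambda>x. inverse x ^ n * exp (- inverse x)) has_real_derivative
          (n * ?y ^ (n - 1) * exp (- ?y) - ?y ^ n * exp (- ?y)) * - (?y ^ 2)) (at x)"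
        using 1 by (simp add: power2_eq_square)
      moreover have "(n * ?y ^ (n - 1) * exp (- ?y) - ?y ^ n * exp (- ?y)) * - (?y ^ 2)
          = flat (n + 2) x - real n * flat (n + 1) x"
        using 1 by (cases n) (auto simp: flat_def algebra_simps power2_eq_square)
      ultimately show ?thesis by simp
    qed
    then show ?thesis
      by (rule has_field_derivative_transform_within_open[where S="{0<..}"]) (use 1 in \<open>auto simp: flat_def\<close>)
  next
    case 2
    have "((\<lambda>x. 0) has_real_derivative flat (n + 2) x - real n * flat (n + 1) x) (at x)"
      using 2 by (simp add: flat_def)
    then show ?thesis
      by (rule has_field_derivative_transform_within_open[where S="{..<0}"]) (use 2 in \<open>auto simp: flat_def\<close>)
  next
    case 3
    have "((\<lambda>h. (flat n (0 + h) - flat n 0) / h) \<longlongrightarrow> 0) (at 0)"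
      unfolding filterlim_at_split
    proof
      have "\<forall>\<^sub>F h in at_left 0. (flat n (0 + h) - flat n 0) / h = (0::real)"
        by (auto simp: eventually_at_left_field flat_def intro: exI[of _ "-1"])
      then show "((\<lambda>h. (flat n (0 + h) - flat n 0) / h) \<longlongrightarrow> 0) (at_left 0)"
        by (rule tendsto_eventually)
      \<comment> \<open>The right difference quotient at 0 is the next member of the family, which
        tends to 0.\<close>
      have "\<forall>\<^sub>F h in at_right 0. flat (Suc n) h = (flat n (0 + h) - flat n 0) / h"
        by (auto simp: eventually_at_right_field flat_def field_simps intro: exI[of _ 1])
      then show "((\<lambda>h. (flat n (0 + h) - flat n 0) / h) \<longlongrightarrow> 0) (at_right 0)"
        using tendsto_cong flat_tendsto by fast
    qed
    then show ?thesis using 3 by (simp add: DERIV_def flat_def)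
  qed
qed

lemma smooth_on_flat: "smooth_on S (flat n)"
proof -
  have "Ck_on k UNIV (flat n)" for k
  proof (induction k arbitrary: n)
    case 0
    show ?case
      unfolding Ck_on.simps by (rule DERIV_continuous_on) (rule has_field_derivative_at_within[OF flat_has_derivative])
  next
    case (Suc k)
    have "dd (flat n) v x = v * (flat (n + 2) x + (- real n) * flat (n + 1) x)" for v x
      using dd_eq[OF flat_has_derivative[unfolded has_field_derivative_def]] by (simp add: mult.commute)
    then have dd: "dd (flat n) v = (\<lambda>x. v * (flat (n + 2) x + (- real n) * flat (n + 1) x))" for v
      by blast
    have "Ck_on k UNIV (dd (flat n) v)" for v
      unfolding dd by (intro Ck_on_add Suc Ck_on_bilinear[OF bounded_bilinear_mult] Ck_on_const open_UNIV)
    moreover have "flat n differentiable_on UNIV"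
      by (metis differentiable_at_imp_differentiable_on flat_has_derivative real_differentiable_def)
    ultimately show ?case
      by (simp add: Ck_on_Suc)
  qed
  then show ?thesis
    unfolding smooth_on_def using Ck_on_subset by blast
qed

lemma smooth_bump:
  fixes x0 :: "'a::euclidean_space"
  assumes "r > 0"
  obtains \<psi> :: "'a \<Rightarrow> real" where
    "smooth_on UNIV \<psi>" "\<And>x. x \<in> ball x0 r \<Longrightarrow> \<psi> x = 1" "\<And>x. x \<notin> cball x0 (2 * r) \<Longrightarrow> \<psi> x = 0"
proof
  \<comment> \<open>\<open>q\<close> exceeds 1 on the ball of radius \<open>r\<close> and is
    negative off the closed ball of radius \<open>2 * r\<close>. In the quotient below, the second
    term of the denominator vanishes on the former and the numerator off the latter.\<close>
  define q where "q = (\<lambda>x. 2 - ((x - x0) \<bullet> (x - x0)) / r\<^sup>2)"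
  define \<psi> where "\<psi> = (\<lambda>x. flat 0 (q x) / (flat 0 (q x) + flat 0 (1 - q x)))"
  have q: "smooth_on UNIV q"
    unfolding q_def
    by (intro smooth_on_diff smooth_on_const smooth_on_divide smooth_on_inner smooth_on_id open_UNIV)
      (use assms in auto)
  have pos: "flat 0 (q x) + flat 0 (1 - q x) > 0" for x
    by (cases "q x > 0") (auto simp: flat_def add_pos_nonneg)
  show "smooth_on UNIV \<psi>"
    unfolding \<psi>_def
  proof (rule smooth_on_divide)
    show f: "smooth_on UNIV (\<lambda>x. flat 0 (q x))"
      by (rule smooth_on_compose[OF _ open_UNIV _ q smooth_on_flat]) auto
    have "smooth_on UNIV (\<lambda>x. flat 0 (1 - q x))"
      by (rule smooth_on_compose[OF _ open_UNIV _ smooth_on_diff[OF _ smooth_on_const q] smooth_on_flat]) auto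
    then show "smooth_on UNIV (\<lambda>x. flat 0 (q x) + flat 0 (1 - q x))"
      by (intro smooth_on_add f) auto
    show "flat 0 (q z) + flat 0 (1 - q z) \<noteq> 0" for z
      using pos[of z] by simp
  qed simp
  have sq: "(x - x0) \<bullet> (x - x0) = (dist x0 x)\<^sup>2" for x
    by (metis dist_commute dist_norm power2_norm_eq_inner)
  show "\<psi> x = 1" if "x \<in> ball x0 r" for x
  proof -
    have "(dist x0 x)\<^sup>2 \<le> r\<^sup>2" using that by (intro power_mono) auto
    then have "(dist x0 x)\<^sup>2 / r\<^sup>2 \<le> 1" using assms by (simp add: divide_le_eq_1)
    then have "q x \<ge> 1" by (simp add: q_def sq)
    then show ?thesis by (simp add: \<psi>_def flat_def)
  qed
  show "\<psi> x = 0" if "x \<notin> cball x0 (2 * r)" for x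
  proof -
    have "(2 * r)\<^sup>2 \<le> (dist x0 x)\<^sup>2" using that assms by (intro power_mono) auto
    then have "(dist x0 x)\<^sup>2 / r\<^sup>2 \<ge> 4" using assms by (simp add: le_divide_eq power_mult_distrib)
    then have "q x \<le> 0" by (simp add: q_def sq)
    then show ?thesis by (simp add: \<psi>_def flat_def)
  qed
qed

section \<open>Lie brackets of vector fields on open subsets of a Euclidean space\<close>

lemma dd_dd_var:
  fixes f :: "'a::euclidean_space \<Rightarrow> 'b::euclidean_space"
  assumes "open S" "x \<in> S" "smooth_on S f" "smooth_on S V"
  shows "dd (\<lambda>y. dd f (V y) y) v x = dd (dd f (V x)) v x + dd f (dd V v x) x"
  by (rule dd_linear_family[OF assms(1,2), of "\<lambda>x v. dd f v x"])
    (use assms in \<open>auto intro: smooth_on_dd linear_dd smooth_on_differentiable\<close>)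

definition lbr :: "('a::euclidean_space \<Rightarrow> 'a) \<Rightarrow> ('a \<Rightarrow> 'a) \<Rightarrow> 'a \<Rightarrow> 'a" where
  "lbr X Y x = dd Y (X x) x - dd X (Y x) x"

lemma smooth_on_lbr: "open S \<Longrightarrow> smooth_on S X \<Longrightarrow> smooth_on S Y \<Longrightarrow> smooth_on S (lbr X Y)"
  unfolding lbr_def[abs_def] by (intro smooth_on_diff smooth_on_dd_var)

lemma dd_diff:
  assumes "f differentiable at x" "g differentiable at x"
  shows "dd (\<lambda>x. f x - g x) v x = dd f v x - dd g v x"
  by (rule dd_eq) (use assms in \<open>auto intro!: derivative_intros dd_has_derivative\<close>)

lemma dd_add:
  assumes "f differentiable at x" "g differentiable at x"
  shows "dd (\<lambda>x. f x + g x) v x = dd f v x + dd g v x"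
  by (rule dd_eq) (use assms in \<open>auto intro!: derivative_intros dd_has_derivative\<close>)

text \<open>In the cyclic sum the iterated first derivatives cancel outright, and the second
  derivatives cancel by their symmetry.\<close>

lemma lbr_jacobi:
  fixes X Y Z :: "'a::euclidean_space \<Rightarrow> 'a"
  assumes "open S" "x \<in> S" "smooth_on S X" "smooth_on S Y" "smooth_on S Z"
  shows "lbr (lbr X Y) Z x + lbr (lbr Y Z) X x + lbr (lbr Z X) Y x = 0"
proof -
  have lin: "linear (\<lambda>v. dd f v x)" if "smooth_on S f" for f :: "'a \<Rightarrow> 'a"
    using assms that by (auto intro: linear_dd smooth_on_differentiable)
  have 1: "dd (lbr X Y) v x = dd (dd Y (X x)) v x + dd Y (dd X v x) x - dd (dd X (Y x)) v x - dd X (dd Y v x) x"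
    if "smooth_on S X" "smooth_on S Y" for X Y v
    unfolding lbr_def[abs_def] using that assms(1,2)
    by (subst dd_diff) (auto simp: dd_dd_var intro: smooth_on_dd_var smooth_on_differentiable)
  have 2: "lbr (lbr X Y) Z x = dd Z (dd Y (X x) x) x - dd Z (dd X (Y x) x) x
      - dd (dd Y (X x)) (Z x) x - dd Y (dd X (Z x) x) x + dd (dd X (Y x)) (Z x) x + dd X (dd Y (Z x) x) x"
    if "smooth_on S X" "smooth_on S Y" "smooth_on S Z" for X Y Z
    using 1[OF that(1,2)] by (simp add: lbr_def[of "lbr X Y"]) (simp add: lbr_def linear_diff[OF lin[OF that(3)]])
  show ?thesis
    unfolding 2[OF assms(3-5)] 2[OF assms(4,5,3)] 2[OF assms(5,3,4)]
    by (simp add: dd_dd_commute[OF assms(1,2,3), of "Y x" "Z x"] dd_dd_commute[OF assms(1,2,4), of "X x" "Z x"]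
        dd_dd_commute[OF assms(1,2,5), of "X x" "Y x"])
qed

subsection \<open>Smooth atlases\<close>

definition transit :: "('i, 'p, 'e::euclidean_space) atlas \<Rightarrow> 'i \<Rightarrow> 'i \<Rightarrow> 'e \<Rightarrow> 'e" where
  "transit B i j = (\<lambda>x. cmap B j (in_chart B i x))"

definition dtr :: "('i, 'p, 'e::euclidean_space) atlas \<Rightarrow> 'i \<Rightarrow> 'i \<Rightarrow> 'p \<Rightarrow> 'e \<Rightarrow> 'e" where
  "dtr B i j p a = dd (transit B i j) a (cmap B i p)"

text \<open>Inverse of reading off the component at \<open>i\<close>: it identifies the model space
  with the tangent space at \<open>p\<close>, for \<open>p\<close> in the domain of chart
  \<open>i\<close>.\<close>

definition tvec :: "('i, 'p, 'e::euclidean_space) atlas \<Rightarrow> 'i \<Rightarrow> 'p \<Rightarrow> 'e \<Rightarrow> 'i \<Rightarrow> 'e" where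
  "tvec B i p a = (\<lambda>j. if j \<in> idx B \<and> p \<in> cdom B j then dtr B i j p a else 0)"

definition overlap :: "('i, 'p, 'e) atlas \<Rightarrow> 'i \<Rightarrow> 'i \<Rightarrow> 'e set" where
  "overlap B i j = cmap B i ` (cdom B i \<inter> cdom B j)"

definition loc :: "('i, 'p, 'e) atlas \<Rightarrow> 'i \<Rightarrow> ('p \<Rightarrow> 'i \<Rightarrow> 'b) \<Rightarrow> 'e \<Rightarrow> 'b" where
  "loc B i X x = X (in_chart B i x) i"

text \<open>The last clause keeps the support of \<open>\<psi>\<close> away from the points outside the chart, so that
  products with \<open>\<psi>\<close> extend smoothly by 0. On a manifold this is where the Hausdorff property
  enters; no topology on the points of the slit bundle is needed.\<close>

definition cutoff :: "('i, 'p, 'e::euclidean_space) atlas \<Rightarrow> 'i \<Rightarrow> 'e set \<Rightarrow> ('p \<Rightarrow> real) \<Rightarrow> bool" where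
  "cutoff B i U \<psi> \<longleftrightarrow> i \<in> idx B \<and> open U \<and> U \<subseteq> cimage B i \<and> smooth_fun B \<psi> \<and>
     (\<forall>x\<in>U. \<psi> (in_chart B i x) = 1) \<and>
     (\<forall>j\<in>idx B. \<forall>q\<in>cdom B j - cdom B i.
        \<exists>T. open T \<and> cmap B j q \<in> T \<and> T \<subseteq> cimage B j \<and> (\<forall>x\<in>T. \<psi> (in_chart B j x) = 0))"

text \<open>Only the chart images carry a topology in these axioms. The same development therefore
  serves the base manifold and the slit bundle, whose points are not given a topology.\<close>

locale smooth_atlas =
  fixes B :: "('i, 'p, 'e::euclidean_space) atlas"
  assumes inj_chart: "i \<in> idx B \<Longrightarrow> inj_on (cmap B i) (cdom B i)"
    and open_cimage: "i \<in> idx B \<Longrightarrow> open (cimage B i)"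
    and open_overlap: "i \<in> idx B \<Longrightarrow> j \<in> idx B \<Longrightarrow> open (overlap B i j)"
    and smooth_transit: "i \<in> idx B \<Longrightarrow> j \<in> idx B \<Longrightarrow> smooth_on (overlap B i j) (transit B i j)"
begin

lemma in_chart_cmap [simp]: "i \<in> idx B \<Longrightarrow> p \<in> cdom B i \<Longrightarrow> in_chart B i (cmap B i p) = p"
  by (simp add: in_chart_def inj_chart the_inv_into_f_f)

lemma cmap_in_chart [simp]: "i \<in> idx B \<Longrightarrow> x \<in> cimage B i \<Longrightarrow> cmap B i (in_chart B i x) = x"
  by (auto simp: in_chart_def inj_chart f_the_inv_into_f)

lemma in_chart_cdom: "i \<in> idx B \<Longrightarrow> x \<in> cimage B i \<Longrightarrow> in_chart B i x \<in> cdom B i"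
  by auto

lemma overlap_subset: "overlap B i j \<subseteq> cimage B i"
  by (auto simp: overlap_def)

lemma overlap_iff:
  "i \<in> idx B \<Longrightarrow> x \<in> overlap B i j \<longleftrightarrow> x \<in> cimage B i \<and> in_chart B i x \<in> cdom B j"
  by (auto simp: overlap_def)

lemma overlapI: "p \<in> cdom B i \<Longrightarrow> p \<in> cdom B j \<Longrightarrow> cmap B i p \<in> overlap B i j"
  by (auto simp: overlap_def)

lemma transit_overlap:
  assumes "i \<in> idx B" "j \<in> idx B" "x \<in> overlap B i j"
  shows "transit B i j x \<in> overlap B j i" "in_chart B j (transit B i j x) = in_chart B i x"
  using assms by (auto simp: overlap_def transit_def)

lemma transit_cmap: "i \<in> idx B \<Longrightarrow> p \<in> cdom B i \<Longrightarrow> transit B i j (cmap B i p) = cmap B j p"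
  by (simp add: transit_def)

lemma transit_differentiable:
  "i \<in> idx B \<Longrightarrow> j \<in> idx B \<Longrightarrow> x \<in> overlap B i j \<Longrightarrow> transit B i j differentiable at x"
  using smooth_on_differentiable[OF smooth_transit open_overlap] by blast

lemma linear_dtr:
  "i \<in> idx B \<Longrightarrow> j \<in> idx B \<Longrightarrow> p \<in> cdom B i \<Longrightarrow> p \<in> cdom B j \<Longrightarrow> linear (dtr B i j p)"
  unfolding dtr_def[abs_def] by (intro linear_dd transit_differentiable overlapI)

lemma dtr_trans:
  assumes "i \<in> idx B" "j \<in> idx B" "k \<in> idx B" "p \<in> cdom B i" "p \<in> cdom B j" "p \<in> cdom B k"
  shows "dtr B j k p (dtr B i j p a) = dtr B i k p a"
proof -
  let ?S = "overlap B i j \<inter> overlap B i k"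
  have "dtr B i k p a = dd (\<lambda>x. transit B j k (transit B i j x)) a (cmap B i p)"
    unfolding dtr_def
    by (rule dd_cong[of ?S]) (use assms open_overlap in \<open>auto simp: overlapI overlap_iff transit_def\<close>)
  also have "\<dots> = dtr B j k p (dtr B i j p a)"
    unfolding dtr_def
    by (subst dd_compose(2)[of "transit B i j"]) (use assms in \<open>auto intro!: transit_differentiable simp: overlapI transit_cmap\<close>)
  finally show ?thesis by simp
qed

lemma dtr_same [simp]:
  assumes "i \<in> idx B" "p \<in> cdom B i"
  shows "dtr B i i p a = a"
proof -
  have "dd (transit B i i) a (cmap B i p) = dd (\<lambda>x. x) a (cmap B i p)"
    by (rule dd_cong[of "cimage B i"]) (use assms open_cimage in \<open>auto simp: transit_def\<close>)
  then show ?thesis by (simp add: dtr_def dd_def)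
qed

lemma tangent_space_iff:
  "v \<in> tangent_space B p \<longleftrightarrow> (\<forall>i. \<not> (i \<in> idx B \<and> p \<in> cdom B i) \<longrightarrow> v i = 0) \<and>
     (\<forall>i\<in>idx B. \<forall>j\<in>idx B. p \<in> cdom B i \<longrightarrow> p \<in> cdom B j \<longrightarrow> v j = dtr B i j p (v i))"
  by (simp add: tangent_space_def dtr_def dd_def transit_def)

lemma tangentD:
  "i \<in> idx B \<Longrightarrow> j \<in> idx B \<Longrightarrow> p \<in> cdom B i \<Longrightarrow> p \<in> cdom B j \<Longrightarrow> v \<in> tangent_space B p \<Longrightarrow>
    v j = dtr B i j p (v i)"
  unfolding tangent_space_iff by blast

lemma tangent_outside:
  "\<not> (i \<in> idx B \<and> p \<in> cdom B i) \<Longrightarrow> v \<in> tangent_space B p \<Longrightarrow> v i = 0"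
  unfolding tangent_space_iff by blast

lemma tvec_same [simp]: "i \<in> idx B \<Longrightarrow> p \<in> cdom B i \<Longrightarrow> tvec B i p a i = a"
  by (simp add: tvec_def)

lemma tvec_tangent: "i \<in> idx B \<Longrightarrow> p \<in> cdom B i \<Longrightarrow> tvec B i p a \<in> tangent_space B p"
  by (simp add: tangent_space_iff tvec_def dtr_trans)

lemma tangent_eq_tvec:
  "i \<in> idx B \<Longrightarrow> p \<in> cdom B i \<Longrightarrow> v \<in> tangent_space B p \<Longrightarrow> v = tvec B i p (v i)"
  using tangentD[of i _ p v] tangent_outside[of _ p v] unfolding tvec_def fun_eq_iff by meson

lemma tangent_eqI:
  "i \<in> idx B \<Longrightarrow> p \<in> cdom B i \<Longrightarrow> v \<in> tangent_space B p \<Longrightarrow> w \<in> tangent_space B p \<Longrightarrow> v i = w i \<Longrightarrow> v = w"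
  by (metis tangent_eq_tvec)

lemma subspace_tangent_space: "subspace (tangent_space B p)"
proof (rule subspaceI)
  show "0 \<in> tangent_space B p"
    by (simp add: tangent_space_iff linear_0[OF linear_dtr])
  fix v w and r :: real assume v: "v \<in> tangent_space B p" and w: "w \<in> tangent_space B p"
  show "v + w \<in> tangent_space B p"
    unfolding tangent_space_iff
  proof (intro conjI allI ballI impI)
    fix i j assume ij: "i \<in> idx B" "j \<in> idx B" "p \<in> cdom B i" "p \<in> cdom B j"
    show "(v + w) j = dtr B i j p ((v + w) i)"
      using tangentD[OF ij v] tangentD[OF ij w] linear_add[OF linear_dtr[OF ij]] by simp
  qed (use tangent_outside[OF _ v] tangent_outside[OF _ w] in simp)
  show "r *\<^sub>R v \<in> tangent_space B p"
    unfolding tangent_space_iff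
  proof (intro conjI allI ballI impI)
    fix i j assume ij: "i \<in> idx B" "j \<in> idx B" "p \<in> cdom B i" "p \<in> cdom B j"
    show "(r *\<^sub>R v) j = dtr B i j p ((r *\<^sub>R v) i)"
      using tangentD[OF ij v] linear_scale[OF linear_dtr[OF ij]] by simp
  qed (use tangent_outside[OF _ v] in simp)
qed

lemmas tangent_0 = subspace_0[OF subspace_tangent_space]
lemmas tangent_add = subspace_add[OF subspace_tangent_space]
lemmas tangent_scale = subspace_scale[OF subspace_tangent_space]
lemmas tangent_diff = subspace_diff[OF subspace_tangent_space]

lemma chart_at_mem:
  "i \<in> idx B \<Longrightarrow> p \<in> cdom B i \<Longrightarrow> chart_at B p \<in> idx B \<and> p \<in> cdom B (chart_at B p)"
  unfolding chart_at_def by (rule someI2) auto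

text \<open>\<open>dir_deriv\<close> uses one arbitrarily chosen chart; the chain rule and the
  transformation law of \<open>w\<close> show that every chart gives the same value.\<close>

lemma dir_deriv_chart:
  assumes "i \<in> idx B" "p \<in> cdom B i" "(\<lambda>x. f (in_chart B i x)) differentiable at (cmap B i p)"
    "w \<in> tangent_space B p"
  shows "dir_deriv B f p w = dd (\<lambda>x. f (in_chart B i x)) (w i) (cmap B i p)"
proof -
  define k where "k = chart_at B p"
  have k: "k \<in> idx B" "p \<in> cdom B k" using chart_at_mem assms by (auto simp: k_def)
  have "dir_deriv B f p w = dd (\<lambda>x. f (in_chart B k x)) (w k) (cmap B k p)"
    by (simp add: dir_deriv_def k_def Let_def dd_def)
  also have "\<dots> = dd (\<lambda>x. f (in_chart B i (transit B k i x))) (w k) (cmap B k p)"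
    by (rule dd_cong[of "overlap B k i"]) (use assms k in \<open>auto simp: open_overlap overlapI transit_overlap\<close>)
  also have "\<dots> = dd (\<lambda>x. f (in_chart B i x)) (dd (transit B k i) (w k) (cmap B k p)) (transit B k i (cmap B k p))"
    by (rule dd_compose(2)[of "transit B k i"]) (use assms k in \<open>auto intro!: transit_differentiable overlapI simp: transit_cmap\<close>)
  also have "\<dots> = dd (\<lambda>x. f (in_chart B i x)) (w i) (cmap B i p)"
    using assms k tangentD[OF k(1) assms(1) k(2) assms(2,4)] by (simp add: dtr_def transit_def)
  finally show ?thesis .
qed

lemma smooth_fun_chart: "smooth_fun B f \<Longrightarrow> i \<in> idx B \<Longrightarrow> smooth_on (cimage B i) (\<lambda>x. f (in_chart B i x))"
  by (simp add: smooth_fun_def)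

lemma vector_field_smooth: "vector_field B X \<Longrightarrow> i \<in> idx B \<Longrightarrow> smooth_on (cimage B i) (loc B i X)"
  by (simp add: vector_field_def loc_def[abs_def])

lemma vector_field_tangent: "vector_field B X \<Longrightarrow> i \<in> idx B \<Longrightarrow> p \<in> cdom B i \<Longrightarrow> X p \<in> tangent_space B p"
  by (auto simp: vector_field_def points_def)

lemma smooth_fun_const: "smooth_fun B (\<lambda>p. c)"
  by (simp add: smooth_fun_def smooth_on_const)

lemma smooth_on_transit_pullback:
  assumes "i \<in> idx B" "j \<in> idx B" "smooth_on (cimage B i) h"
  shows "smooth_on (overlap B j i) (\<lambda>x. h (transit B j i x))"
  by (rule smooth_on_compose[OF open_overlap open_cimage _ smooth_transit])
    (use assms overlap_subset transit_overlap(1) in blast)+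

text \<open>One chart around each point suffices, although \<open>vector_field\<close> asks for
  smoothness in all of them: on overlaps the components change by the derivative of a smooth
  transition map.\<close>

lemma vector_field_local:
  assumes "\<And>p i. i \<in> idx B \<Longrightarrow> p \<in> cdom B i \<Longrightarrow> X p \<in> tangent_space B p"
    and "\<And>p. p \<in> points B \<Longrightarrow> \<exists>i U. i \<in> idx B \<and> p \<in> cdom B i \<and> open U \<and> cmap B i p \<in> U \<and>
      U \<subseteq> cimage B i \<and> smooth_on U (loc B i X)"
  shows "vector_field B X"
  unfolding vector_field_def
proof (intro conjI ballI)
  show "X p \<in> tangent_space B p" if "p \<in> points B" for p
    using that assms(1) by (auto simp: points_def)
  fix j assume j: "j \<in> idx B"
  show "smooth_on (cimage B j) (\<lambda>x. X (in_chart B j x) j)"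
  proof (rule smooth_on_local)
    fix x assume x: "x \<in> cimage B j"
    let ?p = "in_chart B j x"
    have "?p \<in> points B" using x j by (auto simp: points_def)
    then obtain i U where i: "i \<in> idx B" "?p \<in> cdom B i" "open U" "cmap B i ?p \<in> U" "U \<subseteq> cimage B i"
      "smooth_on U (loc B i X)" using assms(2) by blast
    define T where "T = {y \<in> overlap B j i. transit B j i y \<in> U}"
    have cont: "continuous_on (overlap B j i) (transit B j i)"
      using smooth_transit[OF j i(1)] by (metis smooth_on_def Ck_on.simps(1))
    have oT: "open T"
      using continuous_open_preimage[OF cont open_overlap[OF j i(1)] i(3)]
      by (simp add: T_def vimage_def Int_def)
    have xT: "x \<in> T" using x j i by (auto simp: T_def overlap_iff transit_def)
    have s1: "smooth_on T (\<lambda>y. loc B i X (transit B j i y))"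
      by (rule smooth_on_compose[OF oT i(3) _ smooth_on_subset[OF smooth_transit[OF j i(1)]] i(6)])
        (auto simp: T_def)
    have tr: "smooth_on (overlap B i j) (transit B i j)" by (rule smooth_transit[OF i(1) j])
    have "smooth_on T (\<lambda>y. dd (transit B i j) (loc B i X (transit B j i y)) (transit B j i y))"
    proof (rule smooth_on_linear_family[OF oT _ _ s1, of "\<lambda>y a. dd (transit B i j) a (transit B j i y)"])
      show "smooth_on T (\<lambda>y. dd (transit B i j) a (transit B j i y))" for a
        by (rule smooth_on_compose[OF oT open_overlap[OF i(1) j] _ smooth_on_subset[OF smooth_transit[OF j i(1)]] smooth_on_dd[OF tr]])
          (use transit_overlap(1)[OF j i(1)] in \<open>auto simp: T_def\<close>)
      show "linear (\<lambda>a. dd (transit B i j) a (transit B j i y))" if "y \<in> T" for y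
        by (intro linear_dd transit_differentiable transit_overlap i j) (use that in \<open>auto simp: T_def\<close>)
    qed
    moreover have "dd (transit B i j) (loc B i X (transit B j i y)) (transit B j i y) = X (in_chart B j y) j"
      if "y \<in> T" for y
    proof -
      have y: "y \<in> cimage B j" "in_chart B j y \<in> cdom B i" "in_chart B j y \<in> cdom B j"
        using that j by (auto simp: T_def overlap_iff)
      then have "X (in_chart B j y) j = dtr B i j (in_chart B j y) (X (in_chart B j y) i)"
        using assms(1)[OF j, of "in_chart B j y"] i j by (intro tangentD) auto
      then show ?thesis using y i j by (simp add: dtr_def loc_def transit_def)
    qed
    ultimately show "\<exists>T. open T \<and> x \<in> T \<and> smooth_on T (\<lambda>x. X (in_chart B j x) j)"
      using smooth_on_cong[OF oT] oT xT by (metis (no_types, lifting))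
  qed
qed

lemma lie_bracket_chart:
  "i \<in> idx B \<Longrightarrow> p \<in> cdom B i \<Longrightarrow> lie_bracket B X Y p i = lbr (loc B i X) (loc B i Y) (cmap B i p)"
  by (simp add: lie_bracket_def lbr_def loc_def[abs_def] dd_def)

lemma loc_transit:
  assumes "i \<in> idx B" "j \<in> idx B" "x \<in> overlap B i j" "X (in_chart B i x) \<in> tangent_space B (in_chart B i x)"
  shows "loc B j X (transit B i j x) = dd (transit B i j) (loc B i X x) x"
proof -
  have "in_chart B i x \<in> cdom B i" "in_chart B i x \<in> cdom B j" "x \<in> cimage B i"
    using assms by (auto simp: overlap_iff)
  then show ?thesis
    using assms(1,2) tangentD[of i j "in_chart B i x" "X (in_chart B i x)"] assms(4)
    by (simp add: loc_def transit_overlap(2)[OF assms(1-3)] dtr_def)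
qed

text \<open>Comparing components in two charts produces a second derivative of the transition map
  applied to both fields; being symmetric, it cancels in the commutator.\<close>

lemma lie_bracket_tangent:
  assumes X: "vector_field B X" and Y: "vector_field B Y" and "i \<in> idx B" "p \<in> cdom B i"
  shows "lie_bracket B X Y p \<in> tangent_space B p"
  unfolding tangent_space_iff
proof (intro conjI allI ballI impI)
  fix i j assume i: "i \<in> idx B" "p \<in> cdom B i" and j: "j \<in> idx B" "p \<in> cdom B j"
  let ?S = "overlap B i j" and ?f = "transit B i j" and ?x = "cmap B i p"
  have oS: "open ?S" and xS: "?x \<in> ?S" using i j by (auto simp: open_overlap overlapI)
  have smf: "smooth_on ?S ?f" by (rule smooth_transit[OF i(1) j(1)])
  have sm: "smooth_on ?S (loc B i X)" if "vector_field B X" for X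
    by (rule smooth_on_subset[OF vector_field_smooth[OF that i(1)] overlap_subset])
  have fx: "?f ?x = cmap B j p" using i by (simp add: transit_def)
  have D: "dd (loc B j Y) (loc B j X (cmap B j p)) (cmap B j p) =
      dd (dd ?f (loc B i Y ?x)) (loc B i X ?x) ?x + dd ?f (dd (loc B i Y) (loc B i X ?x) ?x) ?x"
    if X: "vector_field B X" and Y: "vector_field B Y" for X Y
  proof -
    have tan: "X (in_chart B i x) \<in> tangent_space B (in_chart B i x)" if "x \<in> ?S" "vector_field B X" for x X
      using that i overlap_iff[of i x j] by (auto intro: vector_field_tangent)
    have "dd (loc B j Y) (loc B j X (cmap B j p)) (cmap B j p)
        = dd (loc B j Y) (dd ?f (loc B i X ?x) ?x) (?f ?x)"
      using loc_transit[OF i(1) j(1) xS, of X] tan[OF xS X] fx by simp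
    also have "\<dots> = dd (\<lambda>y. loc B j Y (?f y)) (loc B i X ?x) ?x"
      by (rule dd_compose(2)[symmetric])
        (use smooth_on_differentiable[OF vector_field_smooth[OF Y j(1)] open_cimage[OF j(1)], of "cmap B j p"]
          transit_differentiable i j xS fx in auto)
    also have "\<dots> = dd (\<lambda>y. dd ?f (loc B i Y y) y) (loc B i X ?x) ?x"
      by (rule dd_cong[OF oS xS]) (use loc_transit[OF i(1) j(1), of _ Y] tan[OF _ Y] in blast)
    also have "\<dots> = dd (dd ?f (loc B i Y ?x)) (loc B i X ?x) ?x + dd ?f (dd (loc B i Y) (loc B i X ?x) ?x) ?x"
      by (rule dd_dd_var[OF oS xS smf sm[OF Y]])
    finally show ?thesis .
  qed
  have lin: "linear (\<lambda>v. dd ?f v ?x)" by (rule linear_dd[OF transit_differentiable[OF i(1) j(1) xS]])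
  show "lie_bracket B X Y p j = dtr B i j p (lie_bracket B X Y p i)"
    unfolding lie_bracket_chart[OF i] lie_bracket_chart[OF j] lbr_def dtr_def D[OF X Y] D[OF Y X]
      linear_diff[OF lin]
    using dd_dd_commute[OF oS xS smf, of "loc B i Y ?x" "loc B i X ?x"] by simp
qed (auto simp: lie_bracket_def)

lemma loc_lie_bracket:
  "i \<in> idx B \<Longrightarrow> x \<in> cimage B i \<Longrightarrow> loc B i (lie_bracket B X Y) x = lbr (loc B i X) (loc B i Y) x"
  using lie_bracket_chart[of i "in_chart B i x" X Y] by (simp add: loc_def[of B i "lie_bracket B X Y"] in_chart_cdom)

lemma vector_field_lie_bracket:
  assumes "vector_field B X" "vector_field B Y"
  shows "vector_field B (lie_bracket B X Y)"
  unfolding vector_field_def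
proof (intro conjI ballI)
  show "lie_bracket B X Y p \<in> tangent_space B p" if "p \<in> points B" for p
    using lie_bracket_tangent[OF assms] that by (auto simp: points_def)
  fix i assume i: "i \<in> idx B"
  have "smooth_on (cimage B i) (lbr (loc B i X) (loc B i Y))"
    by (intro smooth_on_lbr open_cimage vector_field_smooth assms i)
  then have "smooth_on (cimage B i) (loc B i (lie_bracket B X Y))"
    by (rule smooth_on_cong[OF open_cimage[OF i], rotated]) (simp add: loc_lie_bracket i)
  then show "smooth_on (cimage B i) (\<lambda>x. lie_bracket B X Y (in_chart B i x) i)"
    by (simp add: loc_def[abs_def])
qed

lemma lie_bracket_jacobi:
  assumes "vector_field B X" "vector_field B Y" "vector_field B Z" "i \<in> idx B" "p \<in> cdom B i"
  shows "lie_bracket B (lie_bracket B X Y) Z p + lie_bracket B (lie_bracket B Y Z) X p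
     + lie_bracket B (lie_bracket B Z X) Y p = 0"
proof (rule tangent_eqI[OF assms(4,5)])
  let ?l = "loc B i" and ?x = "cmap B i p" and ?U = "cimage B i"
  have U: "open ?U" "?x \<in> ?U" using assms open_cimage by auto
  have lb: "lie_bracket B (lie_bracket B X Y) Z p i = lbr (lbr (?l X) (?l Y)) (?l Z) ?x" for X Y Z
  proof -
    have eq: "\<And>y. y \<in> ?U \<Longrightarrow> loc B i (lie_bracket B X Y) y = lbr (?l X) (?l Y) y"
      using loc_lie_bracket assms by blast
    show ?thesis
      using dd_cong[OF U eq] eq[OF U(2)] assms by (simp add: lie_bracket_chart lbr_def[of "lbr _ _"] lbr_def[of "loc _ _ (lie_bracket _ _ _)"])
  qed
  show "(lie_bracket B (lie_bracket B X Y) Z p + lie_bracket B (lie_bracket B Y Z) X p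
     + lie_bracket B (lie_bracket B Z X) Y p) i = 0 i"
    using lbr_jacobi[OF U vector_field_smooth[OF assms(1,4)] vector_field_smooth[OF assms(2,4)] vector_field_smooth[OF assms(3,4)]]
    by (simp add: lb)
qed (use assms in \<open>auto intro!: tangent_add tangent_0 lie_bracket_tangent vector_field_lie_bracket\<close>)

lemma cutoff_zero:
  assumes "cutoff B i U \<psi>" "j \<in> idx B" "q \<in> cdom B j" "q \<notin> cdom B i"
  obtains T where "open T" "cmap B j q \<in> T" "T \<subseteq> cimage B j" "\<And>x. x \<in> T \<Longrightarrow> \<psi> (in_chart B j x) = 0"
proof -
  have "q \<in> cdom B j - cdom B i" using assms by simp
  then show thesis using assms(1,2) that unfolding cutoff_def by meson
qed

text \<open>Points of chart \<open>j\<close> fall into two cases: on the overlap the function is a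
  product of smooth functions, and elsewhere the last clause of \<open>cutoff\<close> gives a
  neighbourhood on which it is 0.\<close>

lemma cutoff_extend:
  assumes c: "cutoff B i U \<psi>" and h: "smooth_on (cimage B i) h"
  shows "smooth_fun B (\<lambda>p. if p \<in> cdom B i then \<psi> p *\<^sub>R h (cmap B i p) else 0)"
  unfolding smooth_fun_def
proof (rule ballI, rule smooth_on_local)
  fix j x assume j: "j \<in> idx B" and x: "x \<in> cimage B j"
  have i: "i \<in> idx B" using c by (simp add: cutoff_def)
  let ?F = "\<lambda>p. if p \<in> cdom B i then \<psi> p *\<^sub>R h (cmap B i p) else 0"
  show "\<exists>T. open T \<and> x \<in> T \<and> smooth_on T (\<lambda>x. ?F (in_chart B j x))"
  proof (cases "in_chart B j x \<in> cdom B i")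
    case True
    have "smooth_on (overlap B j i) (\<lambda>x. \<psi> (in_chart B j x) *\<^sub>R h (transit B j i x))"
      by (intro smooth_on_scaleR smooth_on_transit_pullback[OF i j] open_overlap h i j
          smooth_on_subset[OF smooth_fun_chart overlap_subset]) (use c in \<open>simp add: cutoff_def\<close>)
    then have "smooth_on (overlap B j i) (\<lambda>x. ?F (in_chart B j x))"
      by (rule smooth_on_cong[OF open_overlap[OF j i], rotated]) (auto simp: overlap_iff j transit_def)
    then show ?thesis using open_overlap[OF j i] True x j overlap_iff by blast
  next
    case False
    then obtain T where T: "open T" "x \<in> T" "\<And>y. y \<in> T \<Longrightarrow> \<psi> (in_chart B j y) = 0"
      using cutoff_zero[OF c j in_chart_cdom[OF j x] False] x j by (metis cmap_in_chart)
    have "smooth_on T (\<lambda>x. ?F (in_chart B j x))"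
      by (rule smooth_on_cong[OF T(1) _ smooth_on_const[of _ 0]]) (simp add: T(3))
    then show ?thesis using T by blast
  qed
qed

lemma cutoff_vector_field:
  assumes c: "cutoff B i U \<psi>" and h: "smooth_on (cimage B i) h"
  shows "vector_field B (\<lambda>p. if p \<in> cdom B i then \<psi> p *\<^sub>R tvec B i p (h (cmap B i p)) else 0)"
    (is "vector_field B ?V")
proof (rule vector_field_local)
  have i: "i \<in> idx B" using c by (simp add: cutoff_def)
  show "?V p \<in> tangent_space B p" if "j \<in> idx B" "p \<in> cdom B j" for p j
    using i by (auto intro: tangent_scale tvec_tangent tangent_0)
  fix p assume "p \<in> points B"
  then obtain j where j: "j \<in> idx B" "p \<in> cdom B j" by (auto simp: points_def)
  show "\<exists>i U. i \<in> idx B \<and> p \<in> cdom B i \<and> open U \<and> cmap B i p \<in> U \<and> U \<subseteq> cimage B i \<and> smooth_on U (loc B i ?V)"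
  proof (cases "p \<in> cdom B i")
    case True
    have "smooth_on (cimage B i) (\<lambda>x. \<psi> (in_chart B i x) *\<^sub>R h x)"
      by (intro smooth_on_scaleR smooth_fun_chart i open_cimage h) (use c in \<open>simp add: cutoff_def\<close>)
    then have "smooth_on (cimage B i) (loc B i ?V)"
      by (rule smooth_on_cong[OF open_cimage[OF i], rotated]) (auto simp: loc_def i)
    then show ?thesis using True i open_cimage by blast
  next
    case False
    then obtain T where T: "open T" "cmap B j p \<in> T" "T \<subseteq> cimage B j" "\<And>y. y \<in> T \<Longrightarrow> \<psi> (in_chart B j y) = 0"
      using cutoff_zero[OF c j False] by blast
    have "smooth_on T (loc B j ?V)"
      by (rule smooth_on_cong[OF T(1) _ smooth_on_const[of _ 0]]) (simp add: T(4) loc_def)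
    then show ?thesis using T j by blast
  qed
qed

end

subsection \<open>Cutoff functions on manifolds\<close>

lemma manifold_openin_image:
  assumes "smooth_manifold M A" "i \<in> idx A" "openin M W" "W \<subseteq> cdom A i"
  shows "open (cmap A i ` W)"
proof -
  have h: "homeomorphic_map (subtopology M (cdom A i)) (top_of_set (cimage A i)) (cmap A i)"
    and o: "open (cimage A i)"
    using assms by (auto simp: smooth_manifold_def)
  have "openin (subtopology M (cdom A i)) W"
    using assms by (metis inf.absorb_iff1 openin_subtopology)
  then have "openin (top_of_set (cimage A i)) (cmap A i ` W)"
    using homeomorphic_imp_open_map[OF h] by (simp add: open_map_def)
  then show ?thesis using o openin_open_trans by blast
qed

lemma manifold_smooth_atlas:
  fixes A :: "('i, 'm, 'e::euclidean_space) atlas"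
  assumes "smooth_manifold M A"
  shows "smooth_atlas A"
proof
  fix i j assume i: "i \<in> idx A"
  have op: "openin M (cdom A i)" and h: "homeomorphic_map (subtopology M (cdom A i)) (top_of_set (cimage A i)) (cmap A i)"
    using assms i by (auto simp: smooth_manifold_def)
  show "inj_on (cmap A i) (cdom A i)"
    using homeomorphic_imp_injective_map[OF h] openin_subset[OF op] by (simp add: inf_absorb2)
  show "open (cimage A i)" using assms i by (auto simp: smooth_manifold_def)
  assume j: "j \<in> idx A"
  then have "openin M (cdom A j)" using assms by (auto simp: smooth_manifold_def)
  then have "openin M (cdom A i \<inter> cdom A j)" using op by blast
  then show "open (overlap A i j)"
    unfolding overlap_def using manifold_openin_image[OF assms i] by simp
  show "smooth_on (overlap A i j) (transit A i j)"
    using assms i j by (simp add: smooth_manifold_def overlap_def transit_def)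
qed

text \<open>The function vanishes off the preimage of a closed ball, which is compact and hence
  closed because \<open>M\<close> is Hausdorff. Removing this preimage from another chart domain
  leaves an open set on which the function is 0.\<close>

lemma manifold_cutoff:
  fixes A :: "('i, 'm, 'e::euclidean_space) atlas"
  assumes man: "smooth_manifold M A" and i: "i \<in> idx A" and p: "p \<in> cdom A i"
  shows "\<exists>U \<psi>. cutoff A i U \<psi> \<and> cmap A i p \<in> U"
proof -
  interpret smooth_atlas A by (rule manifold_smooth_atlas[OF man])
  let ?x = "cmap A i p"
  obtain s where s: "s > 0" "cball ?x s \<subseteq> cimage A i"
    using open_cimage[OF i] p open_contains_cball by blast
  \<comment> \<open>\<open>smooth_bump\<close> reaches out to twice its radius.\<close>
  define r where "r = s / 2"
  have r: "r > 0" "cball ?x (2 * r) \<subseteq> cimage A i" using s by (auto simp: r_def)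
  obtain \<psi> :: "'e \<Rightarrow> real" where psi: "smooth_on UNIV \<psi>" "\<And>x. x \<in> ball ?x r \<Longrightarrow> \<psi> x = 1"
    "\<And>x. x \<notin> cball ?x (2 * r) \<Longrightarrow> \<psi> x = 0"
    using smooth_bump[OF r(1)] by metis
  define F where "F = (\<lambda>q. if q \<in> cdom A i then \<psi> (cmap A i q) else 0)"
  define K where "K = in_chart A i ` cball ?x (2 * r)"
  have op: "openin M (cdom A k)" if "k \<in> idx A" for k
    using man that by (auto simp: smooth_manifold_def)
  have "closedin M K"
  proof -
    obtain g where g: "homeomorphic_maps (subtopology M (cdom A i)) (top_of_set (cimage A i)) (cmap A i) g"
      using man i homeomorphic_map_maps unfolding smooth_manifold_def by blast
    have "g x = in_chart A i x" if "x \<in> cimage A i" for x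
      using g that i openin_subset[OF op[OF i]] by (auto simp: homeomorphic_maps_def)
    then have K: "K = g ` cball ?x (2 * r)" using r(2) by (auto simp: K_def image_def subset_iff)
    have "continuous_map (top_of_set (cimage A i)) (subtopology M (cdom A i)) g"
      using g by (simp add: homeomorphic_maps_def)
    moreover have "compactin (top_of_set (cimage A i)) (cball ?x (2 * r))"
      using r(2) by (simp add: compactin_subtopology)
    ultimately have "compactin (subtopology M (cdom A i)) K"
      unfolding K by (rule image_compactin[rotated])
    then have "compactin M K" by (simp add: compactin_subtopology)
    then show ?thesis using man compactin_imp_closedin by (auto simp: smooth_manifold_def)
  qed
  have zero: "F q = 0" if "q \<notin> K" for q
  proof (cases "q \<in> cdom A i")
    case True
    then have "cmap A i q \<notin> cball ?x (2 * r)"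
      using that i in_chart_cmap[OF i True] unfolding K_def by (metis image_eqI)
    then show ?thesis using psi(3) by (simp add: F_def)
  qed (simp add: F_def)
  have KD: "K \<subseteq> cdom A i" using r(2) i by (auto simp: K_def)
  have out: "\<exists>T. open T \<and> cmap A j q \<in> T \<and> T \<subseteq> cimage A j \<and> (\<forall>x\<in>T. F (in_chart A j x) = 0)"
    if j: "j \<in> idx A" "q \<in> cdom A j" "q \<notin> cdom A i" for j q
  proof (intro exI[of _ "cmap A j ` (cdom A j - K)"] conjI)
    have "openin M (cdom A j - K)" using op[OF j(1)] \<open>closedin M K\<close> by blast
    then show "open (cmap A j ` (cdom A j - K))" by (rule manifold_openin_image[OF man j(1)]) simp
  qed (use j KD zero in auto)
  have "cutoff A i (ball ?x r) F"
    unfolding cutoff_def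
  proof (intro conjI i open_ball)
    show "ball ?x r \<subseteq> cimage A i" using r by (smt (verit) ball_subset_cball subset_ball subset_trans)
    then show "\<forall>x\<in>ball ?x r. F (in_chart A i x) = 1"
      using psi(2) i in_chart_cdom[OF i] by (auto simp: F_def subset_iff)
    show "\<forall>j\<in>idx A. \<forall>q\<in>cdom A j - cdom A i. \<exists>T. open T \<and> cmap A j q \<in> T \<and> T \<subseteq> cimage A j \<and>
        (\<forall>x\<in>T. F (in_chart A j x) = 0)"
      using out by blast
    show "smooth_fun A F"
      unfolding smooth_fun_def
    proof (rule ballI, rule smooth_on_local)
      fix j x assume j: "j \<in> idx A" and x: "x \<in> cimage A j"
      show "\<exists>T. open T \<and> x \<in> T \<and> smooth_on T (\<lambda>x. F (in_chart A j x))"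
      proof (cases "in_chart A j x \<in> cdom A i")
        case True
        have "smooth_on (overlap A j i) (\<lambda>x. \<psi> (transit A j i x))"
          by (rule smooth_on_transit_pullback[OF i j smooth_on_subset[OF psi(1)]]) simp
        then have "smooth_on (overlap A j i) (\<lambda>x. F (in_chart A j x))"
          by (rule smooth_on_cong[OF open_overlap[OF j i], rotated]) (auto simp: overlap_iff j transit_def F_def)
        then show ?thesis using open_overlap[OF j i] True x j overlap_iff by blast
      next
        case False
        then obtain T where T: "open T" "x \<in> T" "\<And>y. y \<in> T \<Longrightarrow> F (in_chart A j y) = 0"
          using out[OF j in_chart_cdom[OF j x] False] x j by (metis cmap_in_chart)
        have "smooth_on T (\<lambda>x. F (in_chart A j x))"
          by (rule smooth_on_cong[OF T(1) _ smooth_on_const[of _ 0]]) (simp add: T(3))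
        then show ?thesis using T by blast
      qed
    qed
  qed
  then show ?thesis using r(1) by (meson centre_in_ball)
qed

subsection \<open>The slit tangent bundle\<close>

text \<open>Beyond the smoothness of the atlas, the topology of the manifold enters the remaining
  proof only through the existence of these cutoff functions.\<close>

locale cutoff_atlas = smooth_atlas A for A :: "('i, 'm, 'e::euclidean_space) atlas" +
  assumes cutoffs: "i \<in> idx A \<Longrightarrow> p \<in> cdom A i \<Longrightarrow> \<exists>U \<psi>. cutoff A i U \<psi> \<and> cmap A i p \<in> U"
begin

abbreviation S :: "('i, 'm \<times> ('i \<Rightarrow> 'e), 'e \<times> 'e) atlas" where
  "S \<equiv> slit_bundle A"

lemma slit_simps [simp]:
  "idx S = idx A"
  "(p, v) \<in> cdom S i \<longleftrightarrow> p \<in> cdom A i \<and> v \<in> tangent_space A p \<and> v \<noteq> 0"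
  "cmap S i (p, v) = (cmap A i p, v i)"
  by (auto simp: slit_bundle_def)

lemma slit_cdomD: "u \<in> cdom S i \<Longrightarrow> fst u \<in> cdom A i \<and> snd u \<in> tangent_space A (fst u) \<and> snd u \<noteq> 0"
  by (cases u) auto

lemma slit_cmap: "cmap S i u = (cmap A i (fst u), snd u i)"
  by (cases u) auto

lemma tvec_0: "i \<in> idx A \<Longrightarrow> p \<in> cdom A i \<Longrightarrow> tvec A i p 0 = 0"
  using tangent_eqI[OF _ _ tvec_tangent tangent_0] by simp

lemma tvec_eq_0_iff: "i \<in> idx A \<Longrightarrow> p \<in> cdom A i \<Longrightarrow> tvec A i p a = 0 \<longleftrightarrow> a = 0"
  by (metis tvec_0 tvec_same zero_fun_def)

lemma tangent_component_0: "i \<in> idx A \<Longrightarrow> p \<in> cdom A i \<Longrightarrow> v \<in> tangent_space A p \<Longrightarrow> v i = 0 \<longleftrightarrow> v = 0"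
  by (metis tangent_eq_tvec tvec_0 zero_fun_def)

lemma slit_cimage: "i \<in> idx A \<Longrightarrow> cimage S i = cimage A i \<times> (- {0})"
proof (intro set_eqI iffI)
  fix z :: "'e \<times> 'e" assume i: "i \<in> idx A" and "z \<in> cimage A i \<times> (- {0})"
  then have "fst z \<in> cimage A i" "snd z \<in> - {0}" by (simp_all add: mem_Times_iff)
  then obtain p where "p \<in> cdom A i" "fst z = cmap A i p" and "snd z \<in> - {0}" by blast
  then have p: "p \<in> cdom A i" "fst z = cmap A i p" "snd z \<noteq> 0" by auto
  have "(p, tvec A i p (snd z)) \<in> cdom S i"
    using p i by (simp add: tvec_tangent tvec_eq_0_iff)
  moreover have "cmap S i (p, tvec A i p (snd z)) = z"
    using p i by (simp add: prod_eq_iff)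
  ultimately show "z \<in> cimage S i" by (metis image_eqI)
qed (use tangent_component_0 in auto)

lemma slit_inj: "i \<in> idx A \<Longrightarrow> inj_on (cmap S i) (cdom S i)"
  using inj_chart tangent_eqI by (auto simp: inj_on_def) blast

lemma slit_in_chart:
  assumes "i \<in> idx A" "x \<in> cimage A i" "y \<noteq> 0"
  shows "in_chart S i (x, y) = (in_chart A i x, tvec A i (in_chart A i x) y)"
  unfolding in_chart_def[of S]
  by (rule the_inv_into_f_eq[OF slit_inj])
    (use assms in \<open>auto simp: tvec_tangent tvec_eq_0_iff\<close>)

lemma slit_overlap:
  assumes "i \<in> idx A" "j \<in> idx A"
  shows "overlap S i j = overlap A i j \<times> (- {0})"
proof (intro set_eqI iffI)
  fix z :: "'e \<times> 'e" assume z: "z \<in> overlap A i j \<times> (- {0})"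
  then have "fst z \<in> overlap A i j" "snd z \<in> - {0}" by (simp_all add: mem_Times_iff)
  then obtain p where "p \<in> cdom A i" "p \<in> cdom A j" "fst z = cmap A i p" and "snd z \<in> - {0}"
    unfolding overlap_def by blast
  then have p: "p \<in> cdom A i" "p \<in> cdom A j" "fst z = cmap A i p" "snd z \<noteq> 0" by auto
  have "(p, tvec A i p (snd z)) \<in> cdom S i \<inter> cdom S j"
    using p assms by (simp add: tvec_tangent tvec_eq_0_iff)
  moreover have "cmap S i (p, tvec A i p (snd z)) = z"
    using p assms by (simp add: prod_eq_iff)
  ultimately show "z \<in> overlap S i j" unfolding overlap_def by (metis image_eqI)
qed (use assms tangent_component_0 in \<open>auto simp: overlap_def\<close>)

lemma slit_transit:
  assumes "i \<in> idx A" "j \<in> idx A" "x \<in> overlap A i j" "y \<noteq> 0"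
  shows "transit S i j (x, y) = (transit A i j x, dd (transit A i j) y x)"
proof -
  have "x \<in> cimage A i" "in_chart A i x \<in> cdom A i" "in_chart A i x \<in> cdom A j"
    using assms by (auto simp: overlap_iff)
  then show ?thesis
    using assms by (simp add: transit_def[of S] slit_in_chart tvec_def dtr_def) (simp add: transit_def)
qed

lemma smooth_slit_transit_formula:
  assumes "i \<in> idx A" "j \<in> idx A"
  shows "smooth_on (overlap A i j \<times> UNIV) (\<lambda>z. (transit A i j (fst z), dd (transit A i j) (snd z) (fst z)))"
proof -
  have o: "open (overlap A i j)" and o2: "open (overlap A i j \<times> (UNIV :: 'e set))"
    using assms open_overlap by (auto simp: open_Times)
  have f: "smooth_on (overlap A i j \<times> (UNIV :: 'e set)) (\<lambda>z. h (fst z))" if "smooth_on (overlap A i j) h" for h :: "'e \<Rightarrow> 'e"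
    by (rule smooth_on_compose[OF o2 o _ _ that]) (auto intro: smooth_on_fst[OF o2] smooth_on_id)
  have "smooth_on (overlap A i j \<times> UNIV) (\<lambda>z. dd (transit A i j) (snd z) (fst z))"
    by (rule smooth_on_linear_family[OF o2, of "\<lambda>z a. dd (transit A i j) a (fst z)"])
      (use assms in \<open>auto intro!: f smooth_on_dd smooth_transit smooth_on_snd[OF o2] smooth_on_id linear_dd transit_differentiable\<close>)
  then show ?thesis
    by (intro smooth_on_Pair o2 f smooth_transit assms)
qed

end

sublocale cutoff_atlas \<subseteq> S: smooth_atlas S
proof
  fix i j assume "i \<in> idx S"
  then have i: "i \<in> idx A" by simp
  show "inj_on (cmap S i) (cdom S i)" using slit_inj[OF i] .
  show "open (cimage S i)" unfolding slit_cimage[OF i] by (intro open_Times open_cimage i) auto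
  assume "j \<in> idx S"
  then have j: "j \<in> idx A" by simp
  show o: "open (overlap S i j)" unfolding slit_overlap[OF i j] by (intro open_Times open_overlap i j) auto
  have "smooth_on (overlap S i j) (\<lambda>z. (transit A i j (fst z), dd (transit A i j) (snd z) (fst z)))"
    by (rule smooth_on_subset[OF smooth_slit_transit_formula[OF i j]]) (auto simp: slit_overlap i j)
  then show "smooth_on (overlap S i j) (transit S i j)"
    by (rule smooth_on_cong[OF o, rotated])
      (use slit_overlap[OF i j] slit_transit[OF i j] in \<open>simp add: mem_Times_iff prod_eq_iff split_paired_all\<close>)
qed

context cutoff_atlas
begin

text \<open>Natural charts change by \<open>(x, y) \<mapsto> (f x, df(x) y)\<close>, which is linear
  in \<open>y\<close>. The second derivative of \<open>f\<close> therefore enters only the vertical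
  component and is applied to \<open>a\<close>; this is why \<open>rho\<close> and
  \<open>vlift\<close> are compatible with changes of charts.\<close>

lemma slit_dtr:
  assumes "i \<in> idx A" "j \<in> idx A" "u \<in> cdom S i" "u \<in> cdom S j"
  shows "dtr S i j u (a, b) = (dtr A i j (fst u) a,
     dd (dd (transit A i j) (snd u i)) a (cmap A i (fst u)) + dtr A i j (fst u) b)"
proof -
  let ?O = "overlap A i j" and ?f = "transit A i j" and ?x = "cmap A i (fst u)" and ?y = "snd u i"
  have o: "open ?O" and o2: "open (?O \<times> (UNIV :: 'e set))"
    using assms open_overlap by (auto simp: open_Times)
  have x: "?x \<in> ?O" and y: "?y \<noteq> 0"
    using assms slit_cdomD[OF assms(3)] slit_cdomD[OF assms(4)] tangent_component_0 by (auto simp: overlapI)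
  have df: "?f differentiable at ?x" by (rule transit_differentiable[OF assms(1,2) x])
  have fst: "dd (\<lambda>z::'e \<times> 'e. h (fst z)) v (?x, ?y) = dd h (fst v) ?x" "(\<lambda>z::'e \<times> 'e. h (fst z)) differentiable at (?x, ?y)"
    if "h differentiable at ?x" for h :: "'e \<Rightarrow> 'e" and v
  proof -
    have "fst differentiable at (?x, ?y)"
      by (rule bounded_linear_imp_differentiable[OF bounded_linear_fst])
    then show "dd (\<lambda>z::'e \<times> 'e. h (fst z)) v (?x, ?y) = dd h (fst v) ?x" "(\<lambda>z::'e \<times> 'e. h (fst z)) differentiable at (?x, ?y)"
      using dd_compose(1)[of fst "(?x, ?y)" h] dd_compose(2)[of fst "(?x, ?y)" h v] that
        dd_eq[OF bounded_linear_imp_has_derivative[OF bounded_linear_fst], of v "(?x, ?y)"] by auto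
  qed
  have dif: "dd ?f w differentiable at ?x" for w
    by (rule smooth_on_differentiable[OF smooth_on_dd[OF smooth_transit] o x]) (use assms in auto)
  have D: "((\<lambda>z. dd ?f (snd z) (fst z)) has_derivative
      (\<lambda>v. dd (\<lambda>z. dd ?f (snd (?x, ?y)) (fst z)) v (?x, ?y) + dd ?f (dd snd v (?x, ?y)) (fst (?x, ?y)))) (at (?x, ?y))"
    by (rule has_derivative_linear_family[OF o2, where F="\<lambda>z a. dd ?f a (fst z)"])
      (use x dif assms in \<open>auto intro!: fst(2) linear_dd transit_differentiable bounded_linear_imp_differentiable[OF bounded_linear_snd]\<close>)
  have "dtr S i j u (a, b) = dd (transit S i j) (a, b) (?x, ?y)"
    by (simp add: dtr_def slit_cmap)
  also have "\<dots> = dd (\<lambda>z. (?f (fst z), dd ?f (snd z) (fst z))) (a, b) (?x, ?y)"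
    by (rule dd_cong[of "?O \<times> (- {0})"])
      (use x y open_Times[OF o open_Compl[OF closed_singleton]] slit_transit[OF assms(1,2)]
        in \<open>simp_all add: mem_Times_iff split_paired_all\<close>)
  also have "\<dots> = (dd (\<lambda>z. ?f (fst z)) (a, b) (?x, ?y), dd (\<lambda>z. dd ?f ?y (fst z)) (a, b) (?x, ?y) + dd ?f (dd snd (a, b) (?x, ?y)) ?x)"
    by (rule dd_eq) (use has_derivative_Pair[OF dd_has_derivative[OF fst(2)[OF df]] D] in simp)
  also have "\<dots> = (dd ?f a ?x, dd (dd ?f ?y) a ?x + dd ?f b ?x)"
    using dd_eq[OF bounded_linear_imp_has_derivative[OF bounded_linear_snd], of "(a, b)" "(?x, ?y)"]
    by (simp add: fst(1) df dif)
  finally show ?thesis by (simp add: dtr_def)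
qed

lemma rho_tangent:
  assumes "i \<in> idx A" "u \<in> cdom S i" "w \<in> tangent_space S u"
  shows "rho w \<in> fibre A u"
  unfolding tangent_space_iff
proof (intro conjI allI impI ballI)
  have u: "snd u \<in> tangent_space A (fst u)" "snd u \<noteq> 0" using slit_cdomD[OF assms(2)] by auto
  have cd: "u \<in> cdom S k" if "fst u \<in> cdom A k" for k using u that by (cases u) auto
  show "rho w k = 0" if "\<not> (k \<in> idx A \<and> fst u \<in> cdom A k)" for k
  proof -
    have "\<not> (k \<in> idx S \<and> u \<in> cdom S k)" using that slit_cdomD[of u k] by auto
    then show ?thesis using S.tangent_outside[OF _ assms(3)] by (simp add: rho_def)
  qed
  fix k l assume k: "k \<in> idx A" "l \<in> idx A" "fst u \<in> cdom A k" "fst u \<in> cdom A l"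
  then have "w l = dtr S k l u (w k)" by (intro S.tangentD[OF _ _ _ _ assms(3)] cd) auto
  then show "rho w l = dtr A k l (fst u) (rho w k)"
    using slit_dtr[OF k(1,2) cd[OF k(3)] cd[OF k(4)], of "fst (w k)" "snd (w k)"] by (simp add: rho_def)
qed

lemma vlift_tangent:
  assumes "i \<in> idx A" "u \<in> cdom S i" "x \<in> fibre A u"
  shows "vlift x \<in> tangent_space S u"
  unfolding S.tangent_space_iff
proof (intro conjI allI impI ballI)
  have u: "snd u \<in> tangent_space A (fst u)" "snd u \<noteq> 0" using slit_cdomD[OF assms(2)] by auto
  have cd: "u \<in> cdom S k" if "fst u \<in> cdom A k" for k using u that by (cases u) auto
  show "vlift x k = 0" if "\<not> (k \<in> idx S \<and> u \<in> cdom S k)" for k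
    using that cd tangent_outside[OF _ assms(3), of k] by (auto simp: vlift_def zero_prod_def)
  fix k l assume "k \<in> idx S" "l \<in> idx S" and k: "u \<in> cdom S k" "u \<in> cdom S l"
  then have i: "k \<in> idx A" "l \<in> idx A" by auto
  have f: "fst u \<in> cdom A k" "fst u \<in> cdom A l" using k slit_cdomD by auto
  have lin: "linear (\<lambda>v. dd (dd (transit A k l) (snd u k)) v (cmap A k (fst u)))"
    by (rule linear_dd, rule smooth_on_differentiable[OF smooth_on_dd[OF smooth_transit[OF i]] open_overlap[OF i]])
      (rule overlapI[OF f])
  show "vlift x l = dtr S k l u (vlift x k)"
    using tangentD[OF i f assms(3)] linear_0[OF linear_dtr[OF i f]]
    by (simp add: vlift_def slit_dtr[OF i k] linear_0[OF lin])
qed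

lemma points_slit_chart: "u \<in> points S \<Longrightarrow> \<exists>i. i \<in> idx A \<and> u \<in> cdom S i"
  by (auto simp: points_def)

lemma cdom_points: "i \<in> idx A \<Longrightarrow> u \<in> cdom S i \<Longrightarrow> u \<in> points S"
  by (auto simp: points_def)

lemma pi_field_smooth: "pi_field A X \<Longrightarrow> i \<in> idx A \<Longrightarrow> smooth_on (cimage S i) (loc S i X)"
  by (simp add: pi_field_def loc_def[abs_def])

lemma pi_field_fibre: "pi_field A X \<Longrightarrow> u \<in> points S \<Longrightarrow> X u \<in> fibre A u"
  by (simp add: pi_field_def)

lemma pi_fieldI:
  assumes "\<And>u. u \<in> points S \<Longrightarrow> X u \<in> fibre A u" "\<And>i. i \<in> idx A \<Longrightarrow> smooth_on (cimage S i) (loc S i X)"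
  shows "pi_field A X"
  using assms by (simp add: pi_field_def loc_def[abs_def])

lemma loc_rho: "loc S i (\<lambda>u. rho (V u)) z = fst (loc S i V z)"
  by (simp add: loc_def rho_def)

lemma pi_field_rho:
  assumes "vector_field S V"
  shows "pi_field A (\<lambda>u. rho (V u))"
proof (rule pi_fieldI)
  show "rho (V u) \<in> fibre A u" if "u \<in> points S" for u
    using points_slit_chart[OF that] rho_tangent S.vector_field_tangent[OF assms] by fastforce
  show "smooth_on (cimage S i) (loc S i (\<lambda>u. rho (V u)))" if "i \<in> idx A" for i
    unfolding loc_rho[abs_def]
    by (intro smooth_on_fst S.open_cimage S.vector_field_smooth assms) (use that in auto)
qed

lemma vector_field_gam:
  assumes "pi_field A X"
  shows "vector_field S (gam X)"
  unfolding vector_field_def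
proof (intro conjI ballI)
  show "gam X u \<in> tangent_space S u" if "u \<in> points S" for u
    unfolding gam_def using points_slit_chart[OF that] vlift_tangent[OF _ _ pi_field_fibre[OF assms that]] by blast
  fix i assume "i \<in> idx S"
  then have "smooth_on (cimage S i) (\<lambda>z. (0 :: 'e, loc S i X z))"
    by (intro smooth_on_Pair smooth_on_const pi_field_smooth assms S.open_cimage) auto
  then show "smooth_on (cimage S i) (\<lambda>x. gam X (in_chart S i x) i)"
    by (simp add: gam_def vlift_def loc_def)
qed

lemma loc_gam: "loc S i (gam X) z = (0, loc S i X z)"
  by (simp add: loc_def gam_def vlift_def)

lemma loc_eta: "i \<in> idx A \<Longrightarrow> z \<in> cimage S i \<Longrightarrow> loc S i eta z = snd z"
  using S.cmap_in_chart[of i z] by (simp add: loc_def eta_def slit_cmap prod_eq_iff)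

lemma pi_field_eta: "pi_field A eta"
proof (rule pi_fieldI)
  show "eta u \<in> fibre A u" if "u \<in> points S" for u
    unfolding eta_def using points_slit_chart[OF that] slit_cdomD by blast
  show "smooth_on (cimage S i) (loc S i eta)" if "i \<in> idx A" for i
    by (rule smooth_on_cong[of _ snd])
      (use that S.open_cimage[of i] in \<open>auto simp: loc_eta intro: smooth_on_snd smooth_on_id\<close>)
qed

text \<open>A \<pi>-vector field is constrained on \<open>points S\<close> only, so its values may
  be altered elsewhere.\<close>

lemma pi_field_cong:
  assumes "pi_field A X" "\<And>u. u \<in> points S \<Longrightarrow> X u = Y u"
  shows "pi_field A Y"
proof (rule pi_fieldI)
  show "Y u \<in> fibre A u" if "u \<in> points S" for u using assms that pi_field_fibre by metis
  show "smooth_on (cimage S i) (loc S i Y)" if i: "i \<in> idx A" for i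
    by (rule smooth_on_cong[OF _ _ pi_field_smooth[OF assms(1) i]])
      (use i S.open_cimage[of i] assms(2)[OF cdom_points[OF i S.in_chart_cdom]] in \<open>simp_all add: loc_def\<close>)
qed

lemma pi_field_0: "pi_field A (\<lambda>u. 0)"
  by (rule pi_fieldI) (auto simp: tangent_0 loc_def[abs_def] smooth_on_const)

lemma loc_add: "loc S i (X + Y) z = loc S i X z + loc S i Y z"
  by (simp add: loc_def)

lemma pi_field_add:
  assumes "pi_field A X" "pi_field A Y"
  shows "pi_field A (X + Y)"
proof (rule pi_fieldI)
  show "(X + Y) u \<in> fibre A u" if "u \<in> points S" for u
    using pi_field_fibre[OF assms(1) that] pi_field_fibre[OF assms(2) that] by (simp add: tangent_add)
  show "smooth_on (cimage S i) (loc S i (X + Y))" if "i \<in> idx A" for i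
    unfolding loc_add[abs_def] by (intro smooth_on_add S.open_cimage pi_field_smooth assms) (use that in auto)
qed

lemma pi_field_scale:
  assumes "smooth_fun S f" "pi_field A X"
  shows "pi_field A (\<lambda>u. f u *\<^sub>R X u)"
proof (rule pi_fieldI)
  show "f u *\<^sub>R X u \<in> fibre A u" if "u \<in> points S" for u
    using pi_field_fibre[OF assms(2) that] by (simp add: tangent_scale)
  show "smooth_on (cimage S i) (loc S i (\<lambda>u. f u *\<^sub>R X u))" if "i \<in> idx A" for i
    using smooth_on_scaleR[OF S.open_cimage S.smooth_fun_chart[OF assms(1)] pi_field_smooth[OF assms(2) that]] that
    by (simp add: loc_def[abs_def])
qed

lemma pi_field_scale_const: "pi_field A X \<Longrightarrow> pi_field A (c *\<^sub>R X)"
  using pi_field_scale[OF S.smooth_fun_const, of X c] by (simp add: scaleR_fun_def)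

lemma pi_field_minus: "pi_field A X \<Longrightarrow> pi_field A (- X)"
  using pi_field_scale_const[of X "-1"] by simp

lemma pi_field_diff: "pi_field A X \<Longrightarrow> pi_field A Y \<Longrightarrow> pi_field A (X - Y)"
  using pi_field_add[OF _ pi_field_minus, of X Y] by simp

text \<open>Natural chart domains contain whole slit fibres, so a cutoff function of the base,
  lifted along the projection, is a cutoff function upstairs.\<close>

lemma slit_cutoff:
  assumes "cutoff A i U \<psi>"
  shows "cutoff S i (U \<times> (- {0})) (\<lambda>u. \<psi> (fst u))"
  unfolding cutoff_def
proof (intro conjI ballI)
  have i: "i \<in> idx A" "open U" "U \<subseteq> cimage A i" "smooth_fun A \<psi>" "\<And>x. x \<in> U \<Longrightarrow> \<psi> (in_chart A i x) = 1"
    using assms by (auto simp: cutoff_def)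
  show "i \<in> idx S" "open (U \<times> (- {0 :: 'e}))" using i(1) open_Times[OF i(2) open_Compl[OF closed_singleton]] by simp_all
  show sub: "U \<times> (- {0}) \<subseteq> cimage S i" using i by (auto simp: slit_cimage)
  show "smooth_fun S (\<lambda>u. \<psi> (fst u))"
    unfolding smooth_fun_def
  proof
    fix j assume "j \<in> idx S"
    then have j: "j \<in> idx A" by simp
    have o: "open (cimage S j)" using j S.open_cimage by simp
    have "smooth_on (cimage S j) (\<lambda>z. \<psi> (in_chart A j (fst z)))"
      by (rule smooth_on_compose[OF o open_cimage[OF j] _ smooth_on_fst[OF o smooth_on_id] smooth_fun_chart[OF i(4) j]])
        (auto simp: slit_cimage j)
    then show "smooth_on (cimage S j) (\<lambda>z. \<psi> (fst (in_chart S j z)))"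
      by (rule smooth_on_cong[OF o, rotated])
        (use slit_in_chart[OF j] in \<open>simp add: slit_cimage[OF j] mem_Times_iff split_paired_all\<close>)
  qed
  show "\<psi> (fst (in_chart S i z)) = 1" if "z \<in> U \<times> (- {0})" for z
    using that i by (cases z) (auto simp: slit_in_chart subset_iff)
  fix j q assume j: "j \<in> idx S" and q: "q \<in> cdom S j - cdom S i"
  then have "fst q \<in> cdom A j" "fst q \<notin> cdom A i" "j \<in> idx A" by (cases q; auto)+
  then obtain T where T: "open T" "cmap A j (fst q) \<in> T" "T \<subseteq> cimage A j" "\<And>x. x \<in> T \<Longrightarrow> \<psi> (in_chart A j x) = 0"
    using cutoff_zero[OF assms] by metis
  have "snd q j \<noteq> 0" using q j tangent_component_0[of j "fst q" "snd q"] by (cases q) auto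
  show "\<exists>T. open T \<and> cmap S j q \<in> T \<and> T \<subseteq> cimage S j \<and> (\<forall>x\<in>T. \<psi> (fst (in_chart S j x)) = 0)"
  proof (intro exI[of _ "T \<times> (- {0})"] conjI ballI)
    show "open (T \<times> (- {0 :: 'e}))" by (rule open_Times[OF T(1) open_Compl[OF closed_singleton]])
    show "cmap S j q \<in> T \<times> (- {0})" using T(2) \<open>snd q j \<noteq> 0\<close> by (simp add: slit_cmap)
    show "T \<times> (- {0}) \<subseteq> cimage S j" using T(3) \<open>j \<in> idx A\<close> by (auto simp only: slit_cimage)
    show "\<psi> (fst (in_chart S j z)) = 0" if "z \<in> T \<times> (- {0})" for z
      using that T(3,4) \<open>j \<in> idx A\<close> by (cases z) (auto simp: slit_in_chart subset_iff)
  qed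
qed

lemma cutoff_outside:
  assumes "cutoff S i U \<psi>" "u \<in> points S" "u \<notin> cdom S i"
  shows "\<psi> u = 0"
proof -
  obtain j where j: "j \<in> idx A" "u \<in> cdom S j" using points_slit_chart assms by blast
  obtain T where "cmap S j u \<in> T" "\<And>x. x \<in> T \<Longrightarrow> \<psi> (in_chart S j x) = 0"
    using S.cutoff_zero[OF assms(1) _ j(2) assms(3)] j(1) slit_simps(1) by metis
  then show ?thesis using S.in_chart_cmap[OF _ j(2)] j(1) slit_simps(1) by metis
qed

lemma slit_cutoffs:
  assumes "i \<in> idx A" "u \<in> cdom S i"
  obtains U \<psi> where "cutoff S i U \<psi>" "cmap S i u \<in> U"
proof -
  have u: "fst u \<in> cdom A i" "snd u i \<noteq> 0"
    using slit_cdomD[OF assms(2)] tangent_component_0 assms by auto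
  then obtain U \<psi> where "cutoff A i U \<psi>" "cmap A i (fst u) \<in> U" using cutoffs assms by blast
  then show thesis using that slit_cutoff u by (fastforce simp: slit_cmap)
qed

lemma extend_vector_field:
  assumes "cutoff S i U \<psi>" "smooth_on (cimage S i) h"
  obtains V where "vector_field S V" "\<And>z. z \<in> U \<Longrightarrow> loc S i V z = h z"
    "\<And>u. u \<in> cdom S i \<Longrightarrow> V u i = \<psi> u *\<^sub>R h (cmap S i u)" "\<And>u. u \<notin> cdom S i \<Longrightarrow> V u = 0"
proof
  let ?V = "\<lambda>p. if p \<in> cdom S i then \<psi> p *\<^sub>R tvec S i p (h (cmap S i p)) else 0"
  show "vector_field S ?V" by (rule S.cutoff_vector_field[OF assms])
  have i: "i \<in> idx S" "U \<subseteq> cimage S i" "\<And>x. x \<in> U \<Longrightarrow> \<psi> (in_chart S i x) = 1"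
    using assms(1) by (auto simp: cutoff_def)
  show "loc S i ?V z = h z" if "z \<in> U" for z
  proof -
    have z: "z \<in> cimage S i" using i that by blast
    show ?thesis using i that S.in_chart_cdom[OF i(1) z] S.cmap_in_chart[OF i(1) z] by (simp add: loc_def)
  qed
  show "?V u i = \<psi> u *\<^sub>R h (cmap S i u)" if "u \<in> cdom S i" for u using i that by simp
qed simp

lemma extend_pi_field:
  assumes "cutoff S i U \<psi>" "smooth_on (cimage S i) h"
  obtains X where "pi_field A X" "\<And>z. z \<in> U \<Longrightarrow> loc S i X z = h z"
    "\<And>u. u \<in> cdom S i \<Longrightarrow> X u i = \<psi> u *\<^sub>R h (cmap S i u)" "\<And>u. u \<notin> cdom S i \<Longrightarrow> X u = 0"
proof -
  have i: "i \<in> idx S" using assms(1) by (auto simp: cutoff_def)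
  have "smooth_on (cimage S i) (\<lambda>z. (h z, 0 :: 'e))"
    by (intro smooth_on_Pair smooth_on_const assms S.open_cimage i)
  from extend_vector_field[OF assms(1) this] obtain V where V: "vector_field S V"
    "\<And>z. z \<in> U \<Longrightarrow> loc S i V z = (h z, 0)"
    "\<And>u. u \<in> cdom S i \<Longrightarrow> V u i = \<psi> u *\<^sub>R (h (cmap S i u), 0)" "\<And>u. u \<notin> cdom S i \<Longrightarrow> V u = 0" by blast
  show thesis
    by (rule that[OF pi_field_rho[OF V(1)]]) (use V in \<open>auto simp: loc_rho\<close>, auto simp: rho_def zero_fun_def)
qed

lemma exists_pi_field:
  assumes "u \<in> points S" "a \<in> fibre A u"
  obtains X where "pi_field A X" "X u = a"
proof -
  obtain i where i: "i \<in> idx A" "u \<in> cdom S i" using points_slit_chart assms by blast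
  obtain U \<psi> where c: "cutoff S i U \<psi>" "cmap S i u \<in> U" using slit_cutoffs[OF i] by blast
  obtain X where X: "pi_field A X" "\<And>z. z \<in> U \<Longrightarrow> loc S i X z = a i"
    using extend_pi_field[OF c(1) smooth_on_const] by metis
  have "X u i = a i" using X(2)[OF c(2)] i by (simp add: loc_def)
  then have "X u = a"
    using tangent_eqI[OF i(1) _ pi_field_fibre[OF X(1) assms(1)] assms(2)] slit_cdomD[OF i(2)] by blast
  then show thesis using that X by blast
qed

lemma pi_extension:
  assumes "u \<in> points S" "a \<in> fibre A u"
  shows "pi_field A (pi_extension A u a)" "pi_extension A u a u = a"
  using someI_ex[of "\<lambda>Z. pi_field A Z \<and> Z u = a"] exists_pi_field[OF assms]
  unfolding pi_extension_def by metis+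

end

lemma smooth_on_bilinear_family:
  fixes F :: "'a::euclidean_space \<Rightarrow> 'b::euclidean_space \<Rightarrow> 'c::euclidean_space \<Rightarrow> 'd::real_normed_vector"
  assumes S: "open S" and F: "\<And>a b. smooth_on S (\<lambda>x. F x a b)"
    and lin: "\<And>x b. x \<in> S \<Longrightarrow> linear (\<lambda>a. F x a b)" "\<And>x a. x \<in> S \<Longrightarrow> linear (F x a)"
    and W: "smooth_on S W" and Z: "smooth_on S Z"
  shows "smooth_on S (\<lambda>y. F y (W y) (Z y))"
  by (rule smooth_on_linear_family[OF S smooth_on_linear_family[OF S F lin(1) W] lin(2) Z])

lemma dd_bilinear_family:
  fixes F :: "'a::euclidean_space \<Rightarrow> 'b::euclidean_space \<Rightarrow> 'c::euclidean_space \<Rightarrow> 'd::real_normed_vector"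
  assumes S: "open S" "x \<in> S" and F: "\<And>a b. smooth_on S (\<lambda>x. F x a b)"
    and lin: "\<And>x b. x \<in> S \<Longrightarrow> linear (\<lambda>a. F x a b)" "\<And>x a. x \<in> S \<Longrightarrow> linear (F x a)"
    and W: "smooth_on S W" and Z: "smooth_on S Z"
  shows "dd (\<lambda>y. F y (W y) (Z y)) v x = dd (\<lambda>y. F y (W x) (Z x)) v x + F x (dd W v x) (Z x) + F x (W x) (dd Z v x)"
  using dd_linear_family[OF S smooth_on_linear_family[OF S(1) F lin(1) W] lin(2) Z]
    dd_linear_family[OF S F lin(1) W, of "Z x" v] by simp

lemma sum_apply: "(\<Sum>k\<in>I. f k) x = (\<Sum>k\<in>I. f k x)"
  by (induction I rule: infinite_finite_induct) auto

section \<open>Rules of calculus for a linear connection on the pullback bundle\<close>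

locale conn_atlas = cutoff_atlas A for A :: "('i, 'm, 'e::euclidean_space) atlas" +
  fixes D :: "('i, 'm, 'e) conn"
  assumes linear_conn: "linear_connection A D"
begin

lemma pi_field_nab: "vector_field S V \<Longrightarrow> pi_field A Z \<Longrightarrow> pi_field A (nab D V Z)"
  using linear_conn by (simp add: linear_connection_def)

context
  fixes u w Z
  assumes u: "u \<in> points S" and w: "w \<in> tangent_space S u" and Z: "pi_field A Z"
begin

lemma D_props:
  "D u w Z \<in> fibre A u \<and>
    (\<forall>w'\<in>tangent_space S u. \<forall>r. D u (r *\<^sub>R w + w') Z = r *\<^sub>R D u w Z + D u w' Z) \<and>
    (\<forall>Z'. pi_field A Z' \<longrightarrow> D u w (Z + Z') = D u w Z + D u w Z') \<and>
    (\<forall>f. smooth_fun S f \<longrightarrow>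
      D u w (\<lambda>v. f v *\<^sub>R Z v) = dir_deriv S f u w *\<^sub>R Z u + f u *\<^sub>R D u w Z)"
  using linear_conn u w Z unfolding linear_connection_def by blast

lemma D_fibre: "D u w Z \<in> fibre A u"
  using D_props by blast

lemma D_add: "pi_field A Z' \<Longrightarrow> D u w (Z + Z') = D u w Z + D u w Z'"
  using D_props by blast

lemma D_leibniz: "smooth_fun S f \<Longrightarrow> D u w (\<lambda>v. f v *\<^sub>R Z v) = dir_deriv S f u w *\<^sub>R Z u + f u *\<^sub>R D u w Z"
  using D_props by blast

lemma D_dir_linear: "w' \<in> tangent_space S u \<Longrightarrow> D u (r *\<^sub>R w + w') Z = r *\<^sub>R D u w Z + D u w' Z"
  using D_props by blast

end

lemma dir_deriv_const: "u \<in> points S \<Longrightarrow> dir_deriv S (\<lambda>u. c) u w = 0"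
  using dd_const[of c] by (simp add: dir_deriv_def Let_def dd_def)

lemma D_scale:
  assumes "u \<in> points S" "w \<in> tangent_space S u" "pi_field A Z"
  shows "D u w (c *\<^sub>R Z) = c *\<^sub>R D u w Z"
  using D_leibniz[OF assms S.smooth_fun_const, of c] dir_deriv_const[OF assms(1), of c w]
  by (simp add: scaleR_fun_def zero_fun_def plus_fun_def)

lemma D_zero:
  assumes "u \<in> points S" "w \<in> tangent_space S u"
  shows "D u w (\<lambda>u. 0) = 0"
  using D_scale[OF assms pi_field_0, of 0] by (simp add: scaleR_fun_def zero_fun_def)

lemma D_minus:
  assumes "u \<in> points S" "w \<in> tangent_space S u" "pi_field A Z"
  shows "D u w (- Z) = - D u w Z"
  using D_scale[OF assms, of "-1"] by simp

lemma D_diff: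
  assumes "u \<in> points S" "w \<in> tangent_space S u" "pi_field A Z" "pi_field A Z'"
  shows "D u w (Z - Z') = D u w Z - D u w Z'"
  using D_add[OF assms(1-3) pi_field_minus[OF assms(4)]] D_minus[OF assms(1,2,4)] by simp

text \<open>Values off \<open>points S\<close> are junk, and the indicator function of the complement of \<open>points S\<close>
  counts as smooth: the Leibniz rule with this function removes the junk.\<close>

lemma D_cong:
  assumes "u \<in> points S" "w \<in> tangent_space S u" "pi_field A Z" "\<And>v. v \<in> points S \<Longrightarrow> Z v = Z' v"
  shows "D u w Z = D u w Z'"
proof -
  have Z': "pi_field A Z'" by (rule pi_field_cong[OF assms(3,4)])
  let ?f = "\<lambda>v. if v \<in> points S then 0 else 1 :: real"
  have "smooth_fun S ?f"
    unfolding smooth_fun_def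
  proof
    fix i assume i: "i \<in> idx S"
    show "smooth_on (cimage S i) (\<lambda>x. ?f (in_chart S i x))"
      by (rule smooth_on_cong[OF S.open_cimage[OF i] _ smooth_on_const[of _ 0]])
        (use i S.in_chart_cdom[OF i] cdom_points in auto)
  qed
  then have "D u w (\<lambda>v. ?f v *\<^sub>R (Z - Z') v) = 0"
    using D_leibniz[OF assms(1,2) pi_field_diff[OF assms(3) Z']] assms(1,4) by simp
  moreover have "(\<lambda>v. ?f v *\<^sub>R (Z - Z') v) = Z - Z'"
    using assms(4) by (auto simp: fun_eq_iff)
  ultimately show ?thesis using D_diff[OF assms(1-3) Z'] by simp
qed

lemma D_sum:
  assumes "finite I" "u \<in> points S" "w \<in> tangent_space S u" "\<And>k. k \<in> I \<Longrightarrow> pi_field A (Z k)"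
  shows "pi_field A (\<lambda>v. \<Sum>k\<in>I. Z k v) \<and> D u w (\<lambda>v. \<Sum>k\<in>I. Z k v) = (\<Sum>k\<in>I. D u w (Z k))"
  using assms(1,4)
proof (induction I rule: finite_induct)
  case empty
  then show ?case using D_zero[OF assms(2,3)] pi_field_0 by (simp add: zero_fun_def)
next
  case (insert k I)
  have "(\<lambda>v. \<Sum>k\<in>insert k I. Z k v) = Z k + (\<lambda>v. \<Sum>k\<in>I. Z k v)"
    using insert.hyps by (simp add: fun_eq_iff)
  moreover have "pi_field A (\<lambda>v. \<Sum>k\<in>I. Z k v)" "D u w (\<lambda>v. \<Sum>k\<in>I. Z k v) = (\<Sum>k\<in>I. D u w (Z k))"
    "pi_field A (Z k)"
    using insert by auto
  ultimately show ?case
    using D_add[OF assms(2,3)] pi_field_add sum.insert[OF insert.hyps, of "\<lambda>k. D u w (Z k)"] by metis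
qed

subsection \<open>The connection form in a chart\<close>

text \<open>\<open>D\<close> acts on global fields only, so its locality has to be extracted from the Leibniz rule: with a
  cutoff function \<open>\<psi>\<close>, the global fields \<open>e\<^sub>b = \<psi> b\<close> and the global functions \<open>f\<^sub>b = \<psi> (Z \<bullet> b)\<close> one has
  \<open>\<psi>\<^sup>2 Z = (\<Sum>b. f\<^sub>b e\<^sub>b)\<close>.\<close>

lemma D_vanishing:
  assumes i: "i \<in> idx A" and u: "u \<in> cdom S i" and w: "w \<in> tangent_space S u" and Z: "pi_field A Z"
    and 0: "Z u = 0"
  shows "D u w Z i = dd (loc S i Z) (w i) (cmap S i u)"
proof -
  let ?z = "cmap S i u"
  have up: "u \<in> points S" by (rule cdom_points[OF i u])
  have iS: "i \<in> idx S" using i by simp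
  have zU: "?z \<in> cimage S i" "open (cimage S i)" using u S.open_cimage[OF iS] by auto
  obtain U \<psi> where c: "cutoff S i U \<psi>" "?z \<in> U" using slit_cutoffs[OF i u] by blast
  have psi: "smooth_fun S \<psi>" "\<psi> u = 1"
    using c S.in_chart_cmap[OF iS u] by (auto simp: cutoff_def)
  have sm: "smooth_on (cimage S i) (loc S i Z)" by (rule pi_field_smooth[OF Z i])
  have "\<exists>e. pi_field A e \<and> (\<forall>v\<in>cdom S i. e v i = \<psi> v *\<^sub>R b) \<and> (\<forall>v. v \<notin> cdom S i \<longrightarrow> e v = 0)" for b
    using extend_pi_field[OF c(1) smooth_on_const] by metis
  then obtain e where e: "\<And>b. pi_field A (e b)" "\<And>b v. v \<in> cdom S i \<Longrightarrow> e b v i = \<psi> v *\<^sub>R b"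
    "\<And>b v. v \<notin> cdom S i \<Longrightarrow> e b v = 0" by metis
  define f where "f = (\<lambda>b v. if v \<in> cdom S i then \<psi> v *\<^sub>R (loc S i Z (cmap S i v) \<bullet> b) else 0)"
  have f: "smooth_fun S (f b)" for b
    unfolding f_def by (rule S.cutoff_extend[OF c(1)], rule smooth_on_linear[OF bounded_linear_inner_left zU(2) sm])
  have locZ: "loc S i Z (cmap S i v) = Z v i" if "v \<in> cdom S i" for v
    using S.in_chart_cmap[OF iS that] by (simp add: loc_def)
  define F where "F = (\<lambda>v. \<Sum>b\<in>Basis. f b v *\<^sub>R e b v)"
  have pf: "pi_field A (\<lambda>v. f b v *\<^sub>R e b v)" for b by (rule pi_field_scale[OF f e(1)])
  have F: "pi_field A F" "D u w F = (\<Sum>b\<in>Basis. D u w (\<lambda>v. f b v *\<^sub>R e b v))"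
    using D_sum[OF finite_Basis up w, of "\<lambda>b v. f b v *\<^sub>R e b v", OF pf] by (simp_all add: F_def)
  have psi2: "smooth_fun S (\<lambda>v. \<psi> v * \<psi> v)"
    using S.smooth_fun_chart[OF psi(1)] S.open_cimage by (auto simp: smooth_fun_def intro!: smooth_on_mult)
  have "F v = (\<psi> v * \<psi> v) *\<^sub>R Z v" if v: "v \<in> points S" for v
  proof (cases "v \<in> cdom S i")
    case True
    have "F v i = (\<psi> v * \<psi> v) *\<^sub>R (\<Sum>b\<in>Basis. (Z v i \<bullet> b) *\<^sub>R b)"
      using True by (simp add: F_def sum_apply f_def locZ e(2) scaleR_sum_right mult_ac)
    then have "F v i = ((\<psi> v * \<psi> v) *\<^sub>R Z v) i" by (simp add: euclidean_representation)
    then show ?thesis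
      using tangent_eqI[OF i _ pi_field_fibre[OF F(1) v] tangent_scale[OF pi_field_fibre[OF Z v]]] slit_cdomD[OF True]
      by blast
  next
    case False
    then show ?thesis using cutoff_outside[OF c(1) v] by (simp add: F_def e(3))
  qed
  then have "D u w F = D u w (\<lambda>v. (\<psi> v * \<psi> v) *\<^sub>R Z v)"
    by (rule D_cong[OF up w F(1)])
  \<comment> \<open>\<open>Z u = 0\<close> removes the term with the derivative of the factor, and
    the factor itself is 1 at \<open>u\<close>.\<close>
  also have "\<dots> = D u w Z"
    using D_leibniz[OF up w Z psi2] psi(2) 0 by simp
  finally have DZ: "D u w F = D u w Z" .
  have "D u w Z i = (\<Sum>b\<in>Basis. D u w (\<lambda>v. f b v *\<^sub>R e b v) i)"
    unfolding DZ[symmetric] F(2) by (rule sum_apply)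
  also have "\<dots> = (\<Sum>b\<in>Basis. (dd (loc S i Z) (w i) ?z \<bullet> b) *\<^sub>R b)"
  proof (rule sum.cong[OF refl])
    fix b :: 'e assume "b \<in> Basis"
    let ?g = "\<lambda>x. loc S i Z x \<bullet> b"
    have gd: "?g differentiable at ?z"
      using smooth_on_differentiable[OF smooth_on_linear[OF bounded_linear_inner_left zU(2) sm] zU(2,1)] .
    have "open U" "U \<subseteq> cimage S i" and "\<And>x. x \<in> U \<Longrightarrow> \<psi> (in_chart S i x) = 1"
      using c(1) by (auto simp: cutoff_def)
    then have eq: "?g x = f b (in_chart S i x)" if "x \<in> U" for x
    proof -
      have "x \<in> cimage S i" using that \<open>U \<subseteq> cimage S i\<close> by blast
      then show ?thesis
        using that S.in_chart_cdom[OF iS] S.cmap_in_chart[OF iS] \<open>\<And>x. x \<in> U \<Longrightarrow> \<psi> (in_chart S i x) = 1\<close>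
        by (simp add: f_def)
    qed
    have "dir_deriv S (f b) u w = dd (\<lambda>x. f b (in_chart S i x)) (w i) ?z"
      by (rule S.dir_deriv_chart[OF iS u differentiable_cong_open[OF \<open>open U\<close> c(2) eq gd] w])
    also have "\<dots> = dd ?g (w i) ?z"
      by (rule dd_cong[OF \<open>open U\<close> c(2), symmetric]) (rule eq)
    also have "\<dots> = dd (loc S i Z) (w i) ?z \<bullet> b"
      by (rule dd_linear[OF bounded_linear_inner_left]) (rule smooth_on_differentiable[OF sm zU(2,1)])
    finally have dfb: "dir_deriv S (f b) u w = dd (loc S i Z) (w i) ?z \<bullet> b" .
    \<comment> \<open>With a vanishing coefficient only its derivative survives in the Leibniz rule,
      and the unknown \<open>D u w (e b)\<close> drops out.\<close>
    have "f b u = 0" using 0 u by (simp add: f_def locZ)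
    then show "D u w (\<lambda>v. f b v *\<^sub>R e b v) i = (dd (loc S i Z) (w i) ?z \<bullet> b) *\<^sub>R b"
      using D_leibniz[OF up w e(1) f] dfb e(2)[OF u] psi(2) by simp
  qed
  finally show ?thesis by (simp add: euclidean_representation)
qed

text \<open>The difference between \<open>D\<close> and the flat derivative of the chart. By \<open>D_vanishing\<close> it does not
  depend on the extension chosen.\<close>

definition om :: "'i \<Rightarrow> 'e \<times> 'e \<Rightarrow> 'e \<times> 'e \<Rightarrow> 'e \<Rightarrow> 'e" where
  "om i z w a = (let u = in_chart S i z; Z = pi_extension A u (tvec A i (fst u) a)
     in D u (tvec S i u w) Z i - dd (loc S i Z) w z)"

text \<open>\<open>Z\<close> and the extension used in \<open>om\<close> agree at \<open>u\<close>,
  so \<open>D_vanishing\<close> applies to their difference; every field through \<open>Z u\<close>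
  yields the same value of \<open>om\<close>.\<close>

lemma D_chart:
  assumes i: "i \<in> idx A" and u: "u \<in> cdom S i" and w: "w \<in> tangent_space S u" and Z: "pi_field A Z"
  shows "D u w Z i = dd (loc S i Z) (w i) (cmap S i u) + om i (cmap S i u) (w i) (Z u i)"
proof -
  have iS: "i \<in> idx S" using i by simp
  have up: "u \<in> points S" by (rule cdom_points[OF i u])
  have fu: "fst u \<in> cdom A i" using slit_cdomD[OF u] by simp
  have Zu: "Z u \<in> fibre A u" by (rule pi_field_fibre[OF Z up])
  let ?E = "pi_extension A u (Z u)" and ?z = "cmap S i u"
  note E = pi_extension[OF up Zu]
  have "om i ?z (w i) (Z u i) = D u w ?E i - dd (loc S i ?E) (w i) ?z"
    using S.in_chart_cmap[OF iS u] tangent_eq_tvec[OF i fu Zu] S.tangent_eq_tvec[OF iS u w]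
    by (simp add: om_def Let_def)
  moreover have "D u w Z i - D u w ?E i = dd (loc S i (Z - ?E)) (w i) ?z"
    using D_vanishing[OF i u w pi_field_diff[OF Z E(1)]] E(2) D_diff[OF up w Z E(1)] by simp
  moreover have "dd (loc S i (Z - ?E)) (w i) ?z = dd (loc S i Z) (w i) ?z - dd (loc S i ?E) (w i) ?z"
  proof -
    have "loc S i (Z - ?E) = (\<lambda>x. loc S i Z x - loc S i ?E x)" by (simp add: loc_def fun_eq_iff)
    moreover have "loc S i X differentiable at ?z" if "pi_field A X" for X
      using smooth_on_differentiable[OF pi_field_smooth[OF that i] S.open_cimage[OF iS]] u by blast
    ultimately show ?thesis using Z E(1) by (simp add: dd_diff)
  qed
  ultimately have "om i ?z (w i) (Z u i) = D u w ?E i - dd (loc S i ?E) (w i) ?z"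
    "D u w Z i = D u w ?E i + (dd (loc S i Z) (w i) ?z - dd (loc S i ?E) (w i) ?z)"
    by (simp_all add: diff_eq_eq)
  then show ?thesis by simp
qed

lemma loc_cmap: "i \<in> idx A \<Longrightarrow> u \<in> cdom S i \<Longrightarrow> loc S i X (cmap S i u) = X u i"
  using S.in_chart_cmap by (simp add: loc_def)

lemma loc_nab:
  assumes i: "i \<in> idx A" and z: "z \<in> cimage S i" and V: "vector_field S V" and Z: "pi_field A Z"
  shows "loc S i (nab D V Z) z = dd (loc S i Z) (loc S i V z) z + om i z (loc S i V z) (loc S i Z z)"
proof -
  obtain u where u: "u \<in> cdom S i" "z = cmap S i u" using z by blast
  have w: "V u \<in> tangent_space S u" using S.vector_field_tangent[OF V _ u(1)] i by simp
  show ?thesis using D_chart[OF i u(1) w Z] u by (simp add: loc_cmap i nab_def)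
qed

lemma om_field:
  assumes "i \<in> idx A" "z \<in> cimage S i" "pi_field A Z"
  shows "om i z w (loc S i Z z) = D (in_chart S i z) (tvec S i (in_chart S i z) w) Z i - dd (loc S i Z) w z"
proof -
  let ?u = "in_chart S i z"
  have iS: "i \<in> idx S" using assms by simp
  have u: "?u \<in> cdom S i" "cmap S i ?u = z" using S.in_chart_cdom[OF iS assms(2)] S.cmap_in_chart[OF iS assms(2)] by auto
  show ?thesis
    using D_chart[OF assms(1) u(1) S.tvec_tangent[OF iS u(1)] assms(3), of w] S.tvec_same[OF iS u(1), of w] u(2)
    by (simp add: loc_def)
qed

lemma exists_loc:
  assumes "i \<in> idx A" "z \<in> cimage S i"
  obtains X where "pi_field A X" "loc S i X z = a"
proof -
  let ?u = "in_chart S i z"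
  have iS: "i \<in> idx S" using assms by simp
  have u: "?u \<in> cdom S i" using S.in_chart_cdom[OF iS assms(2)] by auto
  have "fst ?u \<in> cdom A i" using slit_cdomD[OF u] by blast
  then show thesis
    using exists_pi_field[OF cdom_points[OF assms(1) u] tvec_tangent[OF assms(1)], of a] that assms(1)
    by (metis loc_def tvec_same)
qed

text \<open>\<open>om_field\<close> evaluates \<open>om\<close> on any global field through the
  given vector, so sums and multiples of fields witness linearity in \<open>a\<close>. Linearity in
  the direction is an axiom of the connection, transported by \<open>tvec\<close>.\<close>

lemma linear_om:
  assumes i: "i \<in> idx A" and z: "z \<in> cimage S i"
  shows "linear (om i z w)" "linear (\<lambda>w. om i z w a)"
proof -
  let ?u = "in_chart S i z"
  have iS: "i \<in> idx S" using i by simp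
  have u: "?u \<in> cdom S i" using S.in_chart_cdom[OF iS z] by auto
  have up: "?u \<in> points S" by (rule cdom_points[OF i u])
  have tv: "tvec S i ?u w \<in> tangent_space S ?u" for w by (rule S.tvec_tangent[OF iS u])
  have d: "loc S i X differentiable at z" if "pi_field A X" for X
    using smooth_on_differentiable[OF pi_field_smooth[OF that i] S.open_cimage[OF iS]] z by blast
  show "linear (om i z w)"
  proof (rule linearI)
    fix a b :: 'e and r :: real
    obtain X where X: "pi_field A X" "loc S i X z = a" using exists_loc[OF i z] by blast
    obtain Y where Y: "pi_field A Y" "loc S i Y z = b" using exists_loc[OF i z] by blast
    have s: "loc S i (X + Y) = (\<lambda>x. loc S i X x + loc S i Y x)" "loc S i (r *\<^sub>R X) = (\<lambda>x. r *\<^sub>R loc S i X x)"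
      by (simp_all add: loc_def fun_eq_iff)
    have "om i z w (loc S i (X + Y) z) = om i z w (loc S i X z) + om i z w (loc S i Y z)"
      using D_add[OF up tv X(1) Y(1)] dd_add[OF d[OF X(1)] d[OF Y(1)]]
      by (simp add: om_field[OF i z X(1)] om_field[OF i z Y(1)] om_field[OF i z pi_field_add[OF X(1) Y(1)]])
        (simp add: s)
    then show "om i z w (a + b) = om i z w a + om i z w b" using X Y by (simp add: s)
    have "om i z w (loc S i (r *\<^sub>R X) z) = r *\<^sub>R om i z w (loc S i X z)"
      using D_scale[OF up tv X(1)] dd_linear[OF bounded_linear_scaleR_right d[OF X(1)]]
      by (simp add: om_field[OF i z X(1)] om_field[OF i z pi_field_scale_const[OF X(1)]])
        (simp add: s scaleR_diff_right)
    then show "om i z w (r *\<^sub>R a) = r *\<^sub>R om i z w a" using X by (simp add: s)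
  qed
  show "linear (\<lambda>w. om i z w a)"
  proof -
    obtain X where X: "pi_field A X" "loc S i X z = a" using exists_loc[OF i z] by blast
    have tadd: "tvec S i ?u (r *\<^sub>R v + w) = r *\<^sub>R tvec S i ?u v + tvec S i ?u w" for r v w
      by (rule S.tangent_eqI[OF iS u]) (use S.tvec_same[OF iS u] in \<open>simp_all add: S.tangent_add S.tangent_scale tv\<close>)
    have l: "om i z (r *\<^sub>R v + w) a = r *\<^sub>R om i z v a + om i z w a" for r v w
      using D_dir_linear[OF up tv X(1) tv, of r v w] linear_add[OF linear_dd[OF d[OF X(1)]], of "r *\<^sub>R v" w]
        linear_scale[OF linear_dd[OF d[OF X(1)]], of r v]
      unfolding X(2)[symmetric] by (simp only: om_field[OF i z X(1)] tadd) (simp add: algebra_simps)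
    have l0: "om i z 0 a = 0" using l[of 1 0 0] by simp
    show ?thesis
      by (rule linearI) (use l[of 1] l[of _ _ 0] l0 in auto)
  qed
qed

text \<open>A single neighbourhood serves all constants, since the cutoff function is chosen before
  the components are.\<close>

lemma local_frame:
  assumes "i \<in> idx A" "z \<in> cimage S i"
  obtains U where "open U" "z \<in> U" "U \<subseteq> cimage S i"
    "\<And>a. \<exists>X. pi_field A X \<and> (\<forall>y\<in>U. loc S i X y = a)"
    "\<And>w. \<exists>V. vector_field S V \<and> (\<forall>y\<in>U. loc S i V y = w)"
proof -
  obtain u where u: "u \<in> cdom S i" "z = cmap S i u" using assms by blast
  obtain U \<psi> where c: "cutoff S i U \<psi>" "z \<in> U" using slit_cutoffs[OF assms(1) u(1)] u by blast
  show thesis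
    by (rule that[of U]) (use c extend_pi_field[OF c(1) smooth_on_const] extend_vector_field[OF c(1) smooth_on_const]
        in \<open>metis cutoff_def\<close>)+
qed

text \<open>Where \<open>V\<close> and \<open>X\<close> have constant components, the flat
  derivative of \<open>X\<close> vanishes, and \<open>om\<close> is the component of the smooth
  field \<open>nab D V X\<close>.\<close>

lemma smooth_om:
  assumes i: "i \<in> idx A"
  shows "smooth_on (cimage S i) (\<lambda>z. om i z w a)"
proof (rule smooth_on_local)
  fix z assume z: "z \<in> cimage S i"
  obtain U where U: "open U" "z \<in> U" "U \<subseteq> cimage S i"
    "\<And>a. \<exists>X. pi_field A X \<and> (\<forall>y\<in>U. loc S i X y = a)"
    "\<And>w. \<exists>V. vector_field S V \<and> (\<forall>y\<in>U. loc S i V y = w)"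
    using local_frame[OF i z] by metis
  obtain X V where X: "pi_field A X" "\<And>y. y \<in> U \<Longrightarrow> loc S i X y = a"
    and V: "vector_field S V" "\<And>y. y \<in> U \<Longrightarrow> loc S i V y = w" using U(4,5) by metis
  have "smooth_on U (loc S i (nab D V X))"
    by (rule smooth_on_subset[OF pi_field_smooth[OF pi_field_nab[OF V(1) X(1)] i] U(3)])
  moreover have "loc S i (nab D V X) y = om i y w a" if y: "y \<in> U" for y
  proof -
    have "dd (loc S i X) w y = dd (\<lambda>_. a) w y" by (rule dd_cong[OF U(1) y]) (rule X(2))
    then show ?thesis using loc_nab[OF i _ V(1) X(1), of y] U(3) y X(2) V(2) by auto
  qed
  ultimately show "\<exists>T. open T \<and> z \<in> T \<and> smooth_on T (\<lambda>z. om i z w a)"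
    using U(1,2) smooth_on_cong by metis
qed

text \<open>The curvature form of \<open>om\<close> with the sign of \<open>curvature\<close>,
  opposite to the usual one; the directions are constant vectors, so no bracket term occurs.\<close>

definition Om :: "'i \<Rightarrow> 'e \<times> 'e \<Rightarrow> 'e \<times> 'e \<Rightarrow> 'e \<times> 'e \<Rightarrow> 'e \<Rightarrow> 'e" where
  "Om i z v w a = dd (\<lambda>y. om i y v a) w z - dd (\<lambda>y. om i y w a) v z + om i z w (om i z v a) - om i z v (om i z w a)"

lemma pi_field_curvature:
  "vector_field S V \<Longrightarrow> vector_field S W \<Longrightarrow> pi_field A Z \<Longrightarrow> pi_field A (curvature A D V W Z)"
  unfolding curvature_def
  by (intro pi_field_add pi_field_minus pi_field_nab S.vector_field_lie_bracket)

text \<open>The terms with derivatives of \<open>V\<close> and \<open>W\<close> cancel against the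
  bracket term. First and second derivatives of \<open>Z\<close> enter symmetrically in
  \<open>V\<close> and \<open>W\<close> and cancel in the commutator. What remains involves values
  at \<open>z\<close> only, so the curvature is a tensor.\<close>

lemma loc_curvature:
  assumes i: "i \<in> idx A" and z: "z \<in> cimage S i" and V: "vector_field S V" and W: "vector_field S W"
    and Z: "pi_field A Z"
  shows "loc S i (curvature A D V W Z) z = Om i z (loc S i V z) (loc S i W z) (loc S i Z z)"
proof -
  have iS: "i \<in> idx S" using i by simp
  have U: "open (cimage S i)" by (rule S.open_cimage[OF iS])
  let ?Z = "loc S i Z"
  have sZ: "smooth_on (cimage S i) ?Z" by (rule pi_field_smooth[OF Z i])
  have lin: "linear (om i z w)" for w by (rule linear_om[OF i z])
  have nn: "loc S i (nab D V (nab D W Z)) z =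
      dd (dd ?Z (loc S i W z)) (loc S i V z) z + dd ?Z (dd (loc S i W) (loc S i V z) z) z
      + dd (\<lambda>y. om i y (loc S i W z) (?Z z)) (loc S i V z) z + om i z (dd (loc S i W) (loc S i V z) z) (?Z z)
      + om i z (loc S i W z) (dd ?Z (loc S i V z) z)
      + om i z (loc S i V z) (dd ?Z (loc S i W z) z) + om i z (loc S i V z) (om i z (loc S i W z) (?Z z))"
    if V: "vector_field S V" and W: "vector_field S W" for V W
  proof -
    let ?V = "loc S i V" and ?W = "loc S i W"
    have sW: "smooth_on (cimage S i) ?W" by (rule S.vector_field_smooth[OF W iS])
    have b: "dd (\<lambda>y. om i y (?W y) (?Z y)) v z = dd (\<lambda>y. om i y (?W z) (?Z z)) v z
       + om i z (dd ?W v z) (?Z z) + om i z (?W z) (dd ?Z v z)" for v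
      by (rule dd_bilinear_family[OF U z smooth_om[OF i] linear_om(2)[OF i] linear_om(1)[OF i] sW sZ])
    have bs: "smooth_on (cimage S i) (\<lambda>y. om i y (?W y) (?Z y))"
      by (rule smooth_on_bilinear_family[OF U smooth_om[OF i] linear_om(2)[OF i] linear_om(1)[OF i] sW sZ])
    have "dd (loc S i (nab D W Z)) (?V z) z = dd (\<lambda>y. dd ?Z (?W y) y + om i y (?W y) (?Z y)) (?V z) z"
      by (rule dd_cong[OF U z]) (rule loc_nab[OF i _ W Z])
    also have "\<dots> = dd (\<lambda>y. dd ?Z (?W y) y) (?V z) z + dd (\<lambda>y. om i y (?W y) (?Z y)) (?V z) z"
      by (rule dd_add) (intro smooth_on_differentiable[OF _ U z] bs smooth_on_dd_var sZ sW U)+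
    finally show ?thesis
      using loc_nab[OF i z V pi_field_nab[OF W Z]] loc_nab[OF i z W Z]
      by (simp add: b dd_dd_var[OF U z sZ sW] linear_add[OF lin])
  qed
  have "loc S i (curvature A D V W Z) z = - loc S i (nab D V (nab D W Z)) z + loc S i (nab D W (nab D V Z)) z
      + loc S i (nab D (lie_bracket S V W) Z) z"
    by (simp add: curvature_def loc_def)
  moreover have "loc S i (nab D (lie_bracket S V W) Z) z
      = dd ?Z (dd (loc S i W) (loc S i V z) z) z - dd ?Z (dd (loc S i V) (loc S i W z) z) z
        + om i z (dd (loc S i W) (loc S i V z) z) (?Z z) - om i z (dd (loc S i V) (loc S i W z) z) (?Z z)"
    using loc_nab[OF i z S.vector_field_lie_bracket[OF V W] Z] S.loc_lie_bracket[OF iS z, of V W]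
      linear_diff[OF linear_dd[OF smooth_on_differentiable[OF sZ U z]]] linear_diff[OF linear_om(2)[OF i z]]
    by (simp add: lbr_def)
  ultimately show ?thesis
    using dd_dd_commute[OF U z sZ, of "loc S i V z" "loc S i W z"]
    by (simp add: nn[OF V W] nn[OF W V] Om_def)
qed

text \<open>The flat derivatives of the base components cancel against the base component of the
  bracket, so the torsion is a tensor as well.\<close>

lemma loc_torsion:
  assumes i: "i \<in> idx A" and z: "z \<in> cimage S i" and V: "vector_field S V" and W: "vector_field S W"
  shows "loc S i (torsion A D V W) z = om i z (loc S i V z) (fst (loc S i W z)) - om i z (loc S i W z) (fst (loc S i V z))"
proof -
  have iS: "i \<in> idx S" using i by simp
  have U: "open (cimage S i)" by (rule S.open_cimage[OF iS])
  have fst: "dd (loc S i (\<lambda>u. rho (V u))) v z = fst (dd (loc S i V) v z)" if "vector_field S V" for V v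
    unfolding loc_rho[abs_def]
    by (rule dd_linear[OF bounded_linear_fst smooth_on_differentiable[OF S.vector_field_smooth[OF that iS] U z]])
  have "loc S i (torsion A D V W) z = loc S i (nab D V (\<lambda>u. rho (W u))) z - loc S i (nab D W (\<lambda>u. rho (V u))) z
      - fst (loc S i (lie_bracket S V W) z)"
    by (simp add: torsion_def loc_def rho_def)
  then show ?thesis
    by (simp add: loc_nab[OF i z V pi_field_rho[OF W]] loc_nab[OF i z W pi_field_rho[OF V]] fst V W
        S.loc_lie_bracket[OF iS z] lbr_def loc_rho)
qed

end

subsection \<open>Regular connections\<close>

locale regular_atlas = conn_atlas A D for A :: "('i, 'm, 'e::euclidean_space) atlas" and D +
  assumes regular: "regular_connection A D"
begin

text \<open>\<open>vmap\<close> is \<open>b \<mapsto> D\<^bsub>\<gamma>b\<^esub> \<eta>\<close>, whose invertibility is the regularity of \<open>D\<close>; \<open>N\<close> collects the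
  coefficients of the associated nonlinear connection and \<open>hb\<close> is \<open>\<beta>\<close> in the chart.\<close>

definition vmap :: "'i \<Rightarrow> 'e \<times> 'e \<Rightarrow> 'e \<Rightarrow> 'e" where
  "vmap i z b = b + om i z (0, b) (snd z)"

definition N :: "'i \<Rightarrow> 'e \<times> 'e \<Rightarrow> 'e \<Rightarrow> 'e" where
  "N i z a = inv (vmap i z) (om i z (a, 0) (snd z))"

definition hb :: "'i \<Rightarrow> 'e \<times> 'e \<Rightarrow> 'e \<Rightarrow> 'e \<times> 'e" where
  "hb i z a = (a, - N i z a)"

lemma slit_chartE:
  assumes "i \<in> idx A" "z \<in> cimage S i"
  obtains u where "u \<in> cdom S i" "z = cmap S i u" "u = in_chart S i z" "u \<in> points S" "fst u \<in> cdom A i" "snd u i = snd z"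
proof -
  let ?u = "in_chart S i z"
  have i: "i \<in> idx S" using assms by simp
  have u: "?u \<in> cdom S i" "cmap S i ?u = z"
    using S.in_chart_cdom[OF i assms(2)] S.cmap_in_chart[OF i assms(2)] by auto
  moreover have "snd ?u i = snd z" using u(2) slit_cmap[of i ?u] by (metis snd_conv)
  moreover have "fst ?u \<in> cdom A i" using slit_cdomD[OF u(1)] by blast
  ultimately show thesis using that[of ?u] cdom_points[OF assms(1)] by simp
qed

lemma D_eta:
  assumes i: "i \<in> idx A" and u: "u \<in> cdom S i" and w: "w \<in> tangent_space S u"
  shows "D u w eta i = snd (w i) + om i (cmap S i u) (w i) (snd (cmap S i u))"
proof -
  have iS: "i \<in> idx S" using i by simp
  have z: "cmap S i u \<in> cimage S i" using u by blast
  have "dd (loc S i eta) (w i) (cmap S i u) = dd snd (w i) (cmap S i u)"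
    by (rule dd_cong[OF S.open_cimage[OF iS] z]) (rule loc_eta[OF i])
  also have "\<dots> = snd (w i)"
    by (rule dd_eq) (rule bounded_linear_imp_has_derivative[OF bounded_linear_snd])
  finally show ?thesis using D_chart[OF i u w pi_field_eta] by (simp add: eta_def slit_cmap)
qed

text \<open>Uniqueness in the direct sum, applied to \<open>w = w + 0\<close> and
  \<open>w = 0 + w\<close>.\<close>

lemma hor_vert_zero:
  assumes u: "u \<in> points S" and w: "w \<in> vert_space A u" "w \<in> hor_space A D u"
  shows "w = 0"
proof -
  have t: "w \<in> tangent_space S u" using w by (simp add: vert_space_def)
  have ex: "\<exists>!(a, b). a \<in> vert_space A u \<and> b \<in> hor_space A D u \<and> w = a + b"
    using regular u t unfolding regular_connection_def by blast
  have 0: "0 \<in> vert_space A u" "0 \<in> hor_space A D u"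
  proof -
    show "0 \<in> vert_space A u" using S.tangent_0 by (simp add: vert_space_def rho_def zero_fun_def)
    have "D u 0 eta = D u 0 eta + D u 0 eta"
      using D_dir_linear[OF u S.tangent_0 pi_field_eta S.tangent_0, of 1] by (simp only: scaleR_one add_0_right)
    then have "D u 0 eta = 0" by (metis add_cancel_left_right)
    then show "0 \<in> hor_space A D u" using S.tangent_0 unfolding hor_space_def by blast
  qed
  have "(w, 0) = (0, w)"
    using ex w 0 by (elim ex1E) (metis (mono_tags, lifting) add_0 add.right_neutral case_prodI)
  then show ?thesis by simp
qed

lemma linear_vmap: "i \<in> idx A \<Longrightarrow> z \<in> cimage S i \<Longrightarrow> linear (vmap i z)"
proof (rule linearI)
  fix a b :: 'e and r :: real
  assume iz: "i \<in> idx A" "z \<in> cimage S i"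
  note l = linear_om(2)[OF iz, of "snd z"]
  show "vmap i z (a + b) = vmap i z a + vmap i z b"
    using linear_add[OF l, of "(0, a)" "(0, b)"] by (simp add: vmap_def)
  show "vmap i z (r *\<^sub>R a) = r *\<^sub>R vmap i z a"
    using linear_scale[OF l, of r "(0, a)"] by (simp add: vmap_def scaleR_add_right)
qed

text \<open>A vector \<open>b\<close> killed by \<open>vmap\<close> gives a vertical lift that is
  also horizontal, hence 0; injectivity implies surjectivity in finite dimension.\<close>

lemma vmap_inverse:
  assumes i: "i \<in> idx A" and z: "z \<in> cimage S i"
  shows "inv (vmap i z) (vmap i z a) = a" "vmap i z (inv (vmap i z) a) = a"
proof -
  obtain u where u: "u \<in> cdom S i" "z = cmap S i u" "u \<in> points S" "fst u \<in> cdom A i"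
    using slit_chartE[OF i z] by metis
  have iS: "i \<in> idx S" using i by simp
  have inj: "inj (vmap i z)"
    unfolding linear_injective_0[OF linear_vmap[OF i z]]
  proof (intro allI impI)
    fix b assume b: "vmap i z b = 0"
    let ?w = "tvec S i u (0, b)"
    have t: "?w \<in> tangent_space S u" by (rule S.tvec_tangent[OF iS u(1)])
    have wi: "?w i = (0, b)" by (rule S.tvec_same[OF iS u(1)])
    have "rho ?w = 0"
      by (rule tangent_eqI[OF i u(4) rho_tangent[OF i u(1) t] tangent_0]) (simp add: rho_def wi)
    moreover have "D u ?w eta = 0"
      by (rule tangent_eqI[OF i u(4) D_fibre[OF u(3) t pi_field_eta] tangent_0])
        (use D_eta[OF i u(1) t] b u(2) in \<open>simp add: wi vmap_def\<close>)
    ultimately have "?w = 0" using hor_vert_zero[OF u(3)] t by (simp add: vert_space_def hor_space_def)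
    then show "b = 0" using wi by (simp add: zero_prod_def)
  qed
  then show "inv (vmap i z) (vmap i z a) = a" by (rule inv_f_f)
  have "surj (vmap i z)" using linear_injective_imp_surjective[OF linear_vmap[OF i z] inj] by simp
  then show "vmap i z (inv (vmap i z) a) = a" by (rule surj_f_inv_f)
qed

lemma N_eq: "i \<in> idx A \<Longrightarrow> z \<in> cimage S i \<Longrightarrow> N i z a + om i z (0, N i z a) (snd z) = om i z (a, 0) (snd z)"
  using vmap_inverse(2)[of i z "om i z (a, 0) (snd z)"] by (simp add: N_def vmap_def)

lemma vmap_N: "i \<in> idx A \<Longrightarrow> z \<in> cimage S i \<Longrightarrow> vmap i z (N i z a) = om i z (a, 0) (snd z)"
  by (simp add: N_def vmap_inverse(2))

text \<open>This is \<open>D eta = 0\<close> along a horizontal vector: the flat derivative of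
  \<open>eta\<close> along \<open>hb i z a\<close> is \<open>- N i z a\<close>.\<close>

lemma om_hb_snd:
  assumes "i \<in> idx A" "z \<in> cimage S i"
  shows "om i z (hb i z a) (snd z) = N i z a"
proof -
  have "om i z (hb i z a) (snd z) = om i z ((a, 0) - (0, N i z a)) (snd z)" by (simp add: hb_def)
  also have "\<dots> = om i z (a, 0) (snd z) - om i z (0, N i z a) (snd z)"
    by (rule linear_diff[OF linear_om(2)[OF assms]])
  finally show ?thesis using N_eq[OF assms, of a] by (metis add_diff_cancel_right')
qed

lemma linear_N:
  assumes "i \<in> idx A" "z \<in> cimage S i"
  shows "linear (N i z)"
proof -
  note l = linear_om(2)[OF assms, of "snd z"]
  have li: "linear (inv (vmap i z))"
    by (rule linearI) (metis assms vmap_inverse linear_add[OF linear_vmap[OF assms]],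
        metis assms vmap_inverse linear_scale[OF linear_vmap[OF assms]])
  show ?thesis
  proof (rule linearI)
    fix a b :: 'e and r :: real
    show "N i z (a + b) = N i z a + N i z b"
      using linear_add[OF l, of "(a, 0)" "(b, 0)"] linear_add[OF li] by (simp add: N_def)
    show "N i z (r *\<^sub>R a) = r *\<^sub>R N i z a"
      using linear_scale[OF l, of r "(a, 0)"] linear_scale[OF li] by (simp add: N_def)
  qed
qed

lemma linear_hb: "i \<in> idx A \<Longrightarrow> z \<in> cimage S i \<Longrightarrow> linear (hb i z)"
  by (rule linearI) (simp_all add: hb_def linear_add[OF linear_N] linear_scale[OF linear_N])

lemma smooth_N:
  assumes i: "i \<in> idx A"
  shows "smooth_on (cimage S i) (\<lambda>z. N i z a)"
proof -
  have U: "open (cimage S i)" using S.open_cimage[of i] i by simp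
  have y: "smooth_on (cimage S i) (\<lambda>z. om i z w (snd z))" for w
    by (rule smooth_on_linear_family[OF U smooth_om[OF i] linear_om(1)[OF i] smooth_on_snd[OF U smooth_on_id]])
  have "smooth_on (cimage S i) (\<lambda>z. inv (vmap i z) (om i z (a, 0) (snd z)))"
  proof (rule smooth_on_inverse_family[of _ "vmap i" "\<lambda>z. inv (vmap i z)", OF U linear_vmap[OF i]])
    show "smooth_on (cimage S i) (\<lambda>z. vmap i z a)" for a
      unfolding vmap_def by (intro smooth_on_add smooth_on_const U y)
    show "inv (vmap i z) (vmap i z a) = a" "vmap i z (inv (vmap i z) a) = a" if "z \<in> cimage S i" for z a
      using vmap_inverse[OF i that] by simp_all
  qed (simp, rule y)
  then show ?thesis by (simp add: N_def)
qed

lemma smooth_hb: "i \<in> idx A \<Longrightarrow> smooth_on (cimage S i) (\<lambda>z. hb i z a)"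
  unfolding hb_def
  by (intro smooth_on_Pair smooth_on_const smooth_on_minus smooth_N) (use S.open_cimage[of i] in simp_all)

text \<open>Linearity splits the direction into base and vertical parts, and the invertibility of
  \<open>vmap\<close> solves \<open>D eta = 0\<close> for the vertical part.\<close>

lemma hor_space_iff:
  assumes i: "i \<in> idx A" and u: "u \<in> cdom S i" and w: "w \<in> tangent_space S u"
  shows "w \<in> hor_space A D u \<longleftrightarrow> w i = hb i (cmap S i u) (fst (w i))"
proof -
  let ?z = "cmap S i u"
  have z: "?z \<in> cimage S i" using u by blast
  have fu: "fst u \<in> cdom A i" using slit_cdomD[OF u] by blast
  have "w i = (fst (w i), 0) + (0, snd (w i))" by simp
  then have om: "om i ?z (w i) (snd ?z) = om i ?z (fst (w i), 0) (snd ?z) + om i ?z (0, snd (w i)) (snd ?z)"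
    using linear_add[OF linear_om(2)[OF i z]] by metis
  have "D u w eta = 0 \<longleftrightarrow> D u w eta i = 0"
    using tangent_component_0[OF i fu D_fibre[OF cdom_points[OF i u] w pi_field_eta]] by simp
  also have "\<dots> \<longleftrightarrow> vmap i ?z (snd (w i)) = - om i ?z (fst (w i), 0) (snd ?z)"
    using D_eta[OF i u w] om by (simp add: vmap_def eq_neg_iff_add_eq_0 add_ac)
  also have "\<dots> \<longleftrightarrow> vmap i ?z (snd (w i)) = vmap i ?z (- N i ?z (fst (w i)))"
    by (simp add: linear_neg[OF linear_vmap[OF i z]] vmap_N[OF i z])
  also have "\<dots> \<longleftrightarrow> snd (w i) = - N i ?z (fst (w i))"
    using vmap_inverse(1)[OF i z] by metis
  finally show ?thesis using w by (simp add: hor_space_def hb_def prod_eq_iff)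
qed

text \<open>\<open>bet\<close> inverts \<open>rho\<close> on the horizontal space. By
  \<open>hor_space_iff\<close> a horizontal vector is determined by its base component, which gives
  both injectivity and the explicit preimage.\<close>

lemma bet_point:
  assumes i: "i \<in> idx A" and u: "u \<in> cdom S i" and X: "X u \<in> fibre A u"
  shows "bet A D X u \<in> tangent_space S u" "bet A D X u i = hb i (cmap S i u) (X u i)"
    "bet A D X u \<in> hor_space A D u" "rho (bet A D X u) = X u"
proof -
  have iS: "i \<in> idx S" using i by simp
  have fu: "fst u \<in> cdom A i" using slit_cdomD[OF u] by blast
  let ?w = "tvec S i u (hb i (cmap S i u) (X u i))"
  have t: "?w \<in> tangent_space S u" and wi: "?w i = hb i (cmap S i u) (X u i)"
    by (rule S.tvec_tangent[OF iS u], rule S.tvec_same[OF iS u])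
  have hor: "?w \<in> hor_space A D u"
    unfolding hor_space_iff[OF i u t] wi by (simp add: hb_def)
  have inj: "inj_on rho (hor_space A D u)"
  proof (rule inj_onI)
    fix v w assume v: "v \<in> hor_space A D u" and w: "w \<in> hor_space A D u" and eq: "rho v = rho w"
    have t: "v \<in> tangent_space S u" "w \<in> tangent_space S u" using v w by (auto simp: hor_space_def)
    have "fst (v i) = fst (w i)" using eq by (metis rho_def)
    then have "v i = w i" using hor_space_iff[OF i u t(1)] hor_space_iff[OF i u t(2)] v w by metis
    then show "v = w" using S.tangent_eqI[OF iS u t] by blast
  qed
  have rw: "rho ?w = X u"
    by (rule tangent_eqI[OF i fu rho_tangent[OF i u t] X]) (simp only: rho_def wi, simp add: hb_def)
  have "bet A D X u = ?w"
    unfolding bet_def by (rule the_inv_into_f_eq[OF inj rw hor])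
  then show "bet A D X u \<in> tangent_space S u" "bet A D X u i = hb i (cmap S i u) (X u i)"
    "bet A D X u \<in> hor_space A D u" "rho (bet A D X u) = X u"
    using t wi hor rw by simp_all
qed

lemma loc_bet:
  assumes i: "i \<in> idx A" and z: "z \<in> cimage S i" and X: "pi_field A X"
  shows "loc S i (bet A D X) z = hb i z (loc S i X z)"
proof -
  obtain u where u: "u \<in> cdom S i" "z = cmap S i u" "u \<in> points S"
    using slit_chartE[OF i z] by metis
  show ?thesis using bet_point(2)[of i u X, OF i u(1) pi_field_fibre[OF X u(3)]] by (simp add: u(2) loc_cmap i u(1))
qed

lemma vector_field_bet:
  assumes X: "pi_field A X"
  shows "vector_field S (bet A D X)"
  unfolding vector_field_def
proof (intro conjI ballI)
  show "bet A D X u \<in> tangent_space S u" if "u \<in> points S" for u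
    using points_slit_chart[OF that] bet_point(1)[of _ u X, OF _ _ pi_field_fibre[OF X that]] by blast
  fix i assume iS: "i \<in> idx S"
  then have i: "i \<in> idx A" by simp
  have "smooth_on (cimage S i) (\<lambda>z. hb i z (loc S i X z))"
    by (rule smooth_on_linear_family[OF S.open_cimage[OF iS] smooth_hb[OF i] linear_hb[OF i] pi_field_smooth[OF X i]])
  then have "smooth_on (cimage S i) (loc S i (bet A D X))"
    by (rule smooth_on_cong[OF S.open_cimage[OF iS], rotated]) (simp add: loc_bet[OF i _ X])
  then show "smooth_on (cimage S i) (\<lambda>x. bet A D X (in_chart S i x) i)"
    by (simp add: loc_def[abs_def])
qed

lemma rho_bet: "pi_field A X \<Longrightarrow> u \<in> points S \<Longrightarrow> rho (bet A D X u) = X u"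
  using points_slit_chart bet_point(4) pi_field_fibre by blast

lemma nab_bet_eta:
  assumes "pi_field A X" "u \<in> points S"
  shows "nab D (bet A D X) eta u = 0"
  using points_slit_chart[OF assms(2)] bet_point(3)[of _ u X, OF _ _ pi_field_fibre[OF assms]]
  by (auto simp: hor_space_def nab_def)

end

subsection \<open>Homogeneity and directional derivatives\<close>

text \<open>Dilation of the fibre; homogeneity of degree 0 in \<open>y\<close> is invariance under
  \<open>hs t\<close> for all \<open>t > 0\<close>.\<close>

definition hs :: "real \<Rightarrow> 'a::real_vector \<times> 'a \<Rightarrow> 'a \<times> 'a" where
  "hs t z = (fst z, t *\<^sub>R snd z)"

lemma hs_Pair: "hs t (a, b) = (a, t *\<^sub>R b)"
  by (simp add: hs_def)

lemma bounded_linear_hs: "bounded_linear (hs t :: 'a::euclidean_space \<times> 'a \<Rightarrow> _)"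
  unfolding hs_def[abs_def]
  by (intro bounded_linear_Pair bounded_linear_fst bounded_linear_compose[OF bounded_linear_scaleR_right bounded_linear_snd])

lemma dd_hs:
  fixes f g :: "'a::euclidean_space \<times> 'a \<Rightarrow> 'b::real_normed_vector"
  assumes "open U" "z \<in> U" "f differentiable at (hs t z)" "\<And>y. y \<in> U \<Longrightarrow> f (hs t y) = g y"
  shows "dd f (hs t v) (hs t z) = dd g v z"
proof -
  have "dd (\<lambda>y. f (hs t y)) v z = dd f (dd (hs t) v z) (hs t z)"
    by (rule dd_compose(2)[OF bounded_linear_imp_differentiable[OF bounded_linear_hs] assms(3)])
  moreover have "dd (hs t) v z = hs t v"
    by (rule dd_eq[OF bounded_linear_imp_has_derivative[OF bounded_linear_hs]])
  moreover have "dd (\<lambda>y. f (hs t y)) v z = dd g v z" by (rule dd_cong[OF assms(1,2)]) (rule assms(4))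
  ultimately show ?thesis by simp
qed

text \<open>Agreement on a segment is enough once both functions are differentiable. This serves
  where an identity is available only along one fibre or one ray.\<close>

lemma dd_line:
  fixes f g :: "'a::euclidean_space \<Rightarrow> 'b::real_normed_vector"
  assumes "f differentiable at z" "g differentiable at z" "e > 0"
    "\<And>s. \<bar>s\<bar> < e \<Longrightarrow> f (z + s *\<^sub>R w) = g (z + s *\<^sub>R w)"
  shows "dd f w z = dd g w z"
proof -
  have l: "((\<lambda>s::real. z + s *\<^sub>R w) has_derivative (\<lambda>s. s *\<^sub>R w)) (at 0)"
    by (auto intro!: derivative_eq_intros)
  have "dd (\<lambda>s. h (z + s *\<^sub>R w)) 1 0 = dd h w z" if "h differentiable at z" for h :: "'a \<Rightarrow> 'b"
    using dd_compose(2)[of "\<lambda>s. z + s *\<^sub>R w" 0 h 1] that l dd_eq[OF l, of 1] differentiable_def by fastforce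
  moreover have "dd (\<lambda>s. f (z + s *\<^sub>R w)) 1 0 = dd (\<lambda>s. g (z + s *\<^sub>R w)) 1 (0 :: real)"
    by (rule dd_cong[of "ball 0 e"]) (use assms(3,4) in auto)
  ultimately show ?thesis using assms(1,2) by metis
qed

text \<open>Euler's relation in degree 0. The segment through \<open>z\<close> in direction
  \<open>(0, snd z)\<close> stays on the ray for parameters of modulus below 1, the bound passed to
  \<open>dd_line\<close>.\<close>

lemma dd_radial:
  fixes f :: "'a::euclidean_space \<times> 'a \<Rightarrow> 'b::real_normed_vector"
  assumes "f differentiable at z" "\<And>t. t > 0 \<Longrightarrow> f (hs t z) = f z"
  shows "dd f (0, snd z) z = 0"
proof -
  have "z + s *\<^sub>R (0, snd z) = hs (1 + s) z" for s by (cases z) (simp add: hs_def algebra_simps)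
  then have "dd f (0, snd z) z = dd (\<lambda>_. f z) (0, snd z) z"
    by (intro dd_line[of f z _ 1]) (use assms in auto)
  then show ?thesis by simp
qed

subsection \<open>The Finsler metric in a chart\<close>

locale finsler_atlas = cutoff_atlas A for A :: "('i, 'm, 'e::euclidean_space) atlas" +
  fixes L :: "'m \<times> ('i \<Rightarrow> 'e) \<Rightarrow> real"
  assumes finsler: "finsler_structure A L"
begin

definition En :: "'i \<Rightarrow> 'e \<times> 'e \<Rightarrow> real" where
  "En i z = (L (in_chart S i z))\<^sup>2"

definition G :: "'i \<Rightarrow> 'e \<times> 'e \<Rightarrow> 'e \<Rightarrow> 'e \<Rightarrow> real" where
  "G i z a b = 1/2 * dd (dd (En i) (0, a)) (0, b) z"

lemma smooth_En: "i \<in> idx A \<Longrightarrow> smooth_on (cimage S i) (En i)"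
proof -
  assume i: "i \<in> idx A"
  have "smooth_on (cimage S i) (\<lambda>z. L (in_chart S i z))"
    using finsler i S.smooth_fun_chart[of L i] by (simp add: finsler_structure_def)
  then show ?thesis
    unfolding En_def[abs_def] power2_eq_square using S.open_cimage[of i] i by (auto intro: smooth_on_mult)
qed

lemma open_slit: "i \<in> idx A \<Longrightarrow> open (cimage S i)"
  using S.open_cimage[of i] by simp

lemma smooth_G: "i \<in> idx A \<Longrightarrow> smooth_on (cimage S i) (\<lambda>z. G i z a b)"
  unfolding G_def by (intro smooth_on_mult smooth_on_const smooth_on_dd smooth_En open_slit)

text \<open>Within a fibre the change of natural charts is linear, so the vertical vector
  \<open>(0, x k)\<close> becomes \<open>(0, x i)\<close> at every point of that fibre, and no
  second derivative of the transition map appears. Off the fibre this constancy may be lost; the two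
  first derivatives are therefore compared only along a vertical segment, by
  \<open>dd_line\<close>.\<close>

lemma fmetric_chart:
  assumes i: "i \<in> idx A" and u: "u \<in> cdom S i" and x: "x \<in> fibre A u" and y: "y \<in> fibre A u"
  shows "fmetric A L u x y = G i (cmap S i u) (x i) (y i)"
proof -
  define k where "k = chart_at S u"
  have "k \<in> idx S \<and> u \<in> cdom S k" unfolding k_def by (rule S.chart_at_mem[of i]) (use i u in auto)
  then have k: "k \<in> idx A" "u \<in> cdom S k" by auto
  have fu: "fst u \<in> cdom A i" "fst u \<in> cdom A k" using slit_cdomD u k by auto
  let ?z = "cmap S k u" and ?O = "overlap S k i" and ?f = "transit S k i"
  have O: "open ?O" "?z \<in> ?O" using S.open_overlap[of k i] i k u S.overlapI by auto
  have tr: "?f differentiable at y" if "y \<in> ?O" for y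
    using S.transit_differentiable[of k i y] i k that by simp
  have fO: "?f y \<in> cimage S i" if "y \<in> ?O" for y
    using S.transit_overlap(1)[of k i y] S.overlap_subset[of i k] i k that by auto
  have fz: "?f ?z = cmap S i u" using S.transit_cmap[of k u i] k by simp
  have Ed: "En j differentiable at y" "dd (En j) v differentiable at y" if "j \<in> idx A" "y \<in> cimage S j" for j y v
    by (rule smooth_on_differentiable[OF smooth_En[OF that(1)] open_slit[OF that(1)] that(2)],
        rule smooth_on_differentiable[OF smooth_on_dd[OF smooth_En[OF that(1)]] open_slit[OF that(1)] that(2)])
  have "En k y = En i (?f y)" if "y \<in> ?O" for y
    using S.transit_overlap(2)[of k i y] that i k by (simp add: En_def)
  then have dE: "dd (En k) v y = dd (En i) (dd ?f v y) (?f y)" if "y \<in> ?O" for v y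
    using dd_cong[OF O(1) that, of "En k" "\<lambda>y. En i (?f y)" v] dd_compose(2)[OF tr[OF that] Ed(1)[OF i fO[OF that]], of v] by simp
  have vert: "dd ?f (0, x k) (cmap S k u') = (0, x i)"
    if u': "u' \<in> cdom S k" "u' \<in> cdom S i" "fst u' = fst u" "x \<in> fibre A u" for u' x
  proof -
    have "vlift x \<in> tangent_space S u'" using vlift_tangent[OF i u'(2)] u'(3,4) by simp
    then have "vlift x i = dtr S k i u' (vlift x k)"
      by (intro S.tangentD) (use i k u' in auto)
    then show ?thesis by (simp add: vlift_def dtr_def)
  qed
  obtain e where e: "e > 0" "ball ?z e \<subseteq> ?O" using O openE by blast
  \<comment> \<open>Keeps the segment in the ball; the added 1 covers
    \<open>y k = 0\<close>.\<close>
  define e' where "e' = e / (norm (y k) + 1)"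
  have e': "e' > 0" using e by (simp add: e'_def add_nonneg_pos)
  have "fmetric A L u x y = 1/2 * dd (dd (En k) (0, x k)) (0, y k) ?z"
    by (simp add: fmetric_def Let_def k_def dd_def[abs_def] En_def[abs_def] vlift_def)
  also have "dd (dd (En k) (0, x k)) (0, y k) ?z = dd (\<lambda>y. dd (En i) (0, x i) (?f y)) (0, y k) ?z"
  proof (rule dd_line[OF _ _ e'])
    show "dd (En k) (0, x k) differentiable at ?z" using Ed(2)[OF k(1)] k(2) by blast
    show "(\<lambda>y. dd (En i) (0, x i) (?f y)) differentiable at ?z"
      by (rule dd_compose(1)[OF tr[OF O(2)] Ed(2)[OF i fO[OF O(2)]]])
    fix s :: real assume s: "\<bar>s\<bar> < e'"
    let ?y = "?z + s *\<^sub>R (0, y k)"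
    have "\<bar>s\<bar> * norm (y k) \<le> \<bar>s\<bar> * (norm (y k) + 1)" by (simp add: mult_left_mono)
    also have "\<dots> < e" using s by (simp add: e'_def pos_less_divide_eq add_nonneg_pos)
    finally have "?y \<in> ball ?z e" by (simp add: dist_norm norm_Pair)
    then have yO: "?y \<in> ?O" using e by blast
    let ?u = "in_chart S k ?y"
    have u': "?u \<in> cdom S k" "?u \<in> cdom S i" "cmap S k ?u = ?y"
      using yO S.overlap_iff[of k ?y i] k S.in_chart_cdom[of k ?y] S.cmap_in_chart[of k ?y] by auto
    \<comment> \<open>A vertical displacement does not move the base point, so \<open>vert\<close>
      applies at the displaced point too.\<close>
    have "cmap A k (fst ?u) = cmap A k (fst u)"
      using u'(3) by (simp add: slit_cmap prod_eq_iff)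
    then have "fst ?u = fst u" using inj_chart[OF k(1)] slit_cdomD[OF u'(1)] fu by (auto simp: inj_on_def)
    then show "dd (En k) (0, x k) ?y = dd (En i) (0, x i) (?f ?y)"
      using dE[OF yO] vert[OF u'(1,2) _ x] u'(3) by simp
  qed
  also have "\<dots> = dd (dd (En i) (0, x i)) (0, y i) (cmap S i u)"
    using dd_compose(2)[OF tr[OF O(2)] Ed(2)[OF i fO[OF O(2)]]] vert[OF k(2) u refl y] fz by simp
  finally show ?thesis by (simp add: G_def)
qed

lemma hs_cimage: "i \<in> idx A \<Longrightarrow> z \<in> cimage S i \<Longrightarrow> t > 0 \<Longrightarrow> hs t z \<in> cimage S i"
  unfolding slit_cimage by (cases z) (auto simp: hs_def)

lemma En_hs:
  assumes i: "i \<in> idx A" and z: "z \<in> cimage S i" and t: "t > 0"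
  shows "En i (hs t z) = t\<^sup>2 * En i z"
proof -
  obtain x y where xy: "z = (x, y)" by (cases z)
  then have x: "x \<in> cimage A i" "y \<noteq> 0" using z slit_cimage[OF i] by auto
  let ?p = "in_chart A i x"
  have p: "?p \<in> cdom A i" by (rule in_chart_cdom[OF i x(1)])
  have "(?p, tvec A i ?p y) \<in> points (tangent_bundle A)"
    using i p tvec_tangent[OF i p] by (auto simp: points_def tangent_bundle_def)
  moreover have "tvec A i ?p (t *\<^sub>R y) = t *\<^sub>R tvec A i ?p y"
    by (rule tangent_eqI[OF i p]) (use tvec_tangent[OF i p] i p in \<open>auto intro: tangent_scale\<close>)
  ultimately have "L (?p, tvec A i ?p (t *\<^sub>R y)) = t * L (?p, tvec A i ?p y)"
    using finsler t by (simp add: finsler_structure_def)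
  then show ?thesis
    using x t by (simp add: xy hs_Pair En_def slit_in_chart[OF i] power_mult_distrib)
qed

text \<open>The energy has degree 2 in the fibre coordinate, and each vertical derivative lowers the
  degree by one.\<close>

lemma G_hs:
  assumes i: "i \<in> idx A" and z: "z \<in> cimage S i" and t: "t > 0"
  shows "G i (hs t z) a b = G i z a b"
proof -
  note U = open_slit[OF i]
  have 1: "dd (En i) (0, a) (hs t y) = t * dd (En i) (0, a) y" if y: "y \<in> cimage S i" for y
  proof -
    have d: "En i differentiable at (hs t y)" "En i differentiable at y"
      using smooth_on_differentiable[OF smooth_En[OF i] U] hs_cimage[OF i y t] y by auto
    have "dd (En i) (hs t (0, a)) (hs t y) = dd (\<lambda>y. t\<^sup>2 * En i y) (0, a) y"
      by (rule dd_hs[OF U y d(1)]) (rule En_hs[OF i _ t])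
    also have "\<dots> = t\<^sup>2 * dd (En i) (0, a) y"
      by (rule dd_linear[OF bounded_linear_mult_right d(2)])
    finally have "t * dd (En i) (0, a) (hs t y) = t\<^sup>2 * dd (En i) (0, a) y"
      using linear_scale[OF linear_dd[OF d(1)], of t "(0, a)"] by (simp add: hs_Pair)
    then show ?thesis using t by (simp add: power2_eq_square)
  qed
  have d: "dd (En i) (0, a) differentiable at (hs t z)" "dd (En i) (0, a) differentiable at z"
    using smooth_on_differentiable[OF smooth_on_dd[OF smooth_En[OF i]] U] hs_cimage[OF i z t] z by auto
  have "dd (dd (En i) (0, a)) (hs t (0, b)) (hs t z) = dd (\<lambda>y. t * dd (En i) (0, a) y) (0, b) z"
    by (rule dd_hs[OF U z d(1)]) (rule 1)
  also have "\<dots> = t * dd (dd (En i) (0, a)) (0, b) z"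
    by (rule dd_linear[OF bounded_linear_mult_right d(2)])
  finally have "dd (dd (En i) (0, a)) (0, t *\<^sub>R b) (hs t z) = t * dd (dd (En i) (0, a)) (0, b) z"
    by (simp only: hs_Pair)
  moreover have "dd (dd (En i) (0, a)) (0, t *\<^sub>R b) (hs t z) = t * dd (dd (En i) (0, a)) (0, b) (hs t z)"
    using linear_scale[OF linear_dd[OF d(1)], of t "(0, b)"] by simp
  ultimately have "dd (dd (En i) (0, a)) (0, b) (hs t z) = dd (dd (En i) (0, a)) (0, b) z"
    using t by (metis mult_cancel_left less_irrefl)
  then show ?thesis by (simp add: G_def)
qed

lemma G_sym: "i \<in> idx A \<Longrightarrow> z \<in> cimage S i \<Longrightarrow> G i z a b = G i z b a"
  using dd_dd_commute[OF open_slit _ smooth_En] by (simp add: G_def)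

lemma linear_G:
  assumes "i \<in> idx A" "z \<in> cimage S i"
  shows "linear (G i z a)" "linear (\<lambda>a. G i z a b)"
proof -
  have l: "linear (G i z a)" for a
  proof -
    have "dd (En i) (0, a) differentiable at z"
      using smooth_on_differentiable[OF smooth_on_dd[OF smooth_En[OF assms(1)]] open_slit[OF assms(1)]] assms by blast
    note l = linear_dd[OF this]
    show ?thesis
    proof (rule linearI)
      fix b c :: 'e and r :: real
      show "G i z a (b + c) = G i z a b + G i z a c"
        using linear_add[OF l, of "(0, b)" "(0, c)"] by (simp add: G_def)
      show "G i z a (r *\<^sub>R b) = r *\<^sub>R G i z a b"
        using linear_scale[OF l, of r "(0, b)"] by (simp add: G_def)
    qed
  qed
  show "linear (G i z a)" by (rule l)
  have "(\<lambda>a. G i z a b) = G i z b" using G_sym[OF assms] by blast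
  then show "linear (\<lambda>a. G i z a b)" using l by simp
qed

lemma G_pos:
  assumes i: "i \<in> idx A" and z: "z \<in> cimage S i" and a: "a \<noteq> 0"
  shows "G i z a a > 0"
proof -
  have iS: "i \<in> idx S" using i by simp
  let ?u = "in_chart S i z"
  have u: "?u \<in> cdom S i" "cmap S i ?u = z" using S.in_chart_cdom[OF iS z] S.cmap_in_chart[OF iS z] by auto
  have fu: "fst ?u \<in> cdom A i" using slit_cdomD[OF u(1)] by blast
  let ?x = "tvec A i (fst ?u) a"
  have x: "?x \<in> fibre A ?u" "?x \<noteq> 0" "?x i = a" using tvec_tangent[OF i fu] tvec_eq_0_iff[OF i fu] a i fu by auto
  then have "fmetric A L ?u ?x ?x > 0"
    using finsler cdom_points[OF i u(1)] unfolding finsler_structure_def by blast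
  then show ?thesis using fmetric_chart[OF i u(1) x(1) x(1)] x(3) u(2) by simp
qed

lemma G_nondegenerate:
  assumes "i \<in> idx A" "z \<in> cimage S i" "\<And>b. G i z a b = 0"
  shows "a = 0"
  using G_pos[OF assms(1,2), of a] assms(3)[of a] by auto

text \<open>Classically, the Cartan tensor vanishes on \<open>y\<close>. The second part is Euler's
  relation for \<open>G\<close>. The first follows from it, since third vertical derivatives of the
  energy are symmetric and the slot occupied by \<open>y\<close> can be made the direction of
  differentiation.\<close>

lemma dd_G_snd:
  assumes i: "i \<in> idx A" and z: "z \<in> cimage S i"
  shows "dd (\<lambda>y. G i y (snd z) b) (0, c) z = 0" "dd (\<lambda>y. G i y a b) (0, snd z) z = 0"
proof -
  note U = open_slit[OF i]
  have 0: "dd (\<lambda>y. G i y a b) (0, snd z) z = 0" for a b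
    by (rule dd_radial[OF smooth_on_differentiable[OF smooth_G[OF i] U z]]) (rule G_hs[OF i z])
  show "dd (\<lambda>y. G i y a b) (0, snd z) z = 0" by (rule 0)
  note sm = smooth_on_dd[OF smooth_En[OF i]]
  have G: "dd (\<lambda>y. G i y a b) v z = 1/2 * dd (dd (dd (En i) (0, a)) (0, b)) v z" for a b v
    unfolding G_def
    by (rule dd_linear[OF bounded_linear_mult_right smooth_on_differentiable[OF smooth_on_dd[OF sm] U z]])
  have "dd (dd (dd (En i) (0, snd z)) (0, b)) (0, c) z = dd (dd (dd (En i) (0, b)) (0, snd z)) (0, c) z"
    by (rule dd_cong[OF U z]) (rule dd_dd_commute[OF U _ smooth_En[OF i]])
  also have "\<dots> = dd (dd (dd (En i) (0, b)) (0, c)) (0, snd z) z"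
    by (rule dd_dd_commute[OF U z sm])
  finally show "dd (\<lambda>y. G i y (snd z) b) (0, c) z = 0"
    using 0[of b c] by (simp add: G)
qed

lemma dd_G_sym: "i \<in> idx A \<Longrightarrow> z \<in> cimage S i \<Longrightarrow> dd (\<lambda>y. G i y a b) v z = dd (\<lambda>y. G i y b a) v z"
  by (rule dd_cong[OF open_slit], assumption, assumption, rule G_sym)

lemma loc_fmetric:
  assumes "i \<in> idx A" "z \<in> cimage S i" "pi_field A X" "pi_field A Y"
  shows "fmetric A L (in_chart S i z) (X (in_chart S i z)) (Y (in_chart S i z)) = G i z (loc S i X z) (loc S i Y z)"
proof -
  let ?u = "in_chart S i z"
  have iS: "i \<in> idx S" using assms by simp
  have u: "?u \<in> cdom S i" "cmap S i ?u = z" using S.in_chart_cdom[OF iS assms(2)] S.cmap_in_chart[OF iS assms(2)] by auto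
  have p: "?u \<in> points S" by (rule cdom_points[OF assms(1) u(1)])
  show ?thesis
    using fmetric_chart[OF assms(1) u(1) pi_field_fibre[OF assms(3) p] pi_field_fibre[OF assms(4) p]] u(2)
    by (simp add: loc_def)
qed

lemma smooth_fun_fmetric:
  assumes "pi_field A X" "pi_field A Y"
  shows "smooth_fun S (\<lambda>u. fmetric A L u (X u) (Y u))"
  unfolding smooth_fun_def
proof
  fix i assume "i \<in> idx S"
  then have i: "i \<in> idx A" by simp
  have "smooth_on (cimage S i) (\<lambda>z. G i z (loc S i X z) (loc S i Y z))"
    by (rule smooth_on_bilinear_family[OF open_slit[OF i] smooth_G[OF i] linear_G(2)[OF i] linear_G(1)[OF i]
        pi_field_smooth[OF assms(1) i] pi_field_smooth[OF assms(2) i]])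
  then show "smooth_on (cimage S i) (\<lambda>z. fmetric A L (in_chart S i z) (X (in_chart S i z)) (Y (in_chart S i z)))"
    by (rule smooth_on_cong[OF open_slit[OF i], rotated]) (rule loc_fmetric[OF i _ assms, symmetric])
qed

end

subsection \<open>Cartan connections\<close>

text \<open>Applied to the difference of two solutions \<open>(\<Gamma>, N)\<close> of the Cartan equations at the same point.
  The Koszul formula is used with \<open>a = c = y\<close>, then with one argument \<open>y\<close>, then in general.\<close>

lemma koszul_vanishing:
  fixes g :: "'a::real_vector \<Rightarrow> 'a \<Rightarrow> real"
  assumes add: "\<And>a b c. g (a + b) c = g a c + g b c"
    and sym: "\<And>a b. g a b = g b a" and nondeg: "\<And>a. (\<And>b. g a b = 0) \<Longrightarrow> a = 0"
    and \<Delta>: "\<And>a c. \<Delta> a c = \<Delta> c a" and n: "\<And>a. \<Delta> a y = n a"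
    and \<mu>: "\<And>b c d. \<mu> b c d = \<mu> b d c" "\<And>b d. \<mu> b y d = 0" "\<And>c d. \<mu> 0 c d = 0"
    and eq: "\<And>a c d. g (\<Delta> a c) d + g c (\<Delta> a d) = \<mu> (n a) c d"
  shows "n a = 0 \<and> \<Delta> a c = 0"
proof -
  \<comment> \<open>The equations for \<open>(a, c, d)\<close> and \<open>(c, a, d)\<close> minus
    the one for \<open>(d, a, c)\<close>; the symmetry of \<Delta> cancels the other terms on the
    left.\<close>
  have koszul: "2 * g (\<Delta> a c) d = \<mu> (n a) c d + \<mu> (n c) a d - \<mu> (n d) a c" for a c d
    using eq[of a c d] eq[of c a d] eq[of d a c] \<Delta> sym by (smt (verit))
  have "n y = 0"
    by (rule nondeg) (use koszul[of y y] \<mu> n in \<open>metis add_0 diff_zero mult_eq_0_iff zero_neq_numeral\<close>)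
  \<comment> \<open>\<open>\<mu> (n y)\<close> is now 0, and the other two terms of the formula have
    \<open>y\<close> as an argument.\<close>
  then have "2 * g (n c) d = 0" for c d
    using koszul[of y c d] \<mu> n \<Delta> by (metis add_0 diff_zero)
  then have n0: "n c = 0" for c by (intro nondeg) simp
  have "2 * g (\<Delta> a c) d = 0" for d using koszul[of a c d] n0 \<mu>(3) by simp
  then show ?thesis using n0 nondeg[of "\<Delta> a c"] by simp
qed

locale cartan_atlas = regular_atlas A D + finsler_atlas A L
  for A :: "('i, 'm, 'e::euclidean_space) atlas" and D and L +
  assumes cartan: "cartan_connection A L D"
begin

text \<open>Metricity for fields with locally constant components, whose covariant derivatives at
  \<open>z\<close> are values of \<open>om\<close>.\<close>

lemma dd_G:
  assumes i: "i \<in> idx A" and z: "z \<in> cimage S i"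
  shows "dd (\<lambda>y. G i y a b) w z = G i z (om i z w a) b + G i z a (om i z w b)"
proof -
  have iS: "i \<in> idx S" using i by simp
  obtain U where U: "open U" "z \<in> U" "U \<subseteq> cimage S i"
    "\<And>a. \<exists>X. pi_field A X \<and> (\<forall>y\<in>U. loc S i X y = a)"
    using local_frame[OF i z] by metis
  obtain X Y where X: "pi_field A X" "\<And>y. y \<in> U \<Longrightarrow> loc S i X y = a"
    and Y: "pi_field A Y" "\<And>y. y \<in> U \<Longrightarrow> loc S i Y y = b" using U(4) by metis
  obtain u where u: "u \<in> cdom S i" "z = cmap S i u" "u = in_chart S i z" "u \<in> points S" "fst u \<in> cdom A i"
    using slit_chartE[OF i z] by metis
  let ?w = "tvec S i u w"
  have w: "?w \<in> tangent_space S u" "?w i = w" by (rule S.tvec_tangent[OF iS u(1)], rule S.tvec_same[OF iS u(1)])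
  have D: "D u ?w X i = om i z w a" if X: "pi_field A X" "\<And>y. y \<in> U \<Longrightarrow> loc S i X y = a" for X a
  proof -
    have "dd (loc S i X) w z = dd (\<lambda>_. a) w z" by (rule dd_cong[OF U(1,2)]) (rule X(2))
    then show ?thesis using D_chart[OF i u(1) w(1) X(1)] w(2) u(2) X(2)[OF U(2)] loc_cmap[OF i u(1), of X] by simp
  qed
  let ?f = "\<lambda>v. fmetric A L v (X v) (Y v)"
  have eq: "?f (in_chart S i y) = G i y a b" if "y \<in> U" for y
  proof -
    have "y \<in> cimage S i" using that U(3) by blast
    then show ?thesis using loc_fmetric[OF i _ X(1) Y(1), of y] X(2)[OF that] Y(2)[OF that] by simp
  qed
  have "dir_deriv S ?f u ?w = dd (\<lambda>y. ?f (in_chart S i y)) w z"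
    using S.dir_deriv_chart[OF iS u(1) _ w(1), of ?f] w(2) u(2) z
      smooth_on_differentiable[OF S.smooth_fun_chart[OF smooth_fun_fmetric[OF X(1) Y(1)] iS] open_slit[OF i] z] by simp
  also have "\<dots> = dd (\<lambda>y. G i y a b) w z" by (rule dd_cong[OF U(1,2)]) (rule eq)
  finally have "dd (\<lambda>y. G i y a b) w z = fmetric A L u (D u ?w X) (Y u) + fmetric A L u (X u) (D u ?w Y)"
    using cartan w(1) X(1) Y(1) u(4) by (simp add: cartan_connection_def metrical_def)
  moreover have "fmetric A L u (D u ?w X) (Y u) = G i z (om i z w a) b"
    using fmetric_chart[OF i u(1) D_fibre[OF u(4) w(1) X(1)] pi_field_fibre[OF Y(1) u(4)]]
      D[OF X] Y(2)[OF U(2)] u(2) loc_cmap[OF i u(1), of Y] by simp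
  moreover have "fmetric A L u (X u) (D u ?w Y) = G i z a (om i z w b)"
    using fmetric_chart[OF i u(1) pi_field_fibre[OF X(1) u(4)] D_fibre[OF u(4) w(1) Y(1)]]
      D[OF Y] X(2)[OF U(2)] u(2) loc_cmap[OF i u(1), of X] by simp
  ultimately show ?thesis by simp
qed

text \<open>By \<open>loc_torsion\<close>, Q = 0 is the symmetry of the horizontal Christoffel
  symbols.\<close>

lemma om_hb_sym:
  assumes i: "i \<in> idx A" and z: "z \<in> cimage S i"
  shows "om i z (hb i z a) c = om i z (hb i z c) a"
proof -
  obtain X where X: "pi_field A X" "loc S i X z = a" using exists_loc[OF i z] by blast
  obtain Y where Y: "pi_field A Y" "loc S i Y z = c" using exists_loc[OF i z] by blast
  obtain u where u: "u = in_chart S i z" "u \<in> points S" using slit_chartE[OF i z] by metis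
  have "htorsion A D X Y u = 0"
    using cartan X(1) Y(1) u(2) by (simp add: cartan_connection_def)
  then have "loc S i (torsion A D (bet A D X) (bet A D Y)) z = 0"
    by (simp add: loc_def htorsion_def u(1))
  then show ?thesis
    using loc_torsion[OF i z vector_field_bet[OF X(1)] vector_field_bet[OF Y(1)]]
    by (simp add: loc_bet[OF i z] X Y hb_def[of _ _ "_"])
qed

text \<open>The symmetry axiom for T makes the two terms of \<open>dd_G\<close> in a vertical
  direction equal, so the vertical part of \<open>om\<close> is the Cartan tensor and vanishes on
  \<open>y\<close> by \<open>dd_G_snd\<close>. In particular \<open>vmap\<close> is the identity:
  the derivative of \<open>eta\<close> along \<gamma>b is b.\<close>

lemma om_vert_snd:
  assumes i: "i \<in> idx A" and z: "z \<in> cimage S i"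
  shows "2 * G i z (om i z (0, b) c) d = dd (\<lambda>y. G i y c d) (0, b) z" "om i z (0, b) (snd z) = 0"
    "om i z (0, snd z) c = 0"
proof -
  obtain u where u: "u = in_chart S i z" "u \<in> points S" "u \<in> cdom S i" "z = cmap S i u" using slit_chartE[OF i z] by metis
  have T: "loc S i (mtorsion A D X Y) z = om i z (0, loc S i X z) (loc S i Y z)"
    if X: "pi_field A X" and Y: "pi_field A Y" for X Y
    using loc_torsion[OF i z vector_field_gam[OF X] vector_field_bet[OF Y]] linear_0[OF linear_om(1)[OF i z]]
    by (simp add: mtorsion_def loc_bet[OF i z Y] loc_gam hb_def)
  have sym: "G i z (om i z (0, b) c) d = G i z (om i z (0, b) d) c" for b c d
  proof -
    obtain X where X: "pi_field A X" "loc S i X z = b" using exists_loc[OF i z] by blast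
    obtain Y where Y: "pi_field A Y" "loc S i Y z = c" using exists_loc[OF i z] by blast
    obtain Z where Z: "pi_field A Z" "loc S i Z z = d" using exists_loc[OF i z] by blast
    have pf: "pi_field A (mtorsion A D V W)" if "pi_field A V" "pi_field A W" for V W
      unfolding mtorsion_def torsion_def
      by (intro pi_field_diff pi_field_nab pi_field_rho vector_field_gam vector_field_bet S.vector_field_lie_bracket that)
    have "fmetric A L u (mtorsion A D X Y u) (Z u) = fmetric A L u (mtorsion A D X Z u) (Y u)"
      using cartan X(1) Y(1) Z(1) u(2) by (simp add: cartan_connection_def)
    then show ?thesis
      using loc_fmetric[OF i z pf[OF X(1) Y(1)] Z(1)] loc_fmetric[OF i z pf[OF X(1) Z(1)] Y(1)]
      by (simp add: u(1)[symmetric] T[OF X(1)] X Y Z)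
  qed
  show 1: "2 * G i z (om i z (0, b) c) d = dd (\<lambda>y. G i y c d) (0, b) z" for b c d
    using dd_G[OF i z, of c d "(0, b)"] sym[of b c d] G_sym[OF i z] by simp
  show "om i z (0, b) (snd z) = 0"
    by (rule G_nondegenerate[OF i z]) (use 1[of b "snd z"] dd_G_snd(1)[OF i z] in simp)
  show "om i z (0, snd z) c = 0"
    by (rule G_nondegenerate[OF i z]) (use 1[of "snd z" c] dd_G_snd(2)[OF i z] in simp)
qed

text \<open>Pulled back by \<open>hs t\<close>, the coefficients at \<open>hs t z\<close> satisfy
  the Cartan equations at \<open>z\<close>, because \<open>G\<close> and its derivatives are carried
  over by \<open>G_hs\<close> and \<open>dd_hs\<close>. Uniqueness, in the form of
  \<open>koszul_vanishing\<close>, is applied to the difference from the coefficients at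
  \<open>z\<close>.\<close>

lemma om_hs:
  assumes i: "i \<in> idx A" and z: "z \<in> cimage S i" and t: "t > 0"
  shows "om i (hs t z) (hs t w) c = om i z w c" "hb i (hs t z) a = hs t (hb i z a)"
proof -
  let ?z = "hs t z"
  note U = open_slit[OF i] and z' = hs_cimage[OF i z t]
  have dG: "dd (\<lambda>y. G i y c d) (hs t v) ?z = dd (\<lambda>y. G i y c d) v z" for c d v
    by (rule dd_hs[OF U z smooth_on_differentiable[OF smooth_G[OF i] U z']]) (rule G_hs[OF i _ t])
  note lG = linear_G[OF i z]
  \<comment> \<open>The factor \<open>1 / t\<close> undoes the expected degree 1 of \<open>N\<close>
    in the fibre coordinate.\<close>
  define n where "n = (\<lambda>a. (1 / t) *\<^sub>R N i ?z a - N i z a)"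
  define \<Delta> where "\<Delta> = (\<lambda>a c. om i ?z (hb i ?z a) c - om i z (hb i z a) c)"
  \<comment> \<open>Pulled back to \<open>z\<close>, the two horizontal lifts of \<open>a\<close>
    differ by \<open>(0, n a)\<close>. The difference of the two metric equations is hence a
    vertical derivative of \<open>G\<close>.\<close>
  define \<mu> where "\<mu> = (\<lambda>b c d. - dd (\<lambda>y. G i y c d) (0, b) z)"
  have ld: "linear (\<lambda>v. dd (\<lambda>y. G i y c d) v z)" for c d
    by (rule linear_dd[OF smooth_on_differentiable[OF smooth_G[OF i] U z]])
  have vanish: "n a = 0 \<and> \<Delta> a c = 0" for a c
  proof (rule koszul_vanishing[of "G i z" \<Delta> "snd z" n \<mu>])
    show "G i z (a + b) c = G i z a c + G i z b c" for a b c by (rule linear_add[OF lG(2)])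
    show "G i z a b = G i z b a" for a b by (rule G_sym[OF i z])
    show "a = 0" if "\<And>b. G i z a b = 0" for a by (rule G_nondegenerate[OF i z that])
    show "\<Delta> a c = \<Delta> c a" for a c
      unfolding \<Delta>_def using om_hb_sym[OF i z] om_hb_sym[OF i z'] by simp
    have "om i ?z (hb i ?z a) (t *\<^sub>R snd z) = N i ?z a" for a
      using om_hb_snd[OF i z', of a] by (simp add: hs_def)
    then have tom: "t *\<^sub>R om i ?z (hb i ?z a) (snd z) = N i ?z a" for a
      using linear_scale[OF linear_om(1)[OF i z'], of "hb i ?z a" t "snd z"] by metis
    have "om i ?z (hb i ?z a) (snd z) = (1 / t) *\<^sub>R N i ?z a" for a
      unfolding tom[symmetric] using t by simp
    then show "\<Delta> a (snd z) = n a" for a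
      using om_hb_snd[OF i z, of a] by (simp add: \<Delta>_def n_def)
    show "\<mu> b c d = \<mu> b d c" for b c d using dd_G_sym[OF i z] by (simp add: \<mu>_def)
    show "\<mu> b (snd z) d = 0" for b d using dd_G_snd(1)[OF i z] by (simp add: \<mu>_def)
    show "\<mu> 0 c d = 0" for c d using linear_0[OF ld] by (simp add: \<mu>_def zero_prod_def[symmetric])
    show "G i z (\<Delta> a c) d + G i z c (\<Delta> a d) = \<mu> (n a) c d" for a c d
    proof -
      have h: "hb i ?z a = hs t (a, - ((1 / t) *\<^sub>R N i ?z a))" using t by (simp add: hb_def hs_def)
      have "dd (\<lambda>y. G i y c d) (hb i ?z a) ?z = dd (\<lambda>y. G i y c d) (a, - ((1 / t) *\<^sub>R N i ?z a)) z"
        unfolding h by (rule dG)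
      also have "(a, - ((1 / t) *\<^sub>R N i ?z a)) = hb i z a - (0, n a)" by (simp add: hb_def n_def)
      also have "dd (\<lambda>y. G i y c d) (hb i z a - (0, n a)) z = dd (\<lambda>y. G i y c d) (hb i z a) z + \<mu> (n a) c d"
        using linear_diff[OF ld] by (simp add: \<mu>_def)
      finally show ?thesis
        unfolding dd_G[OF i z'] dd_G[OF i z] G_hs[OF i z t] \<Delta>_def linear_diff[OF lG(1)] linear_diff[OF lG(2)]
        by simp
    qed
  qed
  then have N: "N i ?z a = t *\<^sub>R N i z a" for a
    using t by (simp add: n_def) (metis (no_types) divide_self_if less_irrefl scaleR_one scaleR_scaleR times_divide_eq_right mult_1_right)
  show hb: "hb i ?z a = hs t (hb i z a)" for a by (simp add: hb_def hs_Pair N)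
  \<comment> \<open>In vertical directions \<open>om\<close> is given explicitly by the derivative
    of \<open>G\<close>, so its scaling follows from \<open>dG\<close>.\<close>
  have V: "om i ?z (0, t *\<^sub>R b) c = om i z (0, b) c" for b
  proof -
    have "G i z (om i ?z (0, t *\<^sub>R b) c - om i z (0, b) c) d = 0" for d
      using om_vert_snd(1)[OF i z', of "t *\<^sub>R b" c d] om_vert_snd(1)[OF i z, of b c d] dG[of c d "(0, b)"]
      by (simp add: G_hs[OF i z t] hs_Pair linear_diff[OF lG(2)])
    then have "om i ?z (0, t *\<^sub>R b) c - om i z (0, b) c = 0" by (rule G_nondegenerate[OF i z])
    then show ?thesis by simp
  qed
  obtain p q where w: "w = (p, q)" by (cases w)
  \<comment> \<open>An arbitrary direction is split into its horizontal and vertical parts, to which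
    \<open>vanish\<close> and \<open>V\<close> apply.\<close>
  have "hs t w = hb i ?z p + (0, t *\<^sub>R (q + N i z p))" by (simp add: w hs_Pair hb_def N scaleR_add_right)
  then have "om i ?z (hs t w) c = om i ?z (hb i ?z p) c + om i ?z (0, t *\<^sub>R (q + N i z p)) c"
    using linear_add[OF linear_om(2)[OF i z']] by simp
  also have "\<dots> = om i z (hb i z p) c + om i z (0, q + N i z p) c"
    using vanish[of p c] by (simp add: \<Delta>_def V)
  also have "\<dots> = om i z w c"
    using linear_add[OF linear_om(2)[OF i z], of "hb i z p" "(0, q + N i z p)"] by (simp add: w hb_def)
  finally show "om i ?z (hs t w) c = om i z w c" .
qed

text \<open>By \<open>dd_hs\<close>, a derivative of \<open>om\<close> at the dilated point in a
  dilated direction reduces to the undilated one, so \<open>Om\<close> inherits the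
  invariance.\<close>

lemma Om_hs:
  assumes i: "i \<in> idx A" and z: "z \<in> cimage S i" and t: "t > 0"
  shows "Om i (hs t z) (hs t v) (hs t w) a = Om i z v w a"
proof -
  have "dd (\<lambda>y. om i y (hs t v) a) (hs t w) (hs t z) = dd (\<lambda>y. om i y v a) w z" for v w
    by (rule dd_hs[OF open_slit[OF i] z smooth_on_differentiable[OF smooth_om[OF i] open_slit[OF i] hs_cimage[OF i z t]]])
      (rule om_hs(1)[OF i _ t])
  then show ?thesis by (simp add: Om_def om_hs(1)[OF i z t])
qed

end

subsection \<open>Traces\<close>

text \<open>\<open>endo_trace\<close> uses an unspecified basis of the fibre, so independence of
  that choice has to be shown: expand the images in the standard basis, exchange the two sums, and
  recognise the inner sum as the expansion of a standard basis vector.\<close>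

lemma endo_trace_transport:
  fixes \<phi> :: "'e::euclidean_space \<Rightarrow> 'v::real_vector" and h :: "'e \<Rightarrow> 'e"
  assumes \<phi>: "linear \<phi>" "inj \<phi>" "\<phi> ` UNIV = S" and h: "linear h" and f: "\<And>x. f (\<phi> x) = \<phi> (h x)"
  shows "endo_trace S f = (\<Sum>b\<in>Basis. h b \<bullet> b)"
proof -
  define B where "B = (SOME B. B \<subseteq> S \<and> independent B \<and> S \<subseteq> span B)"
  have span: "span (\<phi> ` Basis) = S" using linear_span_image[OF \<phi>(1), of Basis] \<phi>(3) by simp
  have "\<exists>B. B \<subseteq> S \<and> independent B \<and> S \<subseteq> span B"
    by (meson maximal_independent_subset)
  then have "B \<subseteq> S \<and> independent B \<and> S \<subseteq> span B" unfolding B_def by (rule someI_ex)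
  then have B: "B \<subseteq> S" "independent B" "S \<subseteq> span B" by auto
  \<comment> \<open>The unknown basis is independent and lies in the span of the finite image of
    \<open>Basis\<close>.\<close>
  have fin: "finite B"
    using independent_span_bound[of "\<phi> ` Basis" B] B span by auto
  define r where "r = (\<lambda>c x. representation B (\<phi> x) c)"
  have sp: "\<phi> x \<in> span B" for x using B(3) \<phi>(3) by auto
  have r_sum: "r c (\<Sum>b\<in>Basis. g b *\<^sub>R b) = (\<Sum>b\<in>Basis. g b * r c b)" for c and g :: "'e \<Rightarrow> real"
    using representation_sum[OF B(2), of Basis "\<lambda>b. g b *\<^sub>R \<phi> b"] representation_scale[OF B(2) sp] sp
    by (simp add: r_def linear_sum[OF \<phi>(1)] linear_scale[OF \<phi>(1)] span_scale)
  have expand: "(\<Sum>c\<in>B. r c x *\<^sub>R inv \<phi> c) = x" for x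
  proof -
    have "\<phi> (\<Sum>c\<in>B. r c x *\<^sub>R inv \<phi> c) = (\<Sum>c\<in>B. r c x *\<^sub>R \<phi> (inv \<phi> c))"
      by (simp add: linear_sum[OF \<phi>(1)] linear_scale[OF \<phi>(1)])
    also have "\<dots> = (\<Sum>c\<in>B. r c x *\<^sub>R c)"
      using B(1) \<phi>(3) by (intro sum.cong refl) (metis f_inv_into_f subsetD)
    also have "\<dots> = \<phi> x"
      unfolding r_def by (rule sum_representation_eq[OF B(2) sp fin order_refl])
    finally show ?thesis using \<phi>(2) by (simp add: inj_eq)
  qed
  have "endo_trace S f = (\<Sum>c\<in>B. representation B (f c) c)"
    by (simp add: endo_trace_def B_def Let_def)
  also have "\<dots> = (\<Sum>c\<in>B. r c (h (inv \<phi> c)))"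
    using B(1) \<phi>(3) by (intro sum.cong refl) (metis f f_inv_into_f r_def subsetD)
  also have "\<dots> = (\<Sum>c\<in>B. \<Sum>b\<in>Basis. (h (inv \<phi> c) \<bullet> b) * r c b)"
    by (intro sum.cong refl) (subst r_sum[symmetric], simp add: euclidean_representation)
  also have "\<dots> = (\<Sum>b\<in>Basis. \<Sum>c\<in>B. (h (inv \<phi> c) \<bullet> b) * r c b)"
    by (rule sum.swap)
  also have "\<dots> = (\<Sum>b\<in>Basis. h (\<Sum>c\<in>B. r c b *\<^sub>R inv \<phi> c) \<bullet> b)"
    by (simp add: linear_sum[OF h] linear_scale[OF h] inner_sum_left mult.commute)
  finally show ?thesis by (simp add: expand)
qed

context cartan_atlas
begin

subsection \<open>The curvature tensor in a chart\<close>

lemma smooth_Om: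
  assumes i: "i \<in> idx A"
  shows "smooth_on (cimage S i) (\<lambda>z. Om i z v w a)"
  unfolding Om_def
  by (intro smooth_on_add smooth_on_diff smooth_on_dd smooth_om[OF i] open_slit[OF i]
      smooth_on_linear_family[OF open_slit[OF i] smooth_om[OF i] linear_om(1)[OF i] smooth_om[OF i]])

lemma Om_antisym: "Om i z v w a = - Om i z w v a"
  by (simp add: Om_def)

text \<open>Linearity of \<open>om\<close> in each slot holds throughout an open set, so it passes
  to the derivatives.\<close>

lemma linear_Om:
  assumes i: "i \<in> idx A" and z: "z \<in> cimage S i"
  shows "linear (Om i z v w)" "linear (\<lambda>w. Om i z v w a)" "linear (\<lambda>v. Om i z v w a)"
proof -
  note U = open_slit[OF i]
  have d: "(\<lambda>y. om i y v a) differentiable at z" for v a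
    by (rule smooth_on_differentiable[OF smooth_om[OF i] U z])
  have ldir: "linear (\<lambda>w. dd (\<lambda>y. om i y v a) w z)" for v a by (rule linear_dd[OF d])
  have ddadd: "dd (\<lambda>y. F y + H y) w z = dd F w z + dd H w z" if "F differentiable at z" "H differentiable at z"
    for F H :: "'e \<times> 'e \<Rightarrow> 'e" and w by (rule dd_add[OF that])
  note lo = linear_om(1)[OF i] linear_om(2)[OF i]
  have a1: "dd (\<lambda>y. om i y v (a + b)) w z = dd (\<lambda>y. om i y v a) w z + dd (\<lambda>y. om i y v b) w z" for a b v w
  proof -
    have "dd (\<lambda>y. om i y v (a + b)) w z = dd (\<lambda>y. om i y v a + om i y v b) w z"
      by (rule dd_cong[OF U z]) (rule linear_add[OF lo(1)])
    then show ?thesis using ddadd[OF d d] by simp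
  qed
  have a2: "dd (\<lambda>y. om i y v (r *\<^sub>R a)) w z = r *\<^sub>R dd (\<lambda>y. om i y v a) w z" for a v w r
  proof -
    have "dd (\<lambda>y. om i y v (r *\<^sub>R a)) w z = dd (\<lambda>y. r *\<^sub>R om i y v a) w z"
      by (rule dd_cong[OF U z]) (rule linear_scale[OF lo(1)])
    then show ?thesis using dd_linear[OF bounded_linear_scaleR_right d] by simp
  qed
  have v1: "dd (\<lambda>y. om i y (v + v') a) w z = dd (\<lambda>y. om i y v a) w z + dd (\<lambda>y. om i y v' a) w z" for a v v' w
  proof -
    have "dd (\<lambda>y. om i y (v + v') a) w z = dd (\<lambda>y. om i y v a + om i y v' a) w z"
      by (rule dd_cong[OF U z]) (rule linear_add[OF lo(2)])
    then show ?thesis using ddadd[OF d d] by simp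
  qed
  have v2: "dd (\<lambda>y. om i y (r *\<^sub>R v) a) w z = r *\<^sub>R dd (\<lambda>y. om i y v a) w z" for a v w r
  proof -
    have "dd (\<lambda>y. om i y (r *\<^sub>R v) a) w z = dd (\<lambda>y. r *\<^sub>R om i y v a) w z"
      by (rule dd_cong[OF U z]) (rule linear_scale[OF lo(2)])
    then show ?thesis using dd_linear[OF bounded_linear_scaleR_right d] by simp
  qed
  note simps = linear_add[OF lo(1)[OF z]] linear_scale[OF lo(1)[OF z]] linear_add[OF lo(2)[OF z]]
    linear_scale[OF lo(2)[OF z]] linear_add[OF ldir] linear_scale[OF ldir] a1 a2 v1 v2
  show "linear (Om i z v w)"
    by (rule linearI) (simp_all add: Om_def simps scaleR_add_right scaleR_diff_right)
  show l: "linear (\<lambda>w. Om i z v w a)" for v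
    by (rule linearI) (simp_all add: Om_def simps scaleR_add_right scaleR_diff_right)
  have "(\<lambda>v. Om i z v w a) = (\<lambda>v. - Om i z w v a)" using Om_antisym by blast
  then show "linear (\<lambda>v. Om i z v w a)" using linear_compose_neg[OF l] by simp
qed

definition Rc :: "'i \<Rightarrow> 'e \<times> 'e \<Rightarrow> 'e \<Rightarrow> 'e \<Rightarrow> 'e \<Rightarrow> 'e" where
  "Rc i z a b c = Om i z (hb i z a) (hb i z b) c"

lemma loc_hcurv:
  assumes "i \<in> idx A" "z \<in> cimage S i" "pi_field A X" "pi_field A Y" "pi_field A Z"
  shows "loc S i (hcurv A D X Y Z) z = Rc i z (loc S i X z) (loc S i Y z) (loc S i Z z)"
  unfolding hcurv_def
  by (simp add: loc_curvature[OF assms(1,2) vector_field_bet vector_field_bet] loc_bet assms Rc_def)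

lemma pi_field_hcurv: "pi_field A X \<Longrightarrow> pi_field A Y \<Longrightarrow> pi_field A Z \<Longrightarrow> pi_field A (hcurv A D X Y Z)"
  unfolding hcurv_def by (intro pi_field_curvature vector_field_bet)

lemma linear_Rc:
  assumes i: "i \<in> idx A" and z: "z \<in> cimage S i"
  shows "linear (Rc i z a b)" "linear (\<lambda>b. Rc i z a b c)" "linear (\<lambda>a. Rc i z a b c)"
proof -
  show "linear (Rc i z a b)" unfolding Rc_def[abs_def] using linear_Om(1)[OF i z] by simp
  show "linear (\<lambda>b. Rc i z a b c)" "linear (\<lambda>a. Rc i z a b c)"
    using linear_compose[OF linear_hb[OF i z] linear_Om(2)[OF i z]]
      linear_compose[OF linear_hb[OF i z] linear_Om(3)[OF i z]] by (simp_all add: Rc_def o_def)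
qed

lemma smooth_Rc:
  assumes i: "i \<in> idx A"
  shows "smooth_on (cimage S i) (\<lambda>z. Rc i z a b c)"
  unfolding Rc_def
  by (rule smooth_on_bilinear_family[OF open_slit[OF i] smooth_Om[OF i] linear_Om(3)[OF i] linear_Om(2)[OF i]
      smooth_hb[OF i] smooth_hb[OF i]])

lemma Rc_hs:
  assumes "i \<in> idx A" "z \<in> cimage S i" "t > 0"
  shows "Rc i (hs t z) a b c = Rc i z a b c"
  by (simp add: Rc_def om_hs(2)[OF assms] Om_hs[OF assms])

text \<open>Differentiate \<open>dd_G\<close> once more and antisymmetrise in the two directions:
  second derivatives of \<open>G\<close> commute, the terms with \<open>om\<close> in both slots of
  \<open>G\<close> cancel, and the rest assembles to \<open>Om\<close>.\<close>

lemma G_Om_antisym: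
  assumes i: "i \<in> idx A" and z: "z \<in> cimage S i"
  shows "G i z (Om i z v w a) b + G i z a (Om i z v w b) = 0"
proof -
  note U = open_slit[OF i] and lG = linear_G[OF i]
  have c: "smooth_on (cimage S i) (\<lambda>y. c)" for c :: 'e by (rule smooth_on_const)
  have D: "dd (dd (\<lambda>y. G i y a b) w) v z =
      G i z (om i z v (om i z w a)) b + G i z (om i z w a) (om i z v b) + G i z (dd (\<lambda>y. om i y w a) v z) b
      + (G i z (om i z v a) (om i z w b) + G i z a (om i z v (om i z w b)) + G i z a (dd (\<lambda>y. om i y w b) v z))" for v w
  proof -
    have 1: "dd (\<lambda>y. G i y (om i y w a) b) v z = dd (\<lambda>y. G i y (om i z w a) b) v z + G i z (dd (\<lambda>y. om i y w a) v z) b"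
      using dd_bilinear_family[OF U z smooth_G[OF i] lG(2) lG(1) smooth_om[OF i] c, of w a b v] linear_0[OF lG(1)[OF z]] by simp
    have 2: "dd (\<lambda>y. G i y a (om i y w b)) v z = dd (\<lambda>y. G i y a (om i z w b)) v z + G i z a (dd (\<lambda>y. om i y w b) v z)"
      using dd_bilinear_family[OF U z smooth_G[OF i] lG(2) lG(1) c smooth_om[OF i], of a w b v] linear_0[OF lG(2)[OF z]] by simp
    have "dd (dd (\<lambda>y. G i y a b) w) v z = dd (\<lambda>y. G i y (om i y w a) b + G i y a (om i y w b)) v z"
      by (rule dd_cong[OF U z]) (rule dd_G[OF i])
    also have "\<dots> = dd (\<lambda>y. G i y (om i y w a) b) v z + dd (\<lambda>y. G i y a (om i y w b)) v z"
      by (rule dd_add; rule smooth_on_differentiable[OF smooth_on_bilinear_family[OF U smooth_G[OF i] lG(2) lG(1)] U z])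
        (assumption | rule smooth_om[OF i] c)+
    finally show ?thesis by (simp add: 1 2 dd_G[OF i z])
  qed
  have "dd (dd (\<lambda>y. G i y a b) w) v z = dd (dd (\<lambda>y. G i y a b) v) w z"
    by (rule dd_dd_commute[OF U z smooth_G[OF i]])
  then show ?thesis
    unfolding D Om_def
    by (simp add: linear_add[OF lG(1)[OF z]] linear_diff[OF lG(1)[OF z]] linear_add[OF lG(2)[OF z]] linear_diff[OF lG(2)[OF z]])
qed

subsection \<open>Pointwise calculus\<close>

lemma point_eqI:
  assumes "u \<in> points S" "a \<in> fibre A u" "b \<in> fibre A u" "\<And>i. i \<in> idx A \<Longrightarrow> u \<in> cdom S i \<Longrightarrow> a i = b i"
  shows "a = b"
  using points_slit_chart[OF assms(1)] slit_cdomD tangent_eqI assms(2-4) by metis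

lemma hcurv_chart:
  assumes "i \<in> idx A" "u \<in> cdom S i" "pi_field A X" "pi_field A Y" "pi_field A Z"
  shows "hcurv A D X Y Z u i = Rc i (cmap S i u) (X u i) (Y u i) (Z u i)"
  using loc_hcurv[OF assms(1) _ assms(3-5), of "cmap S i u"] assms(1,2) by (simp add: loc_cmap)

lemma curvature_chart:
  assumes "i \<in> idx A" "u \<in> cdom S i" "vector_field S V" "vector_field S W" "pi_field A Z"
  shows "curvature A D V W Z u i = Om i (cmap S i u) (V u i) (W u i) (Z u i)"
  using loc_curvature[OF assms(1) _ assms(3-5), of "cmap S i u"] assms(1,2) by (simp add: loc_cmap)

lemma curvature_antisym:
  assumes "u \<in> points S" "vector_field S V" "vector_field S W" "pi_field A Z"
  shows "curvature A D V W Z u = - curvature A D W V Z u"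
proof (rule point_eqI[OF assms(1)])
  show "curvature A D V W Z u \<in> fibre A u" by (intro pi_field_fibre pi_field_curvature assms)
  have "(- curvature A D W V Z) u \<in> fibre A u" by (intro pi_field_fibre pi_field_minus pi_field_curvature assms)
  then show "- curvature A D W V Z u \<in> fibre A u" by simp
  fix i assume "i \<in> idx A" "u \<in> cdom S i"
  then show "curvature A D V W Z u i = (- curvature A D W V Z u) i"
    using Om_antisym[of i "cmap S i u" "V u i" "W u i" "Z u i"] by (simp add: curvature_chart assms(2-4))
qed

lemma hcurv_antisym:
  "u \<in> points S \<Longrightarrow> pi_field A X \<Longrightarrow> pi_field A Y \<Longrightarrow> pi_field A Z \<Longrightarrow> hcurv A D X Y Z u = - hcurv A D Y X Z u"
  unfolding hcurv_def by (intro curvature_antisym vector_field_bet)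

lemma fmetric_linear:
  assumes u: "u \<in> points S" and x: "x \<in> fibre A u" "x' \<in> fibre A u" "y \<in> fibre A u"
  shows "fmetric A L u (x + x') y = fmetric A L u x y + fmetric A L u x' y"
    "fmetric A L u (x - x') y = fmetric A L u x y - fmetric A L u x' y"
    "fmetric A L u (r *\<^sub>R x) y = r * fmetric A L u x y"
    "fmetric A L u x y = fmetric A L u y x"
proof -
  obtain i where i: "i \<in> idx A" "u \<in> cdom S i" using points_slit_chart[OF u] by blast
  have z: "cmap S i u \<in> cimage S i" using i by blast
  note f = fmetric_chart[OF i] and l = linear_G(2)[OF i(1) z]
  show "fmetric A L u (x + x') y = fmetric A L u x y + fmetric A L u x' y"
    "fmetric A L u (x - x') y = fmetric A L u x y - fmetric A L u x' y"
    "fmetric A L u (r *\<^sub>R x) y = r * fmetric A L u x y"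
    using x by (simp_all add: f tangent_add tangent_diff tangent_scale linear_add[OF l] linear_diff[OF l] linear_scale[OF l])
  show "fmetric A L u x y = fmetric A L u y x" using x G_sym[OF i(1) z] by (simp add: f)
qed

subsection \<open>The horizontal Ricci tensor\<close>

definition rc :: "'i \<Rightarrow> 'e \<times> 'e \<Rightarrow> 'e \<Rightarrow> 'e \<Rightarrow> real" where
  "rc i z a c = (\<Sum>b\<in>Basis. Rc i z a b c \<bullet> b)"

text \<open>The chart trivialises the fibre, so \<open>endo_trace_transport\<close> applies;
  \<open>pi_extension\<close> enters only through its value at \<open>u\<close>, since
  \<open>hcurv\<close> is a tensor.\<close>

lemma hricci_chart:
  assumes i: "i \<in> idx A" and u: "u \<in> cdom S i" and X: "pi_field A X" and Y: "pi_field A Y"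
  shows "hricci A D X Y u = rc i (cmap S i u) (X u i) (Y u i)"
proof -
  let ?\<phi> = "tvec A i (fst u)" and ?z = "cmap S i u"
  have p: "fst u \<in> cdom A i" using slit_cdomD[OF u] by blast
  have up: "u \<in> points S" by (rule cdom_points[OF i u])
  have z: "?z \<in> cimage S i" using u by blast
  have t: "?\<phi> a \<in> fibre A u" for a by (rule tvec_tangent[OF i p])
  have lin: "linear ?\<phi>"
    by (rule linearI; rule tangent_eqI[OF i p]) (use t i p in \<open>simp_all add: tangent_add tangent_scale\<close>)
  have inj: "inj ?\<phi>" using tvec_same[OF i p] by (metis injI)
  have surj: "?\<phi> ` UNIV = fibre A u" using t tangent_eq_tvec[OF i p] by blast
  show ?thesis
    unfolding hricci_def rc_def
  proof (rule endo_trace_transport[OF lin inj surj linear_Rc(2)[OF i z]])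
    fix b
    note E = pi_extension[OF up t[of b]]
    show "hcurv A D X (pi_extension A u (?\<phi> b)) Y u = ?\<phi> (Rc i ?z (X u i) b (Y u i))"
      by (rule tangent_eqI[OF i p pi_field_fibre[OF pi_field_hcurv[OF X E(1) Y] up] t])
        (simp add: hcurv_chart[OF i u X E(1) Y] E(2) i p)
  qed
qed

lemma linear_rc:
  assumes "i \<in> idx A" "z \<in> cimage S i"
  shows "linear (rc i z a)" "linear (\<lambda>a. rc i z a c)"
proof -
  have inner: "linear (\<lambda>x::'e. x \<bullet> d)" for d
    by (rule bounded_linear.linear[OF bounded_linear_inner_left])
  show "linear (rc i z a)" "linear (\<lambda>a. rc i z a c)"
    unfolding rc_def[abs_def]
    using linear_compose[OF linear_Rc(1)[OF assms] inner] linear_compose[OF linear_Rc(3)[OF assms] inner]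
    by (auto intro!: linear_compose_sum simp: o_def)
qed

lemma smooth_rc: "i \<in> idx A \<Longrightarrow> smooth_on (cimage S i) (\<lambda>z. rc i z a c)"
  unfolding rc_def by (intro smooth_on_sum smooth_on_linear[OF bounded_linear_inner_left] smooth_Rc open_slit)

lemma rc_hs: "i \<in> idx A \<Longrightarrow> z \<in> cimage S i \<Longrightarrow> t > 0 \<Longrightarrow> rc i (hs t z) a c = rc i z a c"
  by (simp add: rc_def Rc_hs)

lemma hricci_in_chart:
  assumes "i \<in> idx A" "z \<in> cimage S i" "pi_field A X" "pi_field A Y"
  shows "hricci A D X Y (in_chart S i z) = rc i z (loc S i X z) (loc S i Y z)"
proof -
  obtain u where u: "u \<in> cdom S i" "z = cmap S i u" "u = in_chart S i z" using slit_chartE[OF assms(1,2)] by metis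
  show ?thesis
    using hricci_chart[OF assms(1) u(1) assms(3,4)] unfolding loc_def u(3)[symmetric] u(2)[symmetric] .
qed

lemma smooth_fun_hricci:
  assumes "pi_field A X" "pi_field A Y"
  shows "smooth_fun S (hricci A D X Y)"
  unfolding smooth_fun_def
proof
  fix i assume "i \<in> idx S"
  then have i: "i \<in> idx A" by simp
  have "smooth_on (cimage S i) (\<lambda>z. rc i z (loc S i X z) (loc S i Y z))"
    by (rule smooth_on_bilinear_family[OF open_slit[OF i] smooth_rc[OF i] linear_rc(2)[OF i] linear_rc(1)[OF i]
        pi_field_smooth[OF assms(1) i] pi_field_smooth[OF assms(2) i]])
  then show "smooth_on (cimage S i) (\<lambda>z. hricci A D X Y (in_chart S i z))"
    by (rule smooth_on_cong[OF open_slit[OF i], rotated]) (rule hricci_in_chart[OF i _ assms, symmetric])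
qed

text \<open>Lowering of an index by \<open>G\<close>, read as a vector through the Euclidean inner
  product. \<open>roc\<close> then solves a linear system, and smoothness of Ric_o reduces to
  \<open>smooth_on_inverse_family\<close>.\<close>

definition flatmap :: "'i \<Rightarrow> 'e \<times> 'e \<Rightarrow> 'e \<Rightarrow> 'e" where
  "flatmap i z a = (\<Sum>b\<in>Basis. G i z a b *\<^sub>R b)"

definition roc :: "'i \<Rightarrow> 'e \<times> 'e \<Rightarrow> 'e \<Rightarrow> 'e" where
  "roc i z a = inv (flatmap i z) (\<Sum>b\<in>Basis. rc i z a b *\<^sub>R b)"

lemma linear_flatmap: "i \<in> idx A \<Longrightarrow> z \<in> cimage S i \<Longrightarrow> linear (flatmap i z)"
  by (rule linearI) (simp_all add: flatmap_def linear_add[OF linear_G(2)] linear_scale[OF linear_G(2)]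
      scaleR_add_left sum.distrib scaleR_sum_right)

lemma basis_sum_inner:
  fixes f :: "'a::euclidean_space \<Rightarrow> real"
  assumes "linear f"
  shows "(\<Sum>b\<in>Basis. f b *\<^sub>R b) \<bullet> c = f c"
  using linear_basis_expand[OF assms, of c] by (simp add: inner_sum_left inner_commute[of c] mult.commute)

lemma flatmap_inverse:
  assumes i: "i \<in> idx A" and z: "z \<in> cimage S i"
  shows "inv (flatmap i z) (flatmap i z a) = a" "flatmap i z (inv (flatmap i z) a) = a"
proof -
  have inj: "inj (flatmap i z)"
    unfolding linear_injective_0[OF linear_flatmap[OF i z]]
  proof (intro allI impI)
    fix a assume "flatmap i z a = 0"
    then have "G i z a b = 0" for b
      using basis_sum_inner[OF linear_G(1)[OF i z], of a b] by (simp add: flatmap_def)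
    then show "a = 0" by (rule G_nondegenerate[OF i z])
  qed
  then show "inv (flatmap i z) (flatmap i z a) = a" by (rule inv_f_f)
  have "surj (flatmap i z)" using linear_injective_imp_surjective[OF linear_flatmap[OF i z] inj] by simp
  then show "flatmap i z (inv (flatmap i z) a) = a" by (rule surj_f_inv_f)
qed

lemma G_roc:
  assumes i: "i \<in> idx A" and z: "z \<in> cimage S i"
  shows "G i z (roc i z a) c = rc i z a c"
proof -
  have "flatmap i z (roc i z a) = (\<Sum>b\<in>Basis. rc i z a b *\<^sub>R b)"
    by (simp add: roc_def flatmap_inverse[OF i z])
  then show ?thesis
    using basis_sum_inner[OF linear_G(1)[OF i z], of "roc i z a" c] basis_sum_inner[OF linear_rc(1)[OF i z], of a c]
    by (simp add: flatmap_def)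
qed

lemma smooth_roc:
  assumes i: "i \<in> idx A"
  shows "smooth_on (cimage S i) (\<lambda>z. roc i z a)"
  unfolding roc_def
proof (rule smooth_on_inverse_family[of _ "flatmap i" "\<lambda>z. inv (flatmap i z)", OF open_slit[OF i] linear_flatmap[OF i]])
  show "smooth_on (cimage S i) (\<lambda>z. flatmap i z a)" for a
    unfolding flatmap_def by (intro smooth_on_sum smooth_on_scaleR smooth_on_const smooth_G open_slit i)
  show "smooth_on (cimage S i) (\<lambda>z. \<Sum>b\<in>Basis. rc i z a b *\<^sub>R b)"
    by (intro smooth_on_sum smooth_on_scaleR smooth_on_const smooth_rc open_slit i)
qed (simp_all add: flatmap_inverse[OF i])

lemma roc_hs: "i \<in> idx A \<Longrightarrow> z \<in> cimage S i \<Longrightarrow> t > 0 \<Longrightarrow> roc i (hs t z) a = roc i z a"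
  by (simp add: roc_def rc_hs flatmap_def[abs_def] G_hs)

lemma linear_roc:
  assumes i: "i \<in> idx A" and z: "z \<in> cimage S i"
  shows "linear (roc i z)"
proof (rule linearI)
  note lG = linear_G(2)[OF i z] and lr = linear_rc(2)[OF i z]
  fix a b :: 'e and r :: real
  have "roc i z (a + b) - (roc i z a + roc i z b) = 0"
    by (rule G_nondegenerate[OF i z]) (simp add: linear_diff[OF lG] linear_add[OF lG] G_roc[OF i z] linear_add[OF lr])
  then show "roc i z (a + b) = roc i z a + roc i z b" by simp
  have "roc i z (r *\<^sub>R a) - r *\<^sub>R roc i z a = 0"
    by (rule G_nondegenerate[OF i z]) (simp add: linear_diff[OF lG] linear_scale[OF lG] G_roc[OF i z] linear_scale[OF lr])
  then show "roc i z (r *\<^sub>R a) = r *\<^sub>R roc i z a" by simp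
qed

text \<open>Every fibre vector is the value of some \<pi>-vector field, so the test fields
  \<open>Y\<close> determine \<open>w\<close> by nondegeneracy of \<open>G\<close>;
  \<open>G_roc\<close> supplies existence.\<close>

lemma ricci_op_chart:
  assumes i: "i \<in> idx A" and u: "u \<in> cdom S i" and X: "pi_field A X"
  shows "ricci_op A L D X u = tvec A i (fst u) (roc i (cmap S i u) (X u i))"
  unfolding ricci_op_def
proof (rule the_equality)
  let ?z = "cmap S i u" and ?r = "tvec A i (fst u) (roc i (cmap S i u) (X u i))"
  have p: "fst u \<in> cdom A i" using slit_cdomD[OF u] by blast
  have up: "u \<in> points S" by (rule cdom_points[OF i u])
  have z: "?z \<in> cimage S i" using u by blast
  have t: "?r \<in> fibre A u" by (rule tvec_tangent[OF i p])
  show "?r \<in> fibre A u \<and> (\<forall>Y. pi_field A Y \<longrightarrow> fmetric A L u ?r (Y u) = hricci A D X Y u)"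
  proof (intro conjI allI impI t)
    fix Y assume Y: "pi_field A Y"
    show "fmetric A L u ?r (Y u) = hricci A D X Y u"
      by (simp add: fmetric_chart[OF i u t pi_field_fibre[OF Y up]] hricci_chart[OF i u X Y] i p G_roc[OF i z])
  qed
  fix w assume w: "w \<in> fibre A u \<and> (\<forall>Y. pi_field A Y \<longrightarrow> fmetric A L u w (Y u) = hricci A D X Y u)"
  have "w i - roc i ?z (X u i) = 0"
  proof (rule G_nondegenerate[OF i z])
    fix b
    obtain Y where Y: "pi_field A Y" "Y u = tvec A i (fst u) b"
      using exists_pi_field[OF up tvec_tangent[OF i p]] by blast
    have "G i ?z (w i) (Y u i) = rc i ?z (X u i) (Y u i)"
      using w Y(1) fmetric_chart[OF i u, of w "Y u"] pi_field_fibre[OF Y(1) up] hricci_chart[OF i u X Y(1)] by simp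
    then show "G i ?z (w i - roc i ?z (X u i)) b = 0"
      using Y(2) i p by (simp add: linear_diff[OF linear_G(2)[OF i z]] G_roc[OF i z])
  qed
  then show "w = ?r" using tangent_eqI[OF i p, of w ?r] w t i p by simp
qed

lemma loc_ricci_op:
  assumes i: "i \<in> idx A" and z: "z \<in> cimage S i" and X: "pi_field A X"
  shows "loc S i (ricci_op A L D X) z = roc i z (loc S i X z)"
proof -
  obtain u where u: "u \<in> cdom S i" "z = cmap S i u" "fst u \<in> cdom A i" using slit_chartE[OF i z] by metis
  show ?thesis using ricci_op_chart[OF i u(1) X] i u(3) by (simp add: u(2) loc_cmap[OF i u(1)])
qed

lemma pi_field_ricci_op:
  assumes X: "pi_field A X"
  shows "pi_field A (ricci_op A L D X)"
proof (rule pi_fieldI)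
  show "ricci_op A L D X u \<in> fibre A u" if u: "u \<in> points S" for u
  proof -
    obtain i where i: "i \<in> idx A" "u \<in> cdom S i" using points_slit_chart[OF u] by blast
    then have "fst u \<in> cdom A i" using slit_cdomD by blast
    then show ?thesis unfolding ricci_op_chart[OF i X] by (rule tvec_tangent[OF i(1)])
  qed
  fix i assume i: "i \<in> idx A"
  have "smooth_on (cimage S i) (\<lambda>z. roc i z (loc S i X z))"
    by (rule smooth_on_linear_family[OF open_slit[OF i] smooth_roc[OF i] linear_roc[OF i] pi_field_smooth[OF X i]])
  then show "smooth_on (cimage S i) (loc S i (ricci_op A L D X))"
    by (rule smooth_on_cong[OF open_slit[OF i], rotated]) (rule loc_ricci_op[OF i _ X, symmetric])
qed

lemma fmetric_ricci_op:
  assumes u: "u \<in> points S" and X: "pi_field A X" and Y: "pi_field A Y"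
  shows "fmetric A L u (ricci_op A L D X u) (Y u) = hricci A D X Y u"
proof -
  obtain i where i: "i \<in> idx A" "u \<in> cdom S i" using points_slit_chart[OF u] by blast
  have p: "fst u \<in> cdom A i" and z: "cmap S i u \<in> cimage S i" using slit_cdomD i(2) by blast+
  show ?thesis
    using fmetric_chart[OF i pi_field_fibre[OF pi_field_ricci_op[OF X] u] pi_field_fibre[OF Y u]] p i(1)
    by (simp add: ricci_op_chart[OF i X] hricci_chart[OF i X Y] G_roc[OF i(1) z])
qed

end

context cartan_atlas
begin

subsection \<open>Bianchi identities\<close>

lemma nab_point:
  "u \<in> points S \<Longrightarrow> vector_field S V \<Longrightarrow> V u \<in> tangent_space S u"
  using points_slit_chart S.vector_field_tangent by fastforce

lemma nab_cong:
  assumes "u \<in> points S" "vector_field S V" "pi_field A Z" "\<And>v. v \<in> points S \<Longrightarrow> Z v = Z' v"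
  shows "nab D V Z u = nab D V Z' u"
  unfolding nab_def by (rule D_cong[OF assms(1) nab_point[OF assms(1,2)] assms(3,4)])

lemma nab_add:
  "u \<in> points S \<Longrightarrow> vector_field S V \<Longrightarrow> pi_field A Z \<Longrightarrow> pi_field A Z' \<Longrightarrow>
    nab D V (Z + Z') u = nab D V Z u + nab D V Z' u"
  unfolding nab_def by (intro D_add nab_point)

lemma nab_diff:
  "u \<in> points S \<Longrightarrow> vector_field S V \<Longrightarrow> pi_field A Z \<Longrightarrow> pi_field A Z' \<Longrightarrow>
    nab D V (Z - Z') u = nab D V Z u - nab D V Z' u"
  unfolding nab_def by (intro D_diff nab_point)

lemma nab_minus:
  "u \<in> points S \<Longrightarrow> vector_field S V \<Longrightarrow> pi_field A Z \<Longrightarrow> nab D V (- Z) u = - nab D V Z u"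
  unfolding nab_def by (intro D_minus nab_point)

lemma nab_leibniz:
  "u \<in> points S \<Longrightarrow> vector_field S V \<Longrightarrow> pi_field A Z \<Longrightarrow> smooth_fun S f \<Longrightarrow>
    nab D V (\<lambda>v. f v *\<^sub>R Z v) u = dir_deriv S f u (V u) *\<^sub>R Z u + f u *\<^sub>R nab D V Z u"
  unfolding nab_def by (intro D_leibniz nab_point)

lemma nab_scale:
  "u \<in> points S \<Longrightarrow> vector_field S V \<Longrightarrow> pi_field A Z \<Longrightarrow> nab D V (c *\<^sub>R Z) u = c *\<^sub>R nab D V Z u"
  unfolding nab_def by (intro D_scale nab_point)

lemma nab_curvature:
  assumes u: "u \<in> points S" and V: "vector_field S V" "vector_field S V1" "vector_field S V2" and Z: "pi_field A Z"
  shows "nab D V (curvature A D V1 V2 Z) u =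
    - nab D V (nab D V1 (nab D V2 Z)) u + nab D V (nab D V2 (nab D V1 Z)) u + nab D V (nab D (lie_bracket S V1 V2) Z) u"
  unfolding curvature_def
  using u V Z by (simp add: nab_add nab_minus nab_diff pi_field_diff pi_field_nab pi_field_add pi_field_minus S.vector_field_lie_bracket)

lemma curvature_apply:
  "curvature A D V W Z u = - nab D V (nab D W Z) u + nab D W (nab D V Z) u + nab D (lie_bracket S V W) Z u"
  by (simp add: curvature_def)

text \<open>A connection is linear in the direction, so the Jacobi identity of the bracket passes to
  it.\<close>

lemma nab_jacobi:
  assumes u: "u \<in> points S" and V: "vector_field S V1" "vector_field S V2" "vector_field S V3" and Z: "pi_field A Z"
  shows "nab D (lie_bracket S (lie_bracket S V1 V2) V3) Z u + nab D (lie_bracket S (lie_bracket S V2 V3) V1) Z u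
    + nab D (lie_bracket S (lie_bracket S V3 V1) V2) Z u = 0"
proof -
  obtain i where i: "i \<in> idx S" "u \<in> cdom S i" using points_slit_chart[OF u] by auto
  let ?a = "lie_bracket S (lie_bracket S V1 V2) V3 u" and ?b = "lie_bracket S (lie_bracket S V2 V3) V1 u"
    and ?c = "lie_bracket S (lie_bracket S V3 V1) V2 u"
  have t: "?a \<in> tangent_space S u" "?b \<in> tangent_space S u" "?c \<in> tangent_space S u"
    using V by (auto intro!: nab_point u S.vector_field_lie_bracket)
  have "D u (?a + ?b + ?c) Z = D u ?a Z + D u ?b Z + D u ?c Z"
    using D_dir_linear[OF u S.tangent_add[OF t(1,2)] Z t(3), of 1] D_dir_linear[OF u t(1) Z t(2), of 1] by simp
  moreover have "D u 0 Z = 0"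
    using D_dir_linear[OF u S.tangent_0 Z S.tangent_0, of 1] by (metis add_cancel_left_right scaleR_one add_0_right)
  ultimately show ?thesis using S.lie_bracket_jacobi[OF V i] by (simp add: nab_def)
qed

text \<open>Jacobi identity for the operators \<open>nab D V\<close>: triple derivatives cancel
  cyclically, terms with one bracket cancel in pairs, and double brackets vanish by
  \<open>nab_jacobi\<close>.\<close>

lemma second_bianchi:
  assumes u: "u \<in> points S" and V: "vector_field S V1" "vector_field S V2" "vector_field S V3" and Z: "pi_field A Z"
  shows "(nab D V1 (curvature A D V2 V3 Z) u - curvature A D V2 V3 (nab D V1 Z) u - curvature A D (lie_bracket S V1 V2) V3 Z u)
    + (nab D V2 (curvature A D V3 V1 Z) u - curvature A D V3 V1 (nab D V2 Z) u - curvature A D (lie_bracket S V2 V3) V1 Z u)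
    + (nab D V3 (curvature A D V1 V2 Z) u - curvature A D V1 V2 (nab D V3 Z) u - curvature A D (lie_bracket S V3 V1) V2 Z u) = 0"
  using nab_jacobi[OF assms] unfolding nab_curvature[OF u V(1,2,3) Z] nab_curvature[OF u V(2,3,1) Z] nab_curvature[OF u V(3,1,2) Z]
    curvature_apply by (simp add: algebra_simps)

text \<open>The vertical part of \<open>V\<close> is detected by differentiating \<open>eta\<close>:
  the horizontal part contributes 0, and a vertical lift returns its argument because
  \<open>om\<close> vanishes on \<open>(0, b)\<close> and \<open>y\<close>.\<close>

lemma decompose:
  assumes u: "u \<in> points S" and V: "vector_field S V"
  shows "V u = bet A D (\<lambda>v. rho (V v)) u + gam (nab D V eta) u"
proof -
  obtain i where i: "i \<in> idx A" "u \<in> cdom S i" using points_slit_chart[OF u] by blast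
  have iS: "i \<in> idx S" and z: "cmap S i u \<in> cimage S i" using i by auto
  let ?z = "cmap S i u"
  have vf: "vector_field S (bet A D (\<lambda>v. rho (V v)))" "vector_field S (gam (nab D V eta))"
    by (intro vector_field_bet pi_field_rho V vector_field_gam pi_field_nab pi_field_eta)+
  have b: "bet A D (\<lambda>v. rho (V v)) u i = hb i ?z (fst (V u i))"
    using bet_point(2)[of i u "\<lambda>v. rho (V v)", OF i pi_field_fibre[OF pi_field_rho[OF V] u]] by (simp add: rho_def)
  have e: "nab D V eta u i = snd (V u i) + om i ?z (V u i) (snd ?z)"
    unfolding nab_def by (rule D_eta[OF i nab_point[OF u V]])
  have "V u i = hb i ?z (fst (V u i)) + (0, snd (V u i) + N i ?z (fst (V u i)))"
    by (simp add: hb_def)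
  then have "om i ?z (V u i) (snd ?z) = om i ?z (hb i ?z (fst (V u i))) (snd ?z) + om i ?z (0, snd (V u i) + N i ?z (fst (V u i))) (snd ?z)"
    using linear_add[OF linear_om(2)[OF i(1) z]] by metis
  then have e': "nab D V eta u i = snd (V u i) + N i ?z (fst (V u i))"
    using e om_hb_snd[OF i(1) z] om_vert_snd(2)[OF i(1) z] by simp
  show ?thesis
  proof (rule S.tangent_eqI[OF iS i(2) nab_point[OF u V]])
    show "bet A D (\<lambda>v. rho (V v)) u + gam (nab D V eta) u \<in> tangent_space S u"
      by (rule S.tangent_add[OF nab_point[OF u vf(1)] nab_point[OF u vf(2)]])
    show "V u i = (bet A D (\<lambda>v. rho (V v)) u + gam (nab D V eta) u) i"
      by (simp add: b gam_def vlift_def e') (simp add: hb_def)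
  qed
qed

lemma nab_bet_eta_0:
  assumes "u \<in> points S" "vector_field S V" "pi_field A X"
  shows "nab D V (nab D (bet A D X) eta) u = 0"
proof -
  have "nab D V (nab D (bet A D X) eta) u = nab D V (\<lambda>u. 0) u"
    by (rule nab_cong[OF assms(1,2) pi_field_nab[OF vector_field_bet[OF assms(3)] pi_field_eta]])
      (rule nab_bet_eta[OF assms(3)])
  then show ?thesis using D_zero[OF assms(1) nab_point[OF assms(1,2)]] by (simp add: nab_def)
qed

text \<open>\<open>eta\<close> is parallel along horizontal fields, so only the bracket term of the
  curvature survives.\<close>

lemma rhat_eq:
  assumes "u \<in> points S" "pi_field A X" "pi_field A Y"
  shows "rhat A D X Y u = nab D (lie_bracket S (bet A D X) (bet A D Y)) eta u"
  using nab_bet_eta_0[OF assms(1) vector_field_bet[OF assms(2)] assms(3)]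
    nab_bet_eta_0[OF assms(1) vector_field_bet[OF assms(3)] assms(2)]
  by (simp add: rhat_def hcurv_def curvature_apply)

lemma pi_field_rhat: "pi_field A X \<Longrightarrow> pi_field A Y \<Longrightarrow> pi_field A (rhat A D X Y)"
  unfolding rhat_def by (intro pi_field_hcurv pi_field_eta)

lemma rho_bracket:
  assumes "u \<in> points S" "pi_field A X" "pi_field A Y"
  shows "rho (lie_bracket S (bet A D X) (bet A D Y) u) = nab D (bet A D X) Y u - nab D (bet A D Y) X u"
proof -
  have "htorsion A D X Y u = 0"
    using cartan assms by (simp add: cartan_connection_def)
  moreover have "nab D (bet A D X) (\<lambda>u. rho (bet A D Y u)) u = nab D (bet A D X) Y u"
    "nab D (bet A D Y) (\<lambda>u. rho (bet A D X u)) u = nab D (bet A D Y) X u"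
    by (rule nab_cong[OF assms(1) vector_field_bet[OF assms(2)] pi_field_rho[OF vector_field_bet[OF assms(3)]]], erule rho_bet[OF assms(3)])
      (rule nab_cong[OF assms(1) vector_field_bet[OF assms(3)] pi_field_rho[OF vector_field_bet[OF assms(2)]]], erule rho_bet[OF assms(2)])
  ultimately show ?thesis by (simp add: htorsion_def torsion_def)
qed

lemma bracket_bet:
  assumes "i \<in> idx A" "u \<in> cdom S i" "pi_field A X" "pi_field A Y"
  shows "lie_bracket S (bet A D X) (bet A D Y) u i =
    hb i (cmap S i u) (nab D (bet A D X) Y u i - nab D (bet A D Y) X u i) + (0, rhat A D X Y u i)"
proof -
  let ?V = "lie_bracket S (bet A D X) (bet A D Y)"
  have u: "u \<in> points S" by (rule cdom_points[OF assms(1,2)])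
  have V: "vector_field S ?V" by (intro S.vector_field_lie_bracket vector_field_bet assms)
  have "?V u i = bet A D (\<lambda>v. rho (?V v)) u i + gam (nab D ?V eta) u i"
    by (subst decompose[OF u V]) simp
  also have "bet A D (\<lambda>v. rho (?V v)) u i = hb i (cmap S i u) (rho (?V u) i)"
    using bet_point(2)[of i u "\<lambda>v. rho (?V v)", OF assms(1,2) pi_field_fibre[OF pi_field_rho[OF V] u]] .
  also have "rho (?V u) i = nab D (bet A D X) Y u i - nab D (bet A D Y) X u i"
    using rho_bracket[OF u assms(3,4)] by simp
  also have "gam (nab D ?V eta) u i = (0, rhat A D X Y u i)"
    using rhat_eq[OF u assms(3,4)] by (simp add: gam_def vlift_def)
  finally show ?thesis .
qed

text \<open>The torsion depends on values only, so the bracket may be replaced by its splitting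
  \<open>bracket_bet\<close>, whose horizontal part contributes Q = 0.\<close>

lemma torsion_bracket:
  assumes u: "u \<in> points S" and X: "pi_field A X" and Y: "pi_field A Y" and Z: "pi_field A Z"
  shows "torsion A D (lie_bracket S (bet A D X) (bet A D Y)) (bet A D Z) u = mtorsion A D (rhat A D X Y) Z u"
proof -
  let ?V = "lie_bracket S (bet A D X) (bet A D Y)"
  have V: "vector_field S ?V" by (intro S.vector_field_lie_bracket vector_field_bet X Y)
  have pt: "pi_field A (torsion A D V W)" if "vector_field S V" "vector_field S W" for V W
    unfolding torsion_def by (intro pi_field_diff pi_field_nab pi_field_rho S.vector_field_lie_bracket that)
  show ?thesis
    unfolding mtorsion_def
  proof (rule point_eqI[OF u])
    show "torsion A D ?V (bet A D Z) u \<in> fibre A u" "torsion A D (gam (rhat A D X Y)) (bet A D Z) u \<in> fibre A u"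
      by (intro pi_field_fibre[OF _ u] pt V vector_field_bet Z vector_field_gam pi_field_rhat X Y)+
    fix i assume i: "i \<in> idx A" "u \<in> cdom S i"
    have z: "cmap S i u \<in> cimage S i" using i by blast
    let ?z = "cmap S i u" and ?p = "nab D (bet A D X) Y u i - nab D (bet A D Y) X u i" and ?r = "rhat A D X Y u i"
    have tc: "torsion A D V W u i = om i ?z (V u i) (fst (W u i)) - om i ?z (W u i) (fst (V u i))"
      if "vector_field S V" "vector_field S W" for V W
      using loc_torsion[OF i(1) z that] by (simp add: loc_cmap i)
    have bZ: "bet A D Z u i = hb i ?z (Z u i)" by (rule bet_point(2)[of i u Z, OF i pi_field_fibre[OF Z u]])
    have "om i ?z (hb i ?z ?p + (0, ?r)) (Z u i) = om i ?z (hb i ?z ?p) (Z u i) + om i ?z (0, ?r) (Z u i)"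
      by (rule linear_add[OF linear_om(2)[OF i(1) z]])
    moreover have "fst (hb i ?z ?p + (0, ?r)) = ?p" "fst (hb i ?z (Z u i)) = Z u i" by (simp_all add: hb_def)
    ultimately have "torsion A D ?V (bet A D Z) u i = om i ?z (0, ?r) (Z u i)"
      unfolding tc[OF V vector_field_bet[OF Z]] bracket_bet[OF i X Y] bZ
      using om_hb_sym[OF i(1) z, of ?p "Z u i"] by simp
    moreover have "torsion A D (gam (rhat A D X Y)) (bet A D Z) u i = om i ?z (0, ?r) (Z u i)"
      unfolding tc[OF vector_field_gam[OF pi_field_rhat[OF X Y]] vector_field_bet[OF Z]] bZ
      using linear_0[OF linear_om(1)[OF i(1) z]] by (simp add: gam_def vlift_def hb_def)
    ultimately show "torsion A D ?V (bet A D Z) u i = torsion A D (gam (rhat A D X Y)) (bet A D Z) u i" by simp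
  qed
qed

text \<open>Regroup the second derivatives by their outer direction; each inner difference is the
  base part of a bracket, since Q = 0. Every group then becomes the torsion of a bracket and a
  horizontal lift, up to double brackets whose sum vanishes by Jacobi.\<close>

lemma first_bianchi:
  assumes u: "u \<in> points S" and X: "pi_field A X" and Y: "pi_field A Y" and Z: "pi_field A Z"
  shows "hcurv A D X Y Z u + hcurv A D Y Z X u + hcurv A D Z X Y u =
    mtorsion A D (rhat A D X Y) Z u + mtorsion A D (rhat A D Y Z) X u + mtorsion A D (rhat A D Z X) Y u"
proof -
  let ?b = "bet A D" and ?br = "\<lambda>X Y. lie_bracket S (bet A D X) (bet A D Y)"
  have sw: "nab D (?b X) (nab D (?b Y) Z) u - nab D (?b X) (nab D (?b Z) Y) u = nab D (?b X) (\<lambda>v. rho (?br Y Z v)) u"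
    if "pi_field A X" "pi_field A Y" "pi_field A Z" for X Y Z
  proof -
    have p: "pi_field A (nab D (?b Y) Z)" "pi_field A (nab D (?b Z) Y)"
      by (intro pi_field_nab vector_field_bet that)+
    have "nab D (?b X) (nab D (?b Y) Z - nab D (?b Z) Y) u = nab D (?b X) (\<lambda>v. rho (?br Y Z v)) u"
      by (rule nab_cong[OF u vector_field_bet[OF that(1)] pi_field_diff[OF p]]) (simp add: rho_bracket that)
    then show ?thesis using nab_diff[OF u vector_field_bet[OF that(1)] p] by simp
  qed
  have tor: "nab D (?br X Y) Z u - nab D (?b Z) (\<lambda>v. rho (?br X Y v)) u =
      mtorsion A D (rhat A D X Y) Z u + rho (lie_bracket S (?br X Y) (?b Z) u)"
    if XYZ: "pi_field A X" "pi_field A Y" "pi_field A Z" for X Y Z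
  proof -
    have "nab D (?br X Y) (\<lambda>v. rho (?b Z v)) u = nab D (?br X Y) Z u"
      by (intro nab_cong u S.vector_field_lie_bracket vector_field_bet that pi_field_rho rho_bet)
    then show ?thesis
      unfolding torsion_bracket[OF u XYZ, symmetric] by (simp add: torsion_def)
  qed
  obtain i where i: "i \<in> idx S" "u \<in> cdom S i" using points_slit_chart[OF u] by auto
  have jac: "rho (lie_bracket S (?br X Y) (?b Z) u) + rho (lie_bracket S (?br Y Z) (?b X) u) + rho (lie_bracket S (?br Z X) (?b Y) u) = 0"
  proof
    fix k
    have "fst ((lie_bracket S (?br X Y) (?b Z) u + lie_bracket S (?br Y Z) (?b X) u + lie_bracket S (?br Z X) (?b Y) u) k) = 0"
      by (simp only: S.lie_bracket_jacobi[OF vector_field_bet[OF X] vector_field_bet[OF Y] vector_field_bet[OF Z] i]) simp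
    then show "(rho (lie_bracket S (?br X Y) (?b Z) u) + rho (lie_bracket S (?br Y Z) (?b X) u)
        + rho (lie_bracket S (?br Z X) (?b Y) u)) k = 0 k"
      by (simp add: rho_def)
  qed
  have "hcurv A D X Y Z u + hcurv A D Y Z X u + hcurv A D Z X Y u =
     - (nab D (?b X) (nab D (?b Y) Z) u - nab D (?b X) (nab D (?b Z) Y) u)
     - (nab D (?b Y) (nab D (?b Z) X) u - nab D (?b Y) (nab D (?b X) Z) u)
     - (nab D (?b Z) (nab D (?b X) Y) u - nab D (?b Z) (nab D (?b Y) X) u)
     + nab D (?br X Y) Z u + nab D (?br Y Z) X u + nab D (?br Z X) Y u"
    by (simp add: hcurv_def curvature_apply algebra_simps)
  also have "\<dots> = (nab D (?br X Y) Z u - nab D (?b Z) (\<lambda>v. rho (?br X Y v)) u)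
     + (nab D (?br Y Z) X u - nab D (?b X) (\<lambda>v. rho (?br Y Z v)) u)
     + (nab D (?br Z X) Y u - nab D (?b Y) (\<lambda>v. rho (?br Z X v)) u)"
    unfolding sw[OF X Y Z] sw[OF Y Z X] sw[OF Z X Y] by (simp add: algebra_simps)
  also have "\<dots> = mtorsion A D (rhat A D X Y) Z u + mtorsion A D (rhat A D Y Z) X u + mtorsion A D (rhat A D Z X) Y u
     + (rho (lie_bracket S (?br X Y) (?b Z) u) + rho (lie_bracket S (?br Y Z) (?b X) u) + rho (lie_bracket S (?br Z X) (?b Y) u))"
    unfolding tor[OF X Y Z] tor[OF Y Z X] tor[OF Z X Y] by (simp add: algebra_simps)
  finally show ?thesis unfolding jac by simp
qed

text \<open>Insert \<open>bracket_bet\<close> in the first slot. Exchanging the slots of the two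
  terms that come with \<open>nab D (bet A D Y) X\<close> and \<open>rhat A D X Y\<close> accounts
  for their signs.\<close>

lemma curvature_bracket:
  assumes u: "u \<in> points S" and X: "pi_field A X" and Y: "pi_field A Y" and Z: "pi_field A Z" and W: "pi_field A W"
  shows "curvature A D (lie_bracket S (bet A D X) (bet A D Y)) (bet A D Z) W u =
    hcurv A D (nab D (bet A D X) Y) Z W u + hcurv A D Z (nab D (bet A D Y) X) W u - hvcurv A D Z (rhat A D X Y) W u"
proof -
  let ?P = "nab D (bet A D X) Y" and ?Q = "nab D (bet A D Y) X" and ?r = "rhat A D X Y"
  have P: "pi_field A ?P" and Q: "pi_field A ?Q" and r: "pi_field A ?r"
    by (intro pi_field_nab vector_field_bet pi_field_rhat X Y)+
  have V: "vector_field S (lie_bracket S (bet A D X) (bet A D Y))" by (intro S.vector_field_lie_bracket vector_field_bet X Y)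
  note hv = vector_field_bet[OF Z] vector_field_gam[OF r]
  show ?thesis
  proof (rule point_eqI[OF u])
    show "curvature A D (lie_bracket S (bet A D X) (bet A D Y)) (bet A D Z) W u \<in> fibre A u"
      by (rule pi_field_fibre[OF pi_field_curvature[OF V hv(1) W] u])
    show "hcurv A D ?P Z W u + hcurv A D Z ?Q W u - hvcurv A D Z ?r W u \<in> fibre A u"
      unfolding hvcurv_def by (intro tangent_add tangent_diff pi_field_fibre[OF _ u] pi_field_hcurv pi_field_curvature P Q Z W hv)
    fix i assume i: "i \<in> idx A" "u \<in> cdom S i"
    let ?z = "cmap S i u"
    have z: "?z \<in> cimage S i" using i by blast
    have bZ: "bet A D Z u i = hb i ?z (Z u i)" by (rule bet_point(2)[of i u Z, OF i pi_field_fibre[OF Z u]])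
    note lO = linear_Om(3)[OF i(1) z]
    have "curvature A D (lie_bracket S (bet A D X) (bet A D Y)) (bet A D Z) W u i =
        Om i ?z (hb i ?z (?P u i - ?Q u i) + (0, ?r u i)) (hb i ?z (Z u i)) (W u i)"
      by (simp add: curvature_chart[OF i V hv(1) W] bracket_bet[OF i X Y] bZ)
    also have "\<dots> = Rc i ?z (?P u i) (Z u i) (W u i) - Rc i ?z (?Q u i) (Z u i) (W u i) + Om i ?z (0, ?r u i) (hb i ?z (Z u i)) (W u i)"
      by (simp add: linear_add[OF lO] linear_diff[OF lO] linear_diff[OF linear_hb[OF i(1) z]] Rc_def)
    also have "Rc i ?z (?Q u i) (Z u i) (W u i) = - Rc i ?z (Z u i) (?Q u i) (W u i)"
      unfolding Rc_def by (rule Om_antisym)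
    also have "Om i ?z (0, ?r u i) (hb i ?z (Z u i)) (W u i) = - Om i ?z (hb i ?z (Z u i)) (0, ?r u i) (W u i)"
      by (rule Om_antisym)
    also have "Om i ?z (hb i ?z (Z u i)) (0, ?r u i) (W u i) = hvcurv A D Z ?r W u i"
      unfolding hvcurv_def curvature_chart[OF i hv W] bZ by (simp add: gam_def vlift_def)
    finally show "curvature A D (lie_bracket S (bet A D X) (bet A D Y)) (bet A D Z) W u i =
        (hcurv A D ?P Z W u + hcurv A D Z ?Q W u - hvcurv A D Z ?r W u) i"
      by (simp add: hcurv_chart[OF i P Z W] hcurv_chart[OF i Z Q W])
  qed
qed

text \<open>Over the cyclic sum, the curvatures of brackets in \<open>second_bianchi\<close> supply
  exactly the terms of \<open>nab13\<close> in which an argument is differentiated, and the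
  curvature P on the vertical parts of the brackets.\<close>

lemma nab13_hcurv_bianchi:
  assumes u: "u \<in> points S" and X: "pi_field A X" and Y: "pi_field A Y" and Z: "pi_field A Z" and W: "pi_field A W"
  shows "nab13 D (bet A D X) (hcurv A D) Y Z W u + nab13 D (bet A D Y) (hcurv A D) Z X W u + nab13 D (bet A D Z) (hcurv A D) X Y W u =
    - (hvcurv A D X (rhat A D Y Z) W u + hvcurv A D Y (rhat A D Z X) W u + hvcurv A D Z (rhat A D X Y) W u)"
proof -
  have "(nab D (bet A D X) (hcurv A D Y Z W) u - hcurv A D Y Z (nab D (bet A D X) W) u
      - (hcurv A D (nab D (bet A D X) Y) Z W u + hcurv A D Z (nab D (bet A D Y) X) W u - hvcurv A D Z (rhat A D X Y) W u))
    + (nab D (bet A D Y) (hcurv A D Z X W) u - hcurv A D Z X (nab D (bet A D Y) W) u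
      - (hcurv A D (nab D (bet A D Y) Z) X W u + hcurv A D X (nab D (bet A D Z) Y) W u - hvcurv A D X (rhat A D Y Z) W u))
    + (nab D (bet A D Z) (hcurv A D X Y W) u - hcurv A D X Y (nab D (bet A D Z) W) u
      - (hcurv A D (nab D (bet A D Z) X) Y W u + hcurv A D Y (nab D (bet A D X) Z) W u - hvcurv A D Y (rhat A D Z X) W u)) = 0"
    using second_bianchi[OF u vector_field_bet[OF X] vector_field_bet[OF Y] vector_field_bet[OF Z] W]
    unfolding curvature_bracket[OF u X Y Z W] curvature_bracket[OF u Y Z X W] curvature_bracket[OF u Z X Y W] hcurv_def .
  then show ?thesis
    unfolding nab13_def by (simp add: algebra_simps add_eq_0_iff)
qed

subsection \<open>The m-projective curvature tensor\<close>

lemma dir_deriv_fmetric: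
  assumes "u \<in> points S" "vector_field S V" "pi_field A X" "pi_field A Y"
  shows "dir_deriv S (\<lambda>v. fmetric A L v (X v) (Y v)) u (V u) =
    fmetric A L u (nab D V X u) (Y u) + fmetric A L u (X u) (nab D V Y u)"
  using cartan assms nab_point[OF assms(1,2)] by (simp add: cartan_connection_def metrical_def nab_def)

text \<open>Leibniz rule for each summand; since \<nabla>g = 0, the coefficients given by g
  contribute only derivatives of their arguments. Both the differential identity and the derivative
  along \<gamma>\<eta> are read off from this formula.\<close>

lemma nab13_mproj:
  assumes u: "u \<in> points S" and V: "vector_field S V" and X: "pi_field A X" and Y: "pi_field A Y" and Z: "pi_field A Z"
  shows "nab13 D V (mproj A L D) X Y Z u = nab13 D V (hcurv A D) X Y Z u - (1 / (2 * (real DIM('e) - 1))) *\<^sub>R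
     (nab02 A D V (hricci A D) X Z u *\<^sub>R Y u - nab02 A D V (hricci A D) Y Z u *\<^sub>R X u
      + fmetric A L u (X u) (Z u) *\<^sub>R nab11 D V (ricci_op A L D) Y u
      - fmetric A L u (Y u) (Z u) *\<^sub>R nab11 D V (ricci_op A L D) X u)"
proof -
  define c where "c = 1 / (2 * (real DIM('e) - 1))"
  let ?F1 = "\<lambda>v. hricci A D X Z v *\<^sub>R Y v" and ?F2 = "\<lambda>v. hricci A D Y Z v *\<^sub>R X v"
    and ?F3 = "\<lambda>v. fmetric A L v (X v) (Z v) *\<^sub>R ricci_op A L D Y v"
    and ?F4 = "\<lambda>v. fmetric A L v (Y v) (Z v) *\<^sub>R ricci_op A L D X v"
  have p: "pi_field A ?F1" "pi_field A ?F2" "pi_field A ?F3" "pi_field A ?F4"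
    by (intro pi_field_scale smooth_fun_hricci smooth_fun_fmetric pi_field_ricci_op X Y Z)+
  note R = pi_field_ricci_op[OF X] pi_field_ricci_op[OF Y]
  have "mproj A L D X Y Z = hcurv A D X Y Z - c *\<^sub>R (?F1 - ?F2 + ?F3 - ?F4)"
    by (rule ext) (simp add: mproj_def c_def)
  then have "nab D V (mproj A L D X Y Z) u = nab D V (hcurv A D X Y Z) u
      - c *\<^sub>R (nab D V ?F1 u - nab D V ?F2 u + nab D V ?F3 u - nab D V ?F4 u)"
    using p pi_field_hcurv[OF X Y Z]
    by (simp add: nab_diff[OF u V] nab_add[OF u V] nab_scale[OF u V] pi_field_diff pi_field_add pi_field_scale_const)
  then show ?thesis
    unfolding nab13_def nab02_def nab11_def c_def[symmetric] mproj_def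
    by (simp add: nab_leibniz[OF u V] smooth_fun_hricci smooth_fun_fmetric X Y Z R dir_deriv_fmetric[OF u V])
      (simp add: algebra_simps)
qed

section \<open>The derivative along \<gamma>\<eta> in a chart\<close>

lemma gam_eta_chart:
  "i \<in> idx A \<Longrightarrow> z \<in> cimage S i \<Longrightarrow> loc S i (gam eta) z = (0, snd z)"
  by (simp add: loc_gam loc_eta)

lemma loc_nab_gam_eta:
  assumes "i \<in> idx A" "z \<in> cimage S i" "pi_field A Z"
  shows "loc S i (nab D (gam eta) Z) z = dd (loc S i Z) (0, snd z) z"
  using loc_nab[OF assms(1,2) vector_field_gam[OF pi_field_eta] assms(3)] om_vert_snd(3)[OF assms(1,2)]
  by (simp add: gam_eta_chart assms)

lemma vector_field_gam_eta: "vector_field S (gam eta)"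
  by (rule vector_field_gam[OF pi_field_eta])

text \<open>In a chart \<open>\<nabla>\<^bsub>\<gamma>\<eta>\<^esub>\<close> is the radial derivative, which kills every tensor whose components are
  homogeneous of degree 0 in the fibre coordinate.\<close>

lemma nab13_hcurv_eta:
  assumes u: "u \<in> points S" and X: "pi_field A X" and Y: "pi_field A Y" and Z: "pi_field A Z"
  shows "nab13 D (gam eta) (hcurv A D) X Y Z u = 0"
proof -
  obtain i where i: "i \<in> idx A" "u \<in> cdom S i" using points_slit_chart[OF u] by blast
  let ?z = "cmap S i u" and ?n = "nab D (gam eta)"
  have z: "?z \<in> cimage S i" and fu: "fst u \<in> cdom A i" using i slit_cdomD by blast+
  note U = open_slit[OF i(1)]
  have nf: "pi_field A (?n W)" if "pi_field A W" for W by (rule pi_field_nab[OF vector_field_gam_eta that])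
  let ?w = "(0, snd ?z)"
  let ?X = "loc S i X" and ?Y = "loc S i Y" and ?Z = "loc S i Z"
  note sX = pi_field_smooth[OF X i(1)] and sY = pi_field_smooth[OF Y i(1)] and sZ = pi_field_smooth[OF Z i(1)]
  note lR = linear_Rc[OF i(1)] and sR = smooth_Rc[OF i(1)]
  have sXY: "smooth_on (cimage S i) (\<lambda>y. Rc i y (?X y) (?Y y) c)" for c
    by (rule smooth_on_bilinear_family[OF U sR lR(3) lR(2) sX sY])
  have "dd (loc S i (hcurv A D X Y Z)) ?w ?z = dd (\<lambda>y. Rc i y (?X y) (?Y y) (?Z y)) ?w ?z"
    by (rule dd_cong[OF U z]) (rule loc_hcurv[OF i(1) _ X Y Z])
  also have "\<dots> = dd (\<lambda>y. Rc i y (?X y) (?Y y) (?Z ?z)) ?w ?z + Rc i ?z (?X ?z) (?Y ?z) (dd ?Z ?w ?z)"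
    by (rule dd_linear_family[OF U z sXY lR(1) sZ])
  also have "dd (\<lambda>y. Rc i y (?X y) (?Y y) (?Z ?z)) ?w ?z = dd (\<lambda>y. Rc i y (?X ?z) (?Y ?z) (?Z ?z)) ?w ?z
      + Rc i ?z (dd ?X ?w ?z) (?Y ?z) (?Z ?z) + Rc i ?z (?X ?z) (dd ?Y ?w ?z) (?Z ?z)"
    by (rule dd_bilinear_family[OF U z sR lR(3) lR(2) sX sY])
  also have "dd (\<lambda>y. Rc i y (?X ?z) (?Y ?z) (?Z ?z)) ?w ?z = 0"
    by (rule dd_radial[OF smooth_on_differentiable[OF sR U z]]) (rule Rc_hs[OF i(1) z])
  finally have "loc S i (?n (hcurv A D X Y Z)) ?z = loc S i (hcurv A D (?n X) Y Z) ?z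
      + loc S i (hcurv A D X (?n Y) Z) ?z + loc S i (hcurv A D X Y (?n Z)) ?z"
    by (simp add: loc_nab_gam_eta[OF i(1) z] loc_hcurv[OF i(1) z] X Y Z nf pi_field_hcurv)
  then have "nab13 D (gam eta) (hcurv A D) X Y Z u i = 0"
    by (simp add: nab13_def loc_cmap i)
  moreover have "nab13 D (gam eta) (hcurv A D) X Y Z u \<in> fibre A u"
    unfolding nab13_def
    by (intro pi_field_fibre[OF _ u] pi_field_diff nf pi_field_hcurv X Y Z)
  ultimately show ?thesis using tangent_component_0[OF i(1) fu] by blast
qed

lemma nab02_hricci_eta:
  assumes u: "u \<in> points S" and X: "pi_field A X" and Y: "pi_field A Y"
  shows "nab02 A D (gam eta) (hricci A D) X Y u = 0"
proof -
  obtain i where i: "i \<in> idx A" "u \<in> cdom S i" using points_slit_chart[OF u] by blast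
  let ?z = "cmap S i u" and ?n = "nab D (gam eta)"
  have iS: "i \<in> idx S" and z: "?z \<in> cimage S i" using i by auto
  note U = open_slit[OF i(1)]
  have nf: "pi_field A (?n W)" if "pi_field A W" for W by (rule pi_field_nab[OF vector_field_gam_eta that])
  let ?w = "(0, snd ?z)" and ?X = "loc S i X" and ?Y = "loc S i Y"
  have w: "gam eta u i = ?w" using gam_eta_chart[OF i(1) z] by (simp add: loc_cmap i)
  have "dir_deriv S (hricci A D X Y) u (gam eta u) = dd (\<lambda>y. hricci A D X Y (in_chart S i y)) ?w ?z"
    unfolding w[symmetric]
    by (rule S.dir_deriv_chart[OF iS i(2) smooth_on_differentiable[OF S.smooth_fun_chart[OF smooth_fun_hricci[OF X Y] iS] U z] nab_point[OF u vector_field_gam_eta]])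
  also have "\<dots> = dd (\<lambda>y. rc i y (?X y) (?Y y)) ?w ?z"
    by (rule dd_cong[OF U z]) (rule hricci_in_chart[OF i(1) _ X Y])
  also have "\<dots> = dd (\<lambda>y. rc i y (?X ?z) (?Y ?z)) ?w ?z + rc i ?z (dd ?X ?w ?z) (?Y ?z) + rc i ?z (?X ?z) (dd ?Y ?w ?z)"
    by (rule dd_bilinear_family[OF U z smooth_rc[OF i(1)] linear_rc(2)[OF i(1)] linear_rc(1)[OF i(1)]
        pi_field_smooth[OF X i(1)] pi_field_smooth[OF Y i(1)]])
  also have "dd (\<lambda>y. rc i y (?X ?z) (?Y ?z)) ?w ?z = 0"
    by (rule dd_radial[OF smooth_on_differentiable[OF smooth_rc[OF i(1)] U z]]) (rule rc_hs[OF i(1) z])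
  finally show ?thesis
    unfolding nab02_def
    using loc_nab_gam_eta[OF i(1) z X] loc_nab_gam_eta[OF i(1) z Y]
    by (simp add: hricci_chart[OF i] X Y nf loc_cmap i)
qed

lemma nab11_ricci_op_eta:
  assumes u: "u \<in> points S" and X: "pi_field A X"
  shows "nab11 D (gam eta) (ricci_op A L D) X u = 0"
proof -
  obtain i where i: "i \<in> idx A" "u \<in> cdom S i" using points_slit_chart[OF u] by blast
  let ?z = "cmap S i u" and ?n = "nab D (gam eta)"
  have z: "?z \<in> cimage S i" and fu: "fst u \<in> cdom A i" using i slit_cdomD by blast+
  note U = open_slit[OF i(1)]
  have nf: "pi_field A (?n W)" if "pi_field A W" for W by (rule pi_field_nab[OF vector_field_gam_eta that])
  let ?w = "(0, snd ?z)" and ?X = "loc S i X"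
  have "dd (loc S i (ricci_op A L D X)) ?w ?z = dd (\<lambda>y. roc i y (?X y)) ?w ?z"
    by (rule dd_cong[OF U z]) (rule loc_ricci_op[OF i(1) _ X])
  also have "\<dots> = dd (\<lambda>y. roc i y (?X ?z)) ?w ?z + roc i ?z (dd ?X ?w ?z)"
    by (rule dd_linear_family[OF U z smooth_roc[OF i(1)] linear_roc[OF i(1)] pi_field_smooth[OF X i(1)]])
  also have "dd (\<lambda>y. roc i y (?X ?z)) ?w ?z = 0"
    by (rule dd_radial[OF smooth_on_differentiable[OF smooth_roc[OF i(1)] U z]]) (rule roc_hs[OF i(1) z])
  finally have "loc S i (?n (ricci_op A L D X)) ?z = loc S i (ricci_op A L D (?n X)) ?z"
    by (simp add: loc_nab_gam_eta[OF i(1) z] loc_ricci_op[OF i(1) z] X nf pi_field_ricci_op)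
  then have "nab11 D (gam eta) (ricci_op A L D) X u i = 0"
    by (simp add: nab11_def loc_cmap i)
  moreover have "nab11 D (gam eta) (ricci_op A L D) X u \<in> fibre A u"
    unfolding nab11_def by (intro pi_field_fibre[OF _ u] pi_field_diff nf pi_field_ricci_op X)
  ultimately show ?thesis using tangent_component_0[OF i(1) fu] by blast
qed

section \<open>Curvature on concurrent \<pi>-vector fields\<close>

lemma hcurv_concurrent:
  assumes u: "u \<in> points S" and X: "pi_field A X" and Y: "pi_field A Y" and \<zeta>: "concurrent A D \<zeta>"
  shows "hcurv A D X Y \<zeta> u = 0"
proof -
  let ?b = "bet A D"
  let ?V = "lie_bracket S (?b X) (?b Y)"
  have z: "pi_field A \<zeta>" and h: "\<And>X u. pi_field A X \<Longrightarrow> u \<in> points S \<Longrightarrow> nab D (?b X) \<zeta> u = - X u"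
    and v: "\<And>X u. pi_field A X \<Longrightarrow> u \<in> points S \<Longrightarrow> nab D (gam X) \<zeta> u = 0"
    using \<zeta> by (auto simp: concurrent_def)
  \<comment> \<open>The inner derivative equals \<open>- Y\<close> on all of
    \<open>points S\<close>, so a second derivative of \<zeta> is a first derivative of
    \<open>Y\<close>.\<close>
  have nn: "nab D (?b X) (nab D (?b Y) \<zeta>) u = - nab D (?b X) Y u" if "pi_field A X" "pi_field A Y" for X Y
  proof -
    have "nab D (?b X) (nab D (?b Y) \<zeta>) u = nab D (?b X) (- Y) u"
      by (rule nab_cong[OF u vector_field_bet[OF that(1)] pi_field_nab[OF vector_field_bet[OF that(2)] z]]) (simp add: h that)
    then show ?thesis using nab_minus[OF u vector_field_bet[OF that(1)] that(2)] by simp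
  qed
  have V: "vector_field S ?V" by (intro S.vector_field_lie_bracket vector_field_bet X Y)
  have p: "pi_field A (\<lambda>v. rho (?V v))" "pi_field A (nab D ?V eta)"
    by (intro pi_field_rho pi_field_nab V pi_field_eta)+
  \<comment> \<open>Only the horizontal part of the bracket contributes, with minus its base
    component; by \<open>rho_bracket\<close> this cancels the two first derivatives left by
    \<open>nn\<close>.\<close>
  have "nab D ?V \<zeta> u = nab D (?b (\<lambda>v. rho (?V v))) \<zeta> u + nab D (gam (nab D ?V eta)) \<zeta> u"
    using D_dir_linear[OF u nab_point[OF u vector_field_bet[OF p(1)]] z nab_point[OF u vector_field_gam[OF p(2)]], of 1]
      decompose[OF u V] by (simp add: nab_def)
  also have "\<dots> = - rho (?V u)" by (simp add: h v p u)
  finally show ?thesis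
    by (simp add: hcurv_def curvature_apply nn X Y rho_bracket[OF u X Y])
qed

text \<open>Here \<zeta> is the vector on which the curvature acts, so every entry of the trace
  comes from a vanishing value of \<open>hcurv\<close>.\<close>

lemma hricci_concurrent:
  assumes u: "u \<in> points S" and X: "pi_field A X" and \<zeta>: "concurrent A D \<zeta>"
  shows "hricci A D X \<zeta> u = 0"
proof -
  obtain i where i: "i \<in> idx A" "u \<in> cdom S i" using points_slit_chart[OF u] by blast
  have z: "pi_field A \<zeta>" using \<zeta> by (simp add: concurrent_def)
  have fu: "fst u \<in> cdom A i" using i slit_cdomD by blast
  have "Rc i (cmap S i u) (X u i) b (\<zeta> u i) = 0" for b
  proof -
    obtain Y where Y: "pi_field A Y" "Y u = tvec A i (fst u) b"
      using exists_pi_field[OF u tvec_tangent[OF i(1) fu]] by blast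
    have "hcurv A D X Y \<zeta> u i = 0" using hcurv_concurrent[OF u X Y(1) \<zeta>] by simp
    then show ?thesis using hcurv_chart[OF i X Y(1) z] Y(2) i(1) fu by simp
  qed
  then show ?thesis by (simp add: hricci_chart[OF i X z] rc_def)
qed

section \<open>Symmetries of the m-projective curvature tensor\<close>

lemma pi_field_mproj:
  assumes "pi_field A X" "pi_field A Y" "pi_field A Z"
  shows "pi_field A (mproj A L D X Y Z)"
proof -
  have "mproj A L D X Y Z = hcurv A D X Y Z - (1 / (2 * (real DIM('e) - 1))) *\<^sub>R
      ((\<lambda>v. hricci A D X Z v *\<^sub>R Y v) - (\<lambda>v. hricci A D Y Z v *\<^sub>R X v)
       + (\<lambda>v. fmetric A L v (X v) (Z v) *\<^sub>R ricci_op A L D Y v) - (\<lambda>v. fmetric A L v (Y v) (Z v) *\<^sub>R ricci_op A L D X v))"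
    by (rule ext) (simp add: mproj_def)
  moreover have "pi_field A \<dots>"
    by (intro pi_field_diff pi_field_add pi_field_scale_const pi_field_scale pi_field_hcurv smooth_fun_hricci
        smooth_fun_fmetric pi_field_ricci_op assms)
  ultimately show ?thesis by simp
qed

lemma mproj_antisym:
  assumes u: "u \<in> points S" and X: "pi_field A X" and Y: "pi_field A Y" and Z: "pi_field A Z"
  shows "mproj A L D X Y Z u = - mproj A L D Y X Z u"
  using hcurv_antisym[OF u X Y Z] by (simp add: mproj_def algebra_simps)

lemma mproj4_antisym_12:
  assumes u: "u \<in> points S" and X: "pi_field A X" and Y: "pi_field A Y" and Z: "pi_field A Z" and W: "pi_field A W"
  shows "mproj4 A L D X Y Z W u = - mproj4 A L D Y X Z W u"
  using fmetric_linear(3)[OF u pi_field_fibre[OF pi_field_mproj[OF Y X Z] u] pi_field_fibre[OF W u] pi_field_fibre[OF W u], of "-1"]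
    mproj_antisym[OF u X Y Z] by (simp add: mproj4_def)

lemma fmetric_hcurv_antisym:
  assumes u: "u \<in> points S" and X: "pi_field A X" and Y: "pi_field A Y" and Z: "pi_field A Z" and W: "pi_field A W"
  shows "fmetric A L u (hcurv A D X Y Z u) (W u) = - fmetric A L u (hcurv A D X Y W u) (Z u)"
proof -
  obtain i where i: "i \<in> idx A" "u \<in> cdom S i" using points_slit_chart[OF u] by blast
  have z: "cmap S i u \<in> cimage S i" using i by blast
  note f = pi_field_fibre[OF _ u]
  show ?thesis
    using G_Om_antisym[OF i(1) z, of _ _ "Z u i" "W u i"] G_sym[OF i(1) z, of "Z u i"]
    by (simp add: fmetric_chart[OF i f f] pi_field_hcurv X Y Z W hcurv_chart[OF i] Rc_def eq_neg_iff_add_eq_0)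
qed

text \<open>Ric_o is eliminated by its defining property, which exhibits the correction as
  antisymmetric in \<open>Z\<close> and \<open>W\<close>: the first and last summands are exchanged
  up to sign, and so are the two in the middle.\<close>

lemma mproj4_expand:
  assumes u: "u \<in> points S" and X: "pi_field A X" and Y: "pi_field A Y" and Z: "pi_field A Z" and W: "pi_field A W"
  shows "mproj4 A L D X Y Z W u = fmetric A L u (hcurv A D X Y Z u) (W u) - (1 / (2 * (real DIM('e) - 1))) *
    (hricci A D X Z u * fmetric A L u (Y u) (W u) - hricci A D Y Z u * fmetric A L u (X u) (W u)
     + fmetric A L u (X u) (Z u) * hricci A D Y W u - fmetric A L u (Y u) (Z u) * hricci A D X W u)"
proof -
  note f = pi_field_fibre[OF _ u]
  note lin = fmetric_linear(1,2)[OF u _ _ f[OF W]] fmetric_linear(3)[OF u _ f[OF W] f[OF W]]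
  show ?thesis
    unfolding mproj4_def mproj_def
    by (simp add: lin f pi_field_hcurv pi_field_ricci_op X Y Z W tangent_add tangent_diff tangent_scale fmetric_ricci_op[OF u])
qed

lemma mproj4_antisym_34:
  assumes u: "u \<in> points S" and X: "pi_field A X" and Y: "pi_field A Y" and Z: "pi_field A Z" and W: "pi_field A W"
  shows "mproj4 A L D X Y Z W u = - mproj4 A L D X Y W Z u"
  unfolding mproj4_expand[OF u X Y Z W] mproj4_expand[OF u X Y W Z] fmetric_hcurv_antisym[OF u X Y Z W]
  by (simp add: algebra_simps)

end

theorem proposition3p2:
  fixes M :: "'m topology"
    and A :: "('i, 'm, 'e::euclidean_space) atlas"
    and L :: "'m \<times> ('i \<Rightarrow> 'e) \<Rightarrow> real"
    and D :: "('i, 'm, 'e) conn"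
  assumes manifold: "smooth_manifold M A"
    and dim: "DIM('e) \<ge> 3"
    and finsler: "finsler_structure A L"
    and cartan: "cartan_connection A L D"
    and ricci_nonzero: "\<exists>X Y. pi_field A X \<and> pi_field A Y \<and>
          (\<exists>u\<in>points (slit_bundle A). hricci A D X Y u \<noteq> 0)"
  shows "\<forall>X Y Z W. pi_field A X \<longrightarrow> pi_field A Y \<longrightarrow> pi_field A Z \<longrightarrow> pi_field A W \<longrightarrow>
    (\<forall>u\<in>points (slit_bundle A).
      mproj4 A L D X Y Z W u = - mproj4 A L D Y X Z W u \<and>
      mproj4 A L D X Y Z W u = - mproj4 A L D X Y W Z u \<and>
      cyc (\<lambda>X Y Z. mproj A L D X Y Z u) X Y Z =
        cyc (\<lambda>X Y Z. mtorsion A D (rhat A D X Y) Z u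
          - (1 / (2 * (real DIM('e) - 1))) *\<^sub>R
              (hricci A D X Z u *\<^sub>R Y u - hricci A D Y Z u *\<^sub>R X u
               + fmetric A L u (X u) (Z u) *\<^sub>R ricci_op A L D Y u
               - fmetric A L u (Y u) (Z u) *\<^sub>R ricci_op A L D X u)) X Y Z \<and>
      cyc (\<lambda>X Y Z. nab13 D (bet A D X) (mproj A L D) Y Z W u) X Y Z =
        - cyc (\<lambda>X Y Z. hvcurv A D X (rhat A D Y Z) W u
          + (1 / (2 * (real DIM('e) - 1))) *\<^sub>R
              (nab02 A D (bet A D X) (hricci A D) Y W u *\<^sub>R Z u
               - nab02 A D (bet A D X) (hricci A D) Z W u *\<^sub>R Y u
               + fmetric A L u (Y u) (W u) *\<^sub>R nab11 D (bet A D X) (ricci_op A L D) Z u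
               - fmetric A L u (Z u) (W u) *\<^sub>R nab11 D (bet A D X) (ricci_op A L D) Y u)) X Y Z \<and>
      nab13 D (gam eta) (mproj A L D) X Y Z u = 0 \<and>
      (\<forall>\<zeta>. concurrent A D \<zeta> \<longrightarrow>
        mproj A L D X Y \<zeta> u = (1 / (2 * (real DIM('e) - 1))) *\<^sub>R
          (fmetric A L u (Y u) (\<zeta> u) *\<^sub>R ricci_op A L D X u
           - fmetric A L u (X u) (\<zeta> u) *\<^sub>R ricci_op A L D Y u)))"
proof -
  interpret smooth_atlas A by (rule manifold_smooth_atlas[OF manifold])
  interpret cartan_atlas A D L
  proof unfold_locales
    show "\<exists>U \<psi>. cutoff A i U \<psi> \<and> cmap A i p \<in> U" if "i \<in> idx A" "p \<in> cdom A i" for i p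
      by (rule manifold_cutoff[OF manifold that])
  qed (use cartan finsler in \<open>auto simp: cartan_connection_def regular_connection_def\<close>)
  show ?thesis
  proof (intro allI impI ballI conjI)
    fix X Y Z W u
    assume X: "pi_field A X" and Y: "pi_field A Y" and Z: "pi_field A Z" and W: "pi_field A W" and u: "u \<in> points S"
    show "mproj4 A L D X Y Z W u = - mproj4 A L D Y X Z W u" by (rule mproj4_antisym_12[OF u X Y Z W])
    show "mproj4 A L D X Y Z W u = - mproj4 A L D X Y W Z u" by (rule mproj4_antisym_34[OF u X Y Z W])
    define c where "c = 1 / (2 * (real DIM('e) - 1))"
    \<comment> \<open>The correction bracket is the same on both sides, so this is the first Bianchi
      identity.\<close>
    show "cyc (\<lambda>X Y Z. mproj A L D X Y Z u) X Y Z =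
        cyc (\<lambda>X Y Z. mtorsion A D (rhat A D X Y) Z u
          - (1 / (2 * (real DIM('e) - 1))) *\<^sub>R
              (hricci A D X Z u *\<^sub>R Y u - hricci A D Y Z u *\<^sub>R X u
               + fmetric A L u (X u) (Z u) *\<^sub>R ricci_op A L D Y u
               - fmetric A L u (Y u) (Z u) *\<^sub>R ricci_op A L D X u)) X Y Z"
      using first_bianchi[OF u X Y Z] unfolding cyc_def mproj_def by (simp add: add_diff_eq diff_add_eq diff_diff_eq)
    \<comment> \<open>Here \<open>n\<close> and \<open>h\<close> stand for derivatives of the
      m-projective tensor and of R, \<open>q\<close> for the derivative of the correction bracket
      and \<open>p\<close> for the terms with P; the cyclic sum becomes a linear identity.\<close>
    have alg: "n = h - c *\<^sub>R q \<Longrightarrow> n' = h' - c *\<^sub>R q' \<Longrightarrow> n'' = h'' - c *\<^sub>R q'' \<Longrightarrow> h + h' + h'' = - (p + p' + p'') \<Longrightarrow>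
        n + n' + n'' = - (p + c *\<^sub>R q + (p' + c *\<^sub>R q') + (p'' + c *\<^sub>R q''))"
      for n n' n'' h h' h'' p p' p'' q q' q'' :: "'i \<Rightarrow> 'e"
    proof -
      assume a: "n = h - c *\<^sub>R q" "n' = h' - c *\<^sub>R q'" "n'' = h'' - c *\<^sub>R q''" and h: "h + h' + h'' = - (p + p' + p'')"
      have "n + n' + n'' = (h + h' + h'') - c *\<^sub>R q - c *\<^sub>R q' - c *\<^sub>R q''" by (simp add: a)
      then show ?thesis unfolding h by simp
    qed
    show "cyc (\<lambda>X Y Z. nab13 D (bet A D X) (mproj A L D) Y Z W u) X Y Z =
        - cyc (\<lambda>X Y Z. hvcurv A D X (rhat A D Y Z) W u
          + (1 / (2 * (real DIM('e) - 1))) *\<^sub>R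
              (nab02 A D (bet A D X) (hricci A D) Y W u *\<^sub>R Z u
               - nab02 A D (bet A D X) (hricci A D) Z W u *\<^sub>R Y u
               + fmetric A L u (Y u) (W u) *\<^sub>R nab11 D (bet A D X) (ricci_op A L D) Z u
               - fmetric A L u (Z u) (W u) *\<^sub>R nab11 D (bet A D X) (ricci_op A L D) Y u)) X Y Z"
      unfolding cyc_def c_def[symmetric]
      by (rule alg[OF nab13_mproj[OF u vector_field_bet[OF X] Y Z W, folded c_def]
            nab13_mproj[OF u vector_field_bet[OF Y] Z X W, folded c_def]
            nab13_mproj[OF u vector_field_bet[OF Z] X Y W, folded c_def] nab13_hcurv_bianchi[OF u X Y Z W]])
    show "nab13 D (gam eta) (mproj A L D) X Y Z u = 0"
      using nab13_mproj[OF u vector_field_gam_eta X Y Z]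
      by (simp add: nab13_hcurv_eta[OF u X Y Z] nab02_hricci_eta[OF u] nab11_ricci_op_eta[OF u] X Y Z)
    fix \<zeta> assume z: "concurrent A D \<zeta>"
    show "mproj A L D X Y \<zeta> u = (1 / (2 * (real DIM('e) - 1))) *\<^sub>R
          (fmetric A L u (Y u) (\<zeta> u) *\<^sub>R ricci_op A L D X u
           - fmetric A L u (X u) (\<zeta> u) *\<^sub>R ricci_op A L D Y u)"
      unfolding mproj_def c_def[symmetric]
      by (simp add: hcurv_concurrent[OF u X Y z] hricci_concurrent[OF u X z] hricci_concurrent[OF u Y z] scaleR_diff_right)
  qed
qed

end
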